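(* Let $\vec U\in L^2_{loc}(\mathbb{R}^3)$ be a weak solution of the stationary Navier–Stokes equations $$-\Delta \vec U+(\vec U\cdot\nabla)\vec U+\nabla P=0,\qquad \operatorname{div}\vec U=0\quad\text{in }\mathbb{R}^3 .$$ Let $9/2<r\le q<+\infty$. If $\vec U\in L^{r,q}(\mathbb{R}^3)$ and moreover $$\sup_{R>1} R^{2-\frac{9}{r}}\,\|\vec U\|_{L^{r,q}(\mathcal C(R/4,2R))}<+\infty,$$ then $\vec U=0$.
   Context: A weak solution is a pair $(\vec U,P)\in L^2_{loc}(\mathbb{R}^3)^3\times\mathcal D'(\mathbb{R}^3)$ satisfying the equations in the sense of distributions. For a measurable $f$ on $\mathbb{R}^3$, let $d_f(\alpha)=|\{x:|f(x)|>\alpha\}|$. For $1\le r<\infty$, $1\le q<\infty$, the Lorentz space $L^{r,q}(\mathbb{R}^3)$ consists of measurable $f$ with $\|f\|_{L^{r,q}}=r^{1/q}\left(\int_0^\infty(\alpha\, d_f(\alpha)^{1/r})^q\,\frac{d\alpha}{\alpha}\right)^{1/q}<\infty$; norms of vector fields are taken of $|\vec U|$. For $0<a<b$, $\mathcal C(a,b)=\{x\in\mathbb{R}^3: a\le|x|\le b\}$, and $\|\vec U\|_{L^{r,q}(\mathcal C(a,b))}$ denotes $\|\mathbf 1_{\mathcal C(a,b)}\vec U\|_{L^{r,q}}$. *)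

theory Defs
  imports "HOL-Analysis.Analysis"
begin

type_synonym R3 = "real^3"

fun dpart :: "3 list \<Rightarrow> (R3 \<Rightarrow> real) \<Rightarrow> R3 \<Rightarrow> real" where
  "dpart [] f = f"
| "dpart (i # is) f = (\<lambda>x. frechet_derivative (dpart is f) (at x) (axis i 1))"

definition test_fun :: "(R3 \<Rightarrow> real) \<Rightarrow> bool" where
  "test_fun \<phi> \<longleftrightarrow> (\<forall>is x. dpart is \<phi> differentiable (at x)) \<and> bounded {x. \<phi> x \<noteq> 0}"

definition distribution :: "((R3 \<Rightarrow> real) \<Rightarrow> real) \<Rightarrow> bool" where
  "distribution T \<longleftrightarrow>
     (\<forall>\<phi> \<psi> a b. test_fun \<phi> \<longrightarrow> test_fun \<psi> \<longrightarrow>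
        T (\<lambda>x. a * \<phi> x + b * \<psi> x) = a * T \<phi> + b * T \<psi>) \<and>
     (\<forall>K. compact K \<longrightarrow> (\<exists>C N. \<forall>\<phi>. test_fun \<phi> \<longrightarrow> {x. \<phi> x \<noteq> 0} \<subseteq> K \<longrightarrow>
        \<bar>T \<phi>\<bar> \<le> C * (\<Sum>is\<in>{is. length is \<le> N}. (SUP x. \<bar>dpart is \<phi> x\<bar>))))"

definition L2_loc :: "(R3 \<Rightarrow> R3) \<Rightarrow> bool" where
  "L2_loc U \<longleftrightarrow> U \<in> borel_measurable lebesgue \<and>
     (\<forall>K. compact K \<longrightarrow> set_integrable lebesgue K (\<lambda>x. (norm (U x))\<^sup>2))"

definition laplacian :: "(R3 \<Rightarrow> real) \<Rightarrow> R3 \<Rightarrow> real" where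
  "laplacian \<phi> = (\<lambda>x. \<Sum>i\<in>UNIV. dpart [i, i] \<phi> x)"

text \<open>Weak (distributional) solution of the stationary Navier--Stokes equations,
  -\<Delta>U + div(U \<otimes> U) + \<nabla>P = 0, div U = 0, tested componentwise.\<close>
definition weak_NS_solution :: "(R3 \<Rightarrow> R3) \<Rightarrow> ((R3 \<Rightarrow> real) \<Rightarrow> real) \<Rightarrow> bool" where
  "weak_NS_solution U P \<longleftrightarrow> L2_loc U \<and> distribution P \<and>
     (\<forall>\<phi> j. test_fun \<phi> \<longrightarrow>
        (LINT x|lebesgue. U x $ j * (- laplacian \<phi> x))
        - (LINT x|lebesgue. (\<Sum>i\<in>UNIV. U x $ i * U x $ j * dpart [i] \<phi> x))
        - P (dpart [j] \<phi>) = 0) \<and>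
     (\<forall>\<psi>. test_fun \<psi> \<longrightarrow> (LINT x|lebesgue. (\<Sum>i\<in>UNIV. U x $ i * dpart [i] \<psi> x)) = 0)"

definition distrib_fun :: "(R3 \<Rightarrow> R3) \<Rightarrow> real \<Rightarrow> ennreal" where
  "distrib_fun f \<alpha> = emeasure lebesgue {x. norm (f x) > \<alpha>}"

definition in_lorentz :: "real \<Rightarrow> real \<Rightarrow> (R3 \<Rightarrow> R3) \<Rightarrow> bool" where
  "in_lorentz r q f \<longleftrightarrow> f \<in> borel_measurable lebesgue \<and>
     (\<forall>\<alpha>>0. distrib_fun f \<alpha> < \<infinity>) \<and>
     set_integrable lborel {0<..}
       (\<lambda>\<alpha>. (\<alpha> * (enn2real (distrib_fun f \<alpha>)) powr (1/r)) powr q / \<alpha>)"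

definition lorentz_norm :: "real \<Rightarrow> real \<Rightarrow> (R3 \<Rightarrow> R3) \<Rightarrow> real" where
  "lorentz_norm r q f = r powr (1/q) *
     (LINT \<alpha>:{0<..}|lborel. (\<alpha> * (enn2real (distrib_fun f \<alpha>)) powr (1/r)) powr q / \<alpha>) powr (1/q)"

definition annulus :: "real \<Rightarrow> real \<Rightarrow> R3 set" where
  "annulus a b = {x. a \<le> norm x \<and> norm x \<le> b}"

definition restrict_to :: "R3 set \<Rightarrow> (R3 \<Rightarrow> R3) \<Rightarrow> R3 \<Rightarrow> R3" where
  "restrict_to A f = (\<lambda>x. if x \<in> A then f x else 0)"

end

theory Submission
  imports Defs "HOL-Computational_Algebra.Polynomial" "HOL-Real_Asymp.Real_Asymp"
begin

text \<open>
  Dyadic summation of the weak-type bound contained in the Lorentz norm turns the hypotheses into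
  \<open>\<integral>\<^bsub>B(R)\<^esub> |U|\<^sup>4 \<le> D R\<^sup>\<gamma>\<close> for \<open>R \<ge> 1\<close>, with some \<open>\<gamma> < 1/3\<close>.  This is all that is used about \<open>U\<close>; in particular
  no regularity theory and no Calderon-Zygmund theory is needed.

  Let \<open>\<rho>\<^sub>s\<close> be the mollifier at scale \<open>s\<close> obtained as the Laplacian of a softened Newtonian potential, so that
  \<open>\<rho>\<^sub>e - \<rho>\<^sub>R = \<Delta>Z\<close> with a test function \<open>Z\<close> supported in \<open>B(R)\<close>.  With \<open>u = \<rho>\<^sub>e * U\<close> and a cut-off \<open>\<psi>\<close> at scale \<open>R\<close>,
  the field \<open>\<Phi> = (\<Delta> - \<nabla> div)(Z * \<psi>u) = \<rho>\<^sub>e * \<psi>u - \<rho>\<^sub>R * \<psi>u - \<nabla>(Z * (u \<cdot> \<nabla>\<psi>))\<close> is a divergence free test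
  field, hence the pressure disappears.  Its first term yields the local energy \<open>\<integral>\<psi>|\<nabla>u|\<^sup>2\<close>, the second
  one is smooth at scale \<open>R\<close>, and the last one is controlled in \<open>L\<^sup>2\<close> through \<open>\<parallel>D\<^sup>2w\<parallel> = \<parallel>\<Delta>w\<parallel>\<close>.  The commutator
  \<open>\<rho>\<^sub>e * (U \<otimes> U) - u \<otimes> u\<close> tends to zero in \<open>L\<^sup>2\<close> because \<open>U\<close> is locally in \<open>L\<^sup>4\<close>.
  If \<open>m\<close> denotes the average size of \<open>U\<close> on \<open>B(R)\<close>, then \<open>e \<rightarrow> 0\<close> gives \<open>\<integral>\<psi>|\<nabla>u|\<^sup>2 \<lesssim> m\<^sup>2R + m\<^sup>3R\<^sup>2\<close>, which
  tends to zero as \<open>R \<rightarrow> \<infinity>\<close> precisely when \<open>\<gamma> < 1/3\<close>; so \<open>U\<close> is constant and, having slow growth, zero.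
\<close>

subsection \<open>Smooth functions\<close>

text \<open>Testing with \<psi>U itself fails twice: U has no derivatives to begin with, and \<psi>U
  is not divergence free, so the unknown pressure would stay. A field (\<Delta> - \<nabla> div)F has
  divergence zero automatically, and it is a test field if F has compact support. The Newtonian
  potential alone has no compact support, whence the difference of two scales. The exponent 4 is
  dictated by L^2: the commutator must be square integrable to be absorbed by half of the energy,
  and U \<otimes> U is paired with a Hessian in L^2. The numbers come from scaling. A field of size
  m varying on B(R) has Dirichlet energy (m/R)^2 R^3 = m^2 R and cubic flux (m^3/R) R^3 = m^3 R^2.
  With m^4 R^3 = R^\<gamma> these are R^((\<gamma>-1)/2) and R^((3\<gamma>-1)/4), which explains
  1/3. On an annulus of radius R the hypothesis bounds the fourth moment by (R^(9/r-2))^4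
  (R^3)^(1-4/r) = R^(24/r-5), and 24/r - 5 < 1/3 means r > 9/2.\<close>

definition pd :: "3 \<Rightarrow> (R3 \<Rightarrow> real) \<Rightarrow> R3 \<Rightarrow> real" where
  "pd i f = (\<lambda>x. frechet_derivative f (at x) (axis i 1))"

definition smooth :: "(R3 \<Rightarrow> real) \<Rightarrow> bool" where
  "smooth f \<longleftrightarrow> (\<forall>is x. dpart is f differentiable (at x))"

lemma dpart_Cons: "dpart (i # is) f = pd i (dpart is f)"
  by (simp add: pd_def)

declare dpart.simps(2) [simp del]

lemma dpart_single: "dpart [i] f = pd i f"
  by (simp add: dpart_Cons)

lemma dpart_append: "dpart (is @ js) f = dpart is (dpart js f)"
  by (induction "is") (simp_all add: dpart_Cons)

lemma test_fun_iff: "test_fun f \<longleftrightarrow> smooth f \<and> bounded {x. f x \<noteq> 0}"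
  by (simp add: test_fun_def smooth_def)

lemma laplacian_eq: "laplacian f = (\<lambda>x. \<Sum>i\<in>UNIV. pd i (pd i f) x)"
  by (simp add: laplacian_def dpart_Cons)

lemma smooth_differentiable: "smooth f \<Longrightarrow> f differentiable (at x)"
  unfolding smooth_def by (metis dpart.simps(1))

lemma smooth_pd: "smooth f \<Longrightarrow> smooth (pd i f)"
  unfolding smooth_def by (metis dpart_append dpart_single)

text \<open>Smoothness is a greatest fixed point, so it suffices to exhibit a family of
  differentiable functions closed under \<open>pd\<close>. This spares inductions over lists of
  derivatives; the families used below are the class \<open>smooth_gen\<close> and the convolutions
  with a fixed function.\<close>

lemma smooth_coinduct:
  assumes "f \<in> S" "\<And>g x. g \<in> S \<Longrightarrow> g differentiable (at x)" "\<And>g i. g \<in> S \<Longrightarrow> pd i g \<in> S"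
  shows "smooth f"
proof -
  have "dpart is f \<in> S" for "is"
    by (induction "is") (use assms in \<open>auto simp: dpart_Cons\<close>)
  then show ?thesis using assms(2) by (auto simp: smooth_def)
qed

lemma pd_eqI: "(f has_derivative D) (at x) \<Longrightarrow> pd i f x = D (axis i 1)"
  unfolding pd_def using frechet_derivative_at by metis

lemma has_derivative_pd:
  assumes "f differentiable (at x)"
  shows "(f has_derivative (\<lambda>h. \<Sum>i\<in>UNIV. h $ i * pd i f x)) (at x)"
proof -
  have d: "(f has_derivative frechet_derivative f (at x)) (at x)"
    using assms frechet_derivative_works by blast
  then interpret l: bounded_linear "frechet_derivative f (at x)"
    by (rule has_derivative_bounded_linear)
  have "frechet_derivative f (at x) h = (\<Sum>i\<in>UNIV. h $ i * pd i f x)" for h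
  proof -
    have "frechet_derivative f (at x) h = frechet_derivative f (at x) (\<Sum>i\<in>UNIV. (h $ i) *s axis i 1)"
      by (simp add: basis_expansion)
    also have "\<dots> = (\<Sum>i\<in>UNIV. frechet_derivative f (at x) ((h $ i) *\<^sub>R axis i 1))"
      by (simp add: l.sum scalar_mult_eq_scaleR)
    also have "\<dots> = (\<Sum>i\<in>UNIV. h $ i * pd i f x)"
      by (simp add: l.scaleR pd_def)
    finally show ?thesis .
  qed
  then show ?thesis using d by presburger
qed

lemma inner_R3: "(x::R3) \<bullet> x = (\<Sum>i\<in>UNIV. (x $ i)\<^sup>2)"
  by (simp add: inner_vec_def power2_eq_square)

text \<open>For p = 1 this is exp(-2/(1-t)), continued flatly by 0. The polynomial in y = 1/(1-t) is
  carried along to make the family closed under differentiation.\<close>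

definition bump :: "real poly \<Rightarrow> real \<Rightarrow> real" where
  "bump p t = (if t < 1 then poly p (1 / (1 - t)) * exp (- (2 / (1 - t))) else 0)"

text \<open>As y = 1/(1-t) has the derivative y^2, p(y) exp(-2y) differentiates to y^2 (p'(y) -
  2p(y)) exp(-2y); the factor y^2 is \<open>[:0, 0, 1:]\<close>.\<close>

definition bump_der :: "real poly \<Rightarrow> real poly" where
  "bump_der p = [:0, 0, 1:] * (pderiv p - smult 2 p)"

lemma poly_exp_tendsto_0: "((\<lambda>y. poly p y * exp (- (2 * y))) \<longlongrightarrow> (0::real)) at_top"
proof -
  have "((\<lambda>y. \<Sum>i\<le>degree p. coeff p i * (y ^ i / exp y) * exp (- y)) \<longlongrightarrow> (\<Sum>i\<le>degree p. coeff p i * 0 * 0)) at_top"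
    by (intro tendsto_intros tendsto_power_div_exp_0
        filterlim_compose[OF exp_at_bot] filterlim_uminus_at_bot_at_top)
  moreover have "(\<Sum>i\<le>degree p. coeff p i * (y ^ i / exp y) * exp (- y)) = poly p y * exp (- (2 * y))" for y
  proof -
    have e: "exp (- (2 * y)) = exp (- y) * exp (- y)"
      by (simp flip: exp_add)
    show ?thesis
      unfolding poly_altdef sum_distrib_right e
      by (intro sum.cong refl) (simp add: exp_minus field_simps)
  qed
  ultimately show ?thesis by simp
qed

lemma bump_has_derivative: "(bump p has_real_derivative bump (bump_der p) t) (at t)"
proof -
  consider "t < 1" | "t > 1" | "t = 1" by linarith
  then show ?thesis
  proof cases
    case 1
    define y where "y = 1 / (1 - t)"
    have y: "((\<lambda>t. 1 / (1 - t)) has_real_derivative y\<^sup>2) (at t)"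
      using 1 by (auto intro!: derivative_eq_intros simp: y_def power2_eq_square)
    have "((\<lambda>t. poly p (1 / (1 - t))) has_real_derivative poly (pderiv p) y * y\<^sup>2) (at t)"
      using DERIV_chain2[OF poly_DERIV y[unfolded y_def]] by (simp add: y_def)
    moreover have "((\<lambda>t. exp (- (2 * (1 / (1 - t))))) has_real_derivative exp (- (2 * y)) * (- (2 * y\<^sup>2))) (at t)"
      using 1 by (auto intro!: derivative_eq_intros y simp: y_def power2_eq_square)
    ultimately have "((\<lambda>t. poly p (1 / (1 - t)) * exp (- (2 * (1 / (1 - t))))) has_real_derivative
        poly (pderiv p) y * y\<^sup>2 * exp (- (2 * y)) + exp (- (2 * y)) * (- (2 * y\<^sup>2)) * poly p y) (at t)"
      unfolding y_def by (rule DERIV_mult)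
    also have "poly (pderiv p) y * y\<^sup>2 * exp (- (2 * y)) + exp (- (2 * y)) * (- (2 * y\<^sup>2)) * poly p y = bump (bump_der p) t"
      using 1 by (simp add: bump_def bump_der_def y_def[symmetric]) (simp add: y_def power2_eq_square algebra_simps)
    finally have "((\<lambda>t. poly p (1 / (1 - t)) * exp (- (2 / (1 - t)))) has_real_derivative bump (bump_der p) t) (at t)"
      by simp
    then show ?thesis
      by (rule has_field_derivative_transform_within_open[where S = "{..<1}"])
        (use 1 in \<open>auto simp: bump_def\<close>)
  next
    case 2
    have "((\<lambda>t. 0) has_real_derivative 0) (at t)" by simp
    then have "(bump p has_real_derivative 0) (at t)"
      by (rule has_field_derivative_transform_within_open[where S = "{1<..}"])
        (use 2 in \<open>auto simp: bump_def\<close>)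
    then show ?thesis using 2 by (simp add: bump_def)
  next
    case 3
    have f: "filterlim (\<lambda>y. 1 / (1 - y)) at_top (at_left (1::real))"
      by real_asymp
    \<comment> \<open>Since the value at 1 is 0, the left difference quotient is -1/(1-y) times the
      function itself, and the factor 1/(1-y) turns \<open>p\<close> into \<open>pCons 0 p\<close>.
      So it is again a polynomial times the exponential, taken at infinity.\<close>
    have "((\<lambda>y. - (poly (pCons 0 p) (1 / (1 - y)) * exp (- (2 * (1 / (1 - y)))))) \<longlongrightarrow> - 0) (at_left 1)"
      by (intro tendsto_minus filterlim_compose[OF poly_exp_tendsto_0 f])
    then have "((\<lambda>y. bump p y / (y - 1)) \<longlongrightarrow> 0) (at_left 1)"
      unfolding minus_zero
    proof (rule Lim_transform_eventually)
      show "\<forall>\<^sub>F y in at_left (1::real). - (poly (pCons 0 p) (1 / (1 - y)) * exp (- (2 * (1 / (1 - y))))) = bump p y / (y - 1)"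
        by (auto simp: eventually_at_filter bump_def field_simps)
    qed
    moreover have "((\<lambda>y. bump p y / (y - 1)) \<longlongrightarrow> 0) (at_right 1)"
      by (rule tendsto_eventually) (auto simp: eventually_at_filter bump_def)
    ultimately have "((\<lambda>y. bump p y / (y - 1)) \<longlongrightarrow> 0) (at 1)"
      by (simp add: filterlim_at_split)
    then show ?thesis using 3
      by (simp add: has_field_derivative_iff bump_def)
  qed
qed

text \<open>A grammar of smooth functions. Treating products, powers and compositions one by one
  would call for rules for iterated derivatives; here a single induction shows that
  \<open>pd\<close> does not leave the class. The rule \<open>base\<close> admits arbitrary smooth
  functions as atoms, so the class coincides with \<open>smooth\<close>.\<close>

inductive smooth_gen :: "(R3 \<Rightarrow> real) \<Rightarrow> bool" where
  base: "smooth f \<Longrightarrow> smooth_gen f"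
| const: "smooth_gen (\<lambda>x. c)"
| coord: "smooth_gen (\<lambda>x. x $ i)"
| add: "smooth_gen f \<Longrightarrow> smooth_gen g \<Longrightarrow> smooth_gen (\<lambda>x. f x + g x)"
| mult: "smooth_gen f \<Longrightarrow> smooth_gen g \<Longrightarrow> smooth_gen (\<lambda>x. f x * g x)"
| powr: "smooth_gen f \<Longrightarrow> (\<And>x. f x > 0) \<Longrightarrow> smooth_gen (\<lambda>x. f x powr a)"
| bump: "smooth_gen f \<Longrightarrow> smooth_gen (\<lambda>x. bump p (f x))"
| affine: "smooth_gen f \<Longrightarrow> smooth_gen (\<lambda>x. f (a + c *\<^sub>R x))"

lemma pd_const: "pd i (\<lambda>x. c) = (\<lambda>x. 0)"
  by (rule ext, subst pd_eqI[where D = "\<lambda>h. 0"]) auto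

lemma pd_coord: "pd i (\<lambda>x. x $ j) = (\<lambda>x. if i = j then 1 else 0)"
  by (rule ext, subst pd_eqI[where D = "\<lambda>h. h $ j"])
    (auto intro!: bounded_linear_imp_has_derivative bounded_linear_vec_nth simp: axis_def)

lemma pd_add':
  assumes "f differentiable (at x)" "g differentiable (at x)"
  shows "pd i (\<lambda>x. f x + g x) x = pd i f x + pd i g x"
  using assms unfolding frechet_derivative_works
  by (subst pd_eqI[OF has_derivative_add]) (auto simp: pd_def)

lemma pd_mult':
  assumes "f differentiable (at x)" "g differentiable (at x)"
  shows "pd i (\<lambda>x. f x * g x) x = pd i f x * g x + f x * pd i g x"
  using assms unfolding frechet_derivative_works
  by (subst pd_eqI[OF has_derivative_mult]) (auto simp: pd_def)

lemma pd_comp':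
  assumes "f differentiable (at x)" "(h has_real_derivative D) (at (f x))"
  shows "(\<lambda>x. h (f x)) differentiable (at x)" "pd i (\<lambda>x. h (f x)) x = D * pd i f x"
proof -
  have "(f has_derivative frechet_derivative f (at x)) (at x)"
    using assms(1) by (simp add: frechet_derivative_works)
  from has_derivative_compose[OF this assms(2)[unfolded has_field_derivative_def]]
  have *: "((\<lambda>x. h (f x)) has_derivative (\<lambda>y. D * frechet_derivative f (at x) y)) (at x)" .
  then show "(\<lambda>x. h (f x)) differentiable (at x)" by (rule differentiableI)
  show "pd i (\<lambda>x. h (f x)) x = D * pd i f x"
    by (subst pd_eqI[OF *]) (simp add: pd_def)
qed

lemma pd_affine':
  assumes "f differentiable (at (a + c *\<^sub>R x))"
  shows "(\<lambda>x. f (a + c *\<^sub>R x)) differentiable (at x)" "pd i (\<lambda>x. f (a + c *\<^sub>R x)) x = c * pd i f (a + c *\<^sub>R x)"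
proof -
  have d: "(f has_derivative frechet_derivative f (at (a + c *\<^sub>R x))) (at (a + c *\<^sub>R x))"
    using assms(1) by (simp add: frechet_derivative_works)
  have "((\<lambda>x. a + c *\<^sub>R x) has_derivative (\<lambda>h. c *\<^sub>R h)) (at x)"
    by (auto intro!: derivative_eq_intros)
  from has_derivative_compose[OF this d]
  have *: "((\<lambda>x. f (a + c *\<^sub>R x)) has_derivative (\<lambda>y. frechet_derivative f (at (a + c *\<^sub>R x)) (c *\<^sub>R y))) (at x)" .
  then show "(\<lambda>x. f (a + c *\<^sub>R x)) differentiable (at x)" by (rule differentiableI)
  interpret l: bounded_linear "frechet_derivative f (at (a + c *\<^sub>R x))"
    using d by (rule has_derivative_bounded_linear)
  show "pd i (\<lambda>x. f (a + c *\<^sub>R x)) x = c * pd i f (a + c *\<^sub>R x)"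
    by (subst pd_eqI[OF *]) (simp add: pd_def l.scaleR)
qed

lemma smooth_gen_step: "smooth_gen f \<Longrightarrow> (\<forall>x. f differentiable (at x)) \<and> (\<forall>i. smooth_gen (pd i f))"
proof (induction rule: smooth_gen.induct)
  case (base f)
  then show ?case using smooth_differentiable smooth_pd smooth_gen.base by blast
next
  case (const c)
  then show ?case by (simp add: pd_const smooth_gen.const)
next
  case (coord i)
  have "(\<lambda>x::R3. x $ i) differentiable (at x)" for x
    by (rule differentiableI[OF bounded_linear_imp_has_derivative[OF bounded_linear_vec_nth]])
  then show ?case by (auto simp: pd_coord intro: smooth_gen.const)
next
  case (add f g)
  then have "pd i (\<lambda>x. f x + g x) = (\<lambda>x. pd i f x + pd i g x)" for i
    by (simp add: pd_add' fun_eq_iff)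
  with add show ?case by (auto intro: smooth_gen.add)
next
  case (mult f g)
  then have "pd i (\<lambda>x. f x * g x) = (\<lambda>x. pd i f x * g x + f x * pd i g x)" for i
    by (simp add: pd_mult' fun_eq_iff)
  with mult show ?case by (auto intro!: smooth_gen.add smooth_gen.mult)
next
  case (powr f a)
  have D: "((\<lambda>y. y powr a) has_real_derivative a * f x powr (a - 1)) (at (f x))" for x
    using powr(2)[of x] has_real_derivative_powr by blast
  have "pd i (\<lambda>x. f x powr a) = (\<lambda>x. a * f x powr (a - 1) * pd i f x)" for i
    using powr pd_comp'(2)[OF _ D] by (simp add: fun_eq_iff)
  moreover have "smooth_gen (\<lambda>x. a * f x powr (a - 1) * pd i f x)" for i
    using powr by (intro smooth_gen.mult smooth_gen.const smooth_gen.powr) auto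
  ultimately show ?case using powr pd_comp'(1)[OF _ D] by auto
next
  case (bump f p)
  have "pd i (\<lambda>x. bump p (f x)) = (\<lambda>x. bump (bump_der p) (f x) * pd i f x)" for i
    using bump pd_comp'(2)[OF _ bump_has_derivative] by (simp add: fun_eq_iff)
  with bump show ?case
    using pd_comp'(1)[OF _ bump_has_derivative] by (auto intro: smooth_gen.mult smooth_gen.bump)
next
  case (affine f a c)
  have "pd i (\<lambda>x. f (a + c *\<^sub>R x)) = (\<lambda>x. c * pd i f (a + c *\<^sub>R x))" for i
    using affine pd_affine'(2) by (simp add: fun_eq_iff)
  moreover have "smooth_gen (\<lambda>x. c * pd i f (a + c *\<^sub>R x))" for i
    using affine by (intro smooth_gen.mult[OF smooth_gen.const smooth_gen.affine]) auto
  ultimately show ?case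
    using affine pd_affine'(1) by auto
qed

lemma smooth_iff_gen: "smooth f \<longleftrightarrow> smooth_gen f"
  using smooth_coinduct[of f "Collect smooth_gen"] smooth_gen_step smooth_gen.base by blast

lemma smooth_const: "smooth (\<lambda>x. c)"
  and smooth_coord: "smooth (\<lambda>x. x $ i)"
  and smooth_add: "smooth f \<Longrightarrow> smooth g \<Longrightarrow> smooth (\<lambda>x. f x + g x)"
  and smooth_mult: "smooth f \<Longrightarrow> smooth g \<Longrightarrow> smooth (\<lambda>x. f x * g x)"
  and smooth_powr: "smooth f \<Longrightarrow> (\<And>x. f x > 0) \<Longrightarrow> smooth (\<lambda>x. f x powr a)"
  and smooth_bump: "smooth f \<Longrightarrow> smooth (\<lambda>x. bump p (f x))"
  and smooth_affine: "smooth f \<Longrightarrow> smooth (\<lambda>x. f (d + c *\<^sub>R x))"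
  unfolding smooth_iff_gen by (blast intro: smooth_gen.intros)+

lemma smooth_cmult: "smooth f \<Longrightarrow> smooth (\<lambda>x. c * f x)"
  by (intro smooth_mult smooth_const)

lemma smooth_minus: "smooth f \<Longrightarrow> smooth (\<lambda>x. - f x)"
  using smooth_cmult[of f "-1"] by simp

lemma smooth_diff: "smooth f \<Longrightarrow> smooth g \<Longrightarrow> smooth (\<lambda>x. f x - g x)"
  using smooth_add[OF _ smooth_minus, of f g] by simp

lemma smooth_sum: "(\<And>i. i \<in> I \<Longrightarrow> smooth (f i)) \<Longrightarrow> smooth (\<lambda>x. \<Sum>i\<in>I. f i x)"
  by (induction I rule: infinite_finite_induct) (auto intro: smooth_add smooth_const)

lemma smooth_power: "smooth f \<Longrightarrow> smooth (\<lambda>x. f x ^ n)"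
  by (induction n) (auto intro: smooth_mult smooth_const)

lemma smooth_normsq: "smooth (\<lambda>x. x \<bullet> x)"
  unfolding inner_R3 by (intro smooth_sum smooth_power smooth_coord)

lemmas smooth_intros = smooth_const smooth_coord smooth_add smooth_mult smooth_bump smooth_affine
  smooth_cmult smooth_minus smooth_diff smooth_sum smooth_power smooth_normsq smooth_pd

lemma smooth_continuous: "smooth f \<Longrightarrow> continuous_on S f"
  by (metis continuous_at_imp_continuous_on differentiable_imp_continuous_within smooth_differentiable)

lemma smooth_borel: "smooth f \<Longrightarrow> f \<in> borel_measurable borel"
  by (simp add: borel_measurable_continuous_onI smooth_continuous)

lemma pd_add: "smooth f \<Longrightarrow> smooth g \<Longrightarrow> pd i (\<lambda>x. f x + g x) = (\<lambda>x. pd i f x + pd i g x)"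
  by (simp add: fun_eq_iff pd_add' smooth_differentiable)

lemma pd_mult: "smooth f \<Longrightarrow> smooth g \<Longrightarrow> pd i (\<lambda>x. f x * g x) = (\<lambda>x. pd i f x * g x + f x * pd i g x)"
  by (simp add: fun_eq_iff pd_mult' smooth_differentiable)

lemma pd_cmult: "smooth f \<Longrightarrow> pd i (\<lambda>x. c * f x) = (\<lambda>x. c * pd i f x)"
  by (simp add: pd_mult smooth_const pd_const)

lemma pd_minus: "smooth f \<Longrightarrow> pd i (\<lambda>x. - f x) = (\<lambda>x. - pd i f x)"
  using pd_cmult[of f i "-1"] by simp

lemma pd_diff: "smooth f \<Longrightarrow> smooth g \<Longrightarrow> pd i (\<lambda>x. f x - g x) = (\<lambda>x. pd i f x - pd i g x)"
  using pd_add[of f "\<lambda>x. - g x" i] by (simp add: smooth_minus pd_minus)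

lemma pd_sum: "(\<And>j. j \<in> I \<Longrightarrow> smooth (f j)) \<Longrightarrow> pd i (\<lambda>x. \<Sum>j\<in>I. f j x) = (\<lambda>x. \<Sum>j\<in>I. pd i (f j) x)"
  by (induction I rule: infinite_finite_induct) (auto simp: pd_const pd_add smooth_sum)

lemma pd_affine: "smooth f \<Longrightarrow> pd i (\<lambda>x. f (a + c *\<^sub>R x)) = (\<lambda>x. c * pd i f (a + c *\<^sub>R x))"
  by (simp add: fun_eq_iff pd_affine' smooth_differentiable)

lemma pd_power2: "smooth f \<Longrightarrow> pd i (\<lambda>x. (f x)\<^sup>2) = (\<lambda>x. 2 * f x * pd i f x)"
  by (simp add: power2_eq_square pd_mult fun_eq_iff)

lemma pd_powr: "smooth f \<Longrightarrow> (\<And>x. f x > 0) \<Longrightarrow> pd i (\<lambda>x. f x powr a) = (\<lambda>x. a * f x powr (a - 1) * pd i f x)"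
  by (rule ext, rule pd_comp') (auto simp: smooth_differentiable intro!: has_real_derivative_powr)

lemma pd_bump: "smooth f \<Longrightarrow> pd i (\<lambda>x. bump p (f x)) = (\<lambda>x. bump (bump_der p) (f x) * pd i f x)"
  by (rule ext, rule pd_comp') (auto simp: smooth_differentiable intro!: bump_has_derivative)

lemma pd_normsq: "pd i (\<lambda>x. x \<bullet> x) = (\<lambda>x. 2 * x $ i)"
  unfolding inner_R3 by (simp add: pd_sum pd_power2 smooth_power smooth_coord pd_coord if_distrib cong: if_cong)

text \<open>The region where the norm exceeds \<open>r\<close> is open, so vanishing there passes to
  derivatives. This is why supports are described by a strict inequality throughout.\<close>

lemma pd_zero_outside:
  assumes "\<And>x. norm x > r \<Longrightarrow> f x = 0" "norm x > r"
  shows "pd i f x = 0"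
proof -
  have "(f has_derivative (\<lambda>h. 0)) (at x)"
  proof (rule has_derivative_transform_within_open)
    show "((\<lambda>x. 0::real) has_derivative (\<lambda>h. 0)) (at x)" by simp
    show "open {x::R3. norm x > r}" by (intro open_Collect_less continuous_intros)
  qed (use assms in auto)
  then show ?thesis by (simp add: pd_eqI)
qed

section \<open>Test functions supported in a ball of known radius\<close>

definition tf :: "real \<Rightarrow> (R3 \<Rightarrow> real) \<Rightarrow> bool" where
  "tf r f \<longleftrightarrow> smooth f \<and> (\<forall>x. norm x > r \<longrightarrow> f x = 0)"

lemma tf_smooth: "tf r f \<Longrightarrow> smooth f" by (simp add: tf_def)
lemma tf_zero: "tf r f \<Longrightarrow> norm x > r \<Longrightarrow> f x = 0" by (simp add: tf_def)

lemma tf_test_fun: "tf r f \<Longrightarrow> test_fun f"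
  unfolding tf_def test_fun_iff bounded_iff by (metis (mono_tags, lifting) linorder_not_le mem_Collect_eq)

lemma tf_pd: "tf r f \<Longrightarrow> tf r (pd i f)"
  unfolding tf_def using pd_zero_outside smooth_pd by blast

lemma tf_add: "tf r f \<Longrightarrow> tf r g \<Longrightarrow> tf r (\<lambda>x. f x + g x)"
  and tf_diff: "tf r f \<Longrightarrow> tf r g \<Longrightarrow> tf r (\<lambda>x. f x - g x)"
  and tf_mult: "tf r f \<Longrightarrow> smooth g \<Longrightarrow> tf r (\<lambda>x. f x * g x)"
  and tf_mono: "tf r f \<Longrightarrow> r \<le> s \<Longrightarrow> tf s f"
  by (auto simp: tf_def intro: smooth_intros)

lemma tf_sum: "(\<And>i. i \<in> I \<Longrightarrow> tf r (f i)) \<Longrightarrow> tf r (\<lambda>x. \<Sum>i\<in>I. f i x)"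
  by (auto simp: tf_def intro: smooth_sum)

lemma tf_laplacian: "tf r f \<Longrightarrow> tf r (laplacian f)"
  unfolding laplacian_eq by (intro tf_sum tf_pd)

subsection \<open>Convolution\<close>

text \<open>Borel rather than Lebesgue measurability is demanded, so that shifts and products stay
  measurable for \<open>lborel\<close> and Fubini's theorem applies.\<close>

definition locint :: "(R3 \<Rightarrow> real) \<Rightarrow> bool" where
  "locint f \<longleftrightarrow> f \<in> borel_measurable borel \<and> (\<forall>r. integrable lborel (\<lambda>x. indicator (cball 0 r) x * f x))"

definition conv :: "(R3 \<Rightarrow> real) \<Rightarrow> (R3 \<Rightarrow> real) \<Rightarrow> R3 \<Rightarrow> real" where
  "conv k f x = (\<integral>y. k (x - y) * f y \<partial>lborel)"

lemma locint_borel: "locint f \<Longrightarrow> f \<in> borel_measurable borel"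
  by (simp add: locint_def)

lemma locint_continuous:
  assumes "continuous_on UNIV f"
  shows "locint f"
  unfolding locint_def
proof (intro conjI allI)
  show "f \<in> borel_measurable borel" using assms by (rule borel_measurable_continuous_onI)
  show "integrable lborel (\<lambda>x. indicator (cball 0 r) x * f x)" for r
    using borel_integrable_compact[of "cball 0 r" f] continuous_on_subset[OF assms] by simp
qed

lemma locint_smooth: "smooth f \<Longrightarrow> locint f"
  by (simp add: locint_continuous smooth_continuous)

lemma integrable_bounded_mult:
  assumes f: "locint f" and h: "h \<in> borel_measurable borel"
    and b: "\<And>x. \<bar>h x\<bar> \<le> C" and z: "\<And>x. norm x > r \<Longrightarrow> h x = 0"
  shows "integrable lborel (\<lambda>x. h x * f x)"
proof (rule Bochner_Integration.integrable_bound)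
  show "integrable lborel (\<lambda>x. C * (indicator (cball 0 r) x * f x))"
    using f by (auto simp: locint_def)
  show "(\<lambda>x. h x * f x) \<in> borel_measurable lborel"
    using f h by (auto simp: locint_def)
  have "\<bar>h x\<bar> * \<bar>f x\<bar> \<le> C * \<bar>f x\<bar>" for x using b[of x] by (intro mult_right_mono) auto
  moreover have "C \<ge> 0" using b[of 0] by linarith
  ultimately show "AE x in lborel. norm (h x * f x) \<le> norm (C * (indicator (cball 0 r) x * f x))"
    using z by (auto simp: abs_mult indicator_def)
qed

lemma tf_bounded:
  assumes "tf r f"
  obtains C where "C \<ge> 0" "\<And>x. \<bar>f x\<bar> \<le> C"
proof -
  have "compact (f ` cball 0 r)"
    using assms by (intro compact_continuous_image smooth_continuous) (auto simp: tf_def)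
  then obtain B where B: "\<forall>x\<in>cball 0 r. norm (f x) \<le> B"
    using compact_imp_bounded bounded_iff by (metis imageI)
  have "\<bar>f x\<bar> \<le> max B 0" for x
    using B tf_zero[OF assms, of x] by (cases "norm x \<le> r") (auto simp: le_max_iff_disj)
  then show ?thesis by (intro that[of "max B 0"]) auto
qed

lemma tf_integrable_mult:
  assumes "tf r h" "locint f"
  shows "integrable lborel (\<lambda>x. h x * f x)" "integrable lborel (\<lambda>x. f x * h x)"
proof -
  obtain C where "\<And>x. \<bar>h x\<bar> \<le> C" using tf_bounded[OF assms(1)] by blast
  then show "integrable lborel (\<lambda>x. h x * f x)"
    using assms by (intro integrable_bounded_mult[where r = r]) (auto simp: tf_def smooth_borel)
  then show "integrable lborel (\<lambda>x. f x * h x)" by (simp add: mult.commute)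
qed

lemma tf_integrable: "tf r h \<Longrightarrow> integrable lborel h"
  using tf_integrable_mult[of r h "\<lambda>x. 1"] by (simp add: locint_continuous)

lemma onorm_coord_le:
  fixes c :: "3 \<Rightarrow> real"
  assumes "(\<Sum>i\<in>UNIV. \<bar>c i\<bar>) \<le> B"
  shows "onorm (\<lambda>h. \<Sum>i\<in>UNIV. h $ i * c i) \<le> B"
proof (rule onorm_bound)
  show "0 \<le> B" using assms sum_nonneg[of UNIV "\<lambda>i. \<bar>c i\<bar>"] by linarith
  fix h :: R3
  have "\<bar>\<Sum>i\<in>UNIV. h $ i * c i\<bar> \<le> (\<Sum>i\<in>UNIV. \<bar>h $ i\<bar> * \<bar>c i\<bar>)"
    using sum_abs[of "\<lambda>i. h $ i * c i" UNIV] by (simp add: abs_mult)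
  also have "\<dots> \<le> (\<Sum>i\<in>UNIV. norm h * \<bar>c i\<bar>)"
    by (intro sum_mono mult_right_mono component_le_norm_cart) auto
  also have "\<dots> \<le> norm h * B"
    using assms by (simp flip: sum_distrib_left add: mult_left_mono)
  finally show "norm (\<Sum>i\<in>UNIV. h $ i * c i) \<le> B * norm h" by (simp add: mult.commute)
qed

lemma tf_lipschitz:
  assumes "tf r f"
  obtains L where "L \<ge> 0" "\<And>x y. \<bar>f x - f y\<bar> \<le> L * norm (x - y)"
proof -
  have "\<exists>C\<ge>0. \<forall>x. \<bar>pd i f x\<bar> \<le> C" for i
    using tf_bounded[OF tf_pd[OF assms, of i]] by metis
  then obtain C where C: "\<And>i. C i \<ge> 0" "\<And>i x. \<bar>pd i f x\<bar> \<le> C i" by metis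
  define L where "L = (\<Sum>i\<in>UNIV. C i)"
  have "norm (f x - f y) \<le> L * norm (x - y)" for x y
  proof (rule differentiable_bound[of UNIV])
    show "(f has_derivative (\<lambda>h. \<Sum>i\<in>UNIV. h $ i * pd i f x)) (at x within UNIV)" for x
      using assms by (auto intro!: has_derivative_pd smooth_differentiable simp: tf_def)
    show "onorm (\<lambda>h. \<Sum>i\<in>UNIV. h $ i * pd i f x) \<le> L" for x
      unfolding L_def by (intro onorm_coord_le sum_mono C)
  qed auto
  moreover have "L \<ge> 0" unfolding L_def by (intro sum_nonneg C)
  ultimately show ?thesis using that[of L] by simp
qed

text \<open>The mean value inequality for f minus its linearisation at z: the gradient of this
  function at w is a difference of gradients of f, hence of size |w - z|. Uniformity in z lets the
  remainder be integrated against another function.\<close>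

lemma tf_taylor:
  assumes "tf r f"
  obtains C where "C \<ge> 0" "\<And>z h. \<bar>f (z + h) - f z - (\<Sum>i\<in>UNIV. h $ i * pd i f z)\<bar> \<le> C * (norm h)\<^sup>2"
proof -
  have "\<exists>L\<ge>0. \<forall>x y. \<bar>pd i f x - pd i f y\<bar> \<le> L * norm (x - y)" for i
    using tf_lipschitz[OF tf_pd[OF assms, of i]] by metis
  then obtain L where L: "\<And>i. L i \<ge> 0" "\<And>i x y. \<bar>pd i f x - pd i f y\<bar> \<le> L i * norm (x - y)" by metis
  define C where "C = (\<Sum>i\<in>UNIV. L i)"
  have C0: "C \<ge> 0" unfolding C_def by (intro sum_nonneg L)
  have "\<bar>f (z + h) - f z - (\<Sum>i\<in>UNIV. h $ i * pd i f z)\<bar> \<le> C * (norm h)\<^sup>2" for z h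
  proof -
    define \<phi> where "\<phi> w = f w - (\<Sum>i\<in>UNIV. w $ i * pd i f z)" for w
    have "norm (\<phi> (z + h) - \<phi> z) \<le> (C * norm h) * norm (z + h - z)"
    proof (rule differentiable_bound[of "cball z (norm h)"])
      fix w assume w: "w \<in> cball z (norm h)"
      have "(\<phi> has_derivative (\<lambda>h. (\<Sum>i\<in>UNIV. h $ i * pd i f w) - (\<Sum>i\<in>UNIV. h $ i * pd i f z))) (at w)"
        unfolding \<phi>_def using assms
        by (intro has_derivative_diff has_derivative_pd smooth_differentiable has_derivative_sum
            has_derivative_mult_left bounded_linear_imp_has_derivative bounded_linear_vec_nth) (auto simp: tf_def)
      then show "(\<phi> has_derivative (\<lambda>h. \<Sum>i\<in>UNIV. h $ i * (pd i f w - pd i f z))) (at w within cball z (norm h))"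
        by (simp add: sum_subtractf right_diff_distrib has_derivative_at_withinI)
      have "(\<Sum>i\<in>UNIV. \<bar>pd i f w - pd i f z\<bar>) \<le> (\<Sum>i\<in>UNIV. L i * norm h)"
      proof (rule sum_mono)
        fix i
        have "\<bar>pd i f w - pd i f z\<bar> \<le> L i * norm (w - z)" by (rule L)
        also have "\<dots> \<le> L i * norm h"
          using w by (intro mult_left_mono L) (auto simp: dist_norm norm_minus_commute)
        finally show "\<bar>pd i f w - pd i f z\<bar> \<le> L i * norm h" .
      qed
      then show "onorm (\<lambda>h. \<Sum>i\<in>UNIV. h $ i * (pd i f w - pd i f z)) \<le> C * norm h"
        by (intro onorm_coord_le) (simp add: C_def sum_distrib_right)
    qed (auto simp: dist_norm)
    moreover have "\<phi> (z + h) - \<phi> z = f (z + h) - f z - (\<Sum>i\<in>UNIV. h $ i * pd i f z)"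
      unfolding \<phi>_def by (simp add: sum.distrib distrib_right)
    ultimately show ?thesis by (simp add: power2_eq_square mult.assoc)
  qed
  with C0 show ?thesis using that by blast
qed

lemma tf_reflect:
  assumes "tf r k"
  shows "tf (r + norm x) (\<lambda>y. k (x - y))" "pd i (\<lambda>y. k (x - y)) = (\<lambda>y. - pd i k (x - y))"
proof -
  have s: "smooth k" using assms by (simp add: tf_def)
  have "k (x - y) = 0" if "norm y > r + norm x" for y
    using assms that norm_triangle_ineq2[of y x] by (auto simp: tf_def norm_minus_commute)
  then show "tf (r + norm x) (\<lambda>y. k (x - y))"
    using smooth_affine[OF s, of x "-1"] by (simp add: tf_def)
  show "pd i (\<lambda>y. k (x - y)) = (\<lambda>y. - pd i k (x - y))"
    using pd_affine[OF s, of i x "-1"] by simp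
qed

lemma conv_integrable: "tf r k \<Longrightarrow> locint f \<Longrightarrow> integrable lborel (\<lambda>y. k (x - y) * f y)"
  by (rule tf_integrable_mult(1)[OF tf_reflect(1)])

text \<open>The Taylor remainder of the kernel is at most a multiple of |h|^2, and for small h it
  lives in one fixed ball; so it can be integrated against a function that is only locally
  integrable.\<close>

lemma conv_has_derivative:
  assumes k: "tf r k" and f: "locint f"
  shows "(conv k f has_derivative (\<lambda>h. \<Sum>i\<in>UNIV. h $ i * conv (pd i k) f x)) (at x)"
proof -
  obtain C where C: "C \<ge> 0" "\<And>z h. \<bar>k (z + h) - k z - (\<Sum>i\<in>UNIV. h $ i * pd i k z)\<bar> \<le> C * (norm h)\<^sup>2"
    using tf_taylor[OF k] by blast
  \<comment> \<open>For |h| <= 1 and |y| > B the kernel vanishes at x - y and at x + h - y, and so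
    do its derivatives at x - y.\<close>
  define B where "B = norm x + 1 + r"
  define I where "I = (\<integral>y. \<bar>indicator (cball 0 B) y * f y\<bar> \<partial>lborel)"
  have e: "(k ((x - y) + h) - k (x - y) - (\<Sum>i\<in>UNIV. h $ i * pd i k (x - y))) * f y =
      k (x + h - y) * f y - k (x - y) * f y - (\<Sum>i\<in>UNIV. h $ i * (pd i k (x - y) * f y))" for h y
    by (simp add: left_diff_distrib sum_distrib_right mult.assoc diff_add_eq)
  have est: "norm (conv k f (x + h) - conv k f x - (\<Sum>i\<in>UNIV. h $ i * conv (pd i k) f x)) \<le> C * (norm h)\<^sup>2 * I"
    if h: "norm h \<le> 1" for h
  proof -
    have "conv k f (x + h) - conv k f x - (\<Sum>i\<in>UNIV. h $ i * conv (pd i k) f x) =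
        (\<integral>y. (k ((x - y) + h) - k (x - y) - (\<Sum>i\<in>UNIV. h $ i * pd i k (x - y))) * f y \<partial>lborel)"
    proof -
      have i1: "integrable lborel (\<lambda>y. k (x + h - y) * f y)" "integrable lborel (\<lambda>y. k (x - y) * f y)"
        by (rule conv_integrable[OF k f])+
      have i2: "integrable lborel (\<lambda>y. h $ i * (pd i k (x - y) * f y))" for i
        using conv_integrable[OF tf_pd[OF k] f] by simp
      have "(\<integral>y. (k ((x - y) + h) - k (x - y) - (\<Sum>i\<in>UNIV. h $ i * pd i k (x - y))) * f y \<partial>lborel) =
        (\<integral>y. k (x + h - y) * f y - k (x - y) * f y - (\<Sum>i\<in>UNIV. h $ i * (pd i k (x - y) * f y)) \<partial>lborel)"
        unfolding e ..
      also have "\<dots> = conv k f (x + h) - conv k f x - (\<Sum>i\<in>UNIV. h $ i * conv (pd i k) f x)"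
        unfolding conv_def
        by (subst Bochner_Integration.integral_diff, intro Bochner_Integration.integrable_diff i1,
            intro Bochner_Integration.integrable_sum i2,
            subst Bochner_Integration.integral_diff, rule i1, rule i1,
            subst Bochner_Integration.integral_sum, rule i2) simp
      finally show ?thesis by simp
    qed
    also have "norm \<dots> \<le> (\<integral>y. C * (norm h)\<^sup>2 * \<bar>indicator (cball 0 B) y * f y\<bar> \<partial>lborel)"
    proof (rule Bochner_Integration.integral_norm_bound_integral)
      show "integrable lborel (\<lambda>y. C * (norm h)\<^sup>2 * \<bar>indicator (cball 0 B) y * f y\<bar>)"
        using f by (auto simp: locint_def)
      have i1: "integrable lborel (\<lambda>y. k (x + h - y) * f y)" "integrable lborel (\<lambda>y. k (x - y) * f y)"
        by (rule conv_integrable[OF k f])+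
      have i2: "integrable lborel (\<lambda>y. h $ i * (pd i k (x - y) * f y))" for i
        using conv_integrable[OF tf_pd[OF k] f] by simp
      have "integrable lborel (\<lambda>y. k (x + h - y) * f y - k (x - y) * f y - (\<Sum>i\<in>UNIV. h $ i * (pd i k (x - y) * f y)))"
        by (intro Bochner_Integration.integrable_diff i1 Bochner_Integration.integrable_sum i2)
      then show "integrable lborel (\<lambda>y. (k ((x - y) + h) - k (x - y) - (\<Sum>i\<in>UNIV. h $ i * pd i k (x - y))) * f y)"
        unfolding e .
      fix y :: R3
      show "norm ((k ((x - y) + h) - k (x - y) - (\<Sum>i\<in>UNIV. h $ i * pd i k (x - y))) * f y)
          \<le> C * (norm h)\<^sup>2 * \<bar>indicator (cball 0 B) y * f y\<bar>"
      proof (cases "norm y \<le> B")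
        case True
        then show ?thesis using C(2)[of "x - y" h] by (auto simp: abs_mult intro!: mult_right_mono)
      next
        case False
        have "norm (x - y) > r" "norm (x - y + h) > r"
          using False h norm_triangle_ineq2[of y x] norm_triangle_ineq2[of "y - x" h]
          by (auto simp: B_def norm_minus_commute algebra_simps)
        then have "k (x - y) = 0" "k (x - y + h) = 0" "pd i k (x - y) = 0" for i
          using k tf_pd[OF k] by (auto simp: tf_def)
        then show ?thesis using C(1) by simp
      qed
    qed
    also have "\<dots> = C * (norm h)\<^sup>2 * I" by (simp add: I_def)
    finally show ?thesis .
  qed
  have I0: "I \<ge> 0" by (simp add: I_def)
  show ?thesis
    unfolding has_derivative_at
  proof
    show "bounded_linear (\<lambda>h. \<Sum>i\<in>UNIV. h $ i * conv (pd i k) f x)"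
      by (intro bounded_linear_sum bounded_linear_mult_const bounded_linear_vec_nth)
    show "((\<lambda>h. norm (conv k f (x + h) - conv k f x - (\<Sum>i\<in>UNIV. h $ i * conv (pd i k) f x)) / norm h) \<longlongrightarrow> 0) (at 0)"
    proof (rule Lim_null_comparison)
      have "eventually (\<lambda>h::R3. norm h \<le> 1) (at 0)"
        by (auto simp: eventually_at dist_norm intro!: exI[of _ 1])
      moreover have "eventually (\<lambda>h::R3. h \<noteq> 0) (at 0)" by (simp add: eventually_at_filter)
      ultimately show "\<forall>\<^sub>F h in at 0. norm (norm (conv k f (x + h) - conv k f x - (\<Sum>i\<in>UNIV. h $ i * conv (pd i k) f x)) / norm h)
        \<le> C * I * norm h"
      proof eventually_elim
        case (elim h)
        then show ?case using est[of h] by (simp add: field_simps power2_eq_square)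
      qed
      show "((\<lambda>h. C * I * norm h) \<longlongrightarrow> 0) (at (0::R3))"
        by (auto intro!: tendsto_eq_intros)
    qed
  qed
qed

lemma pd_conv: "tf r k \<Longrightarrow> locint f \<Longrightarrow> pd i (conv k f) = conv (pd i k) f"
  by (rule ext, subst pd_eqI[OF conv_has_derivative]) (auto simp: axis_def if_distrib[of "\<lambda>c. c * _"] cong: if_cong)

lemma smooth_conv:
  assumes "tf r k" "locint f"
  shows "smooth (conv k f)"
proof (rule smooth_coinduct[where S = "{conv k f | k. tf r k}"])
  fix g x assume "g \<in> {conv k f | k. tf r k}"
  then show "g differentiable (at x)" using conv_has_derivative[OF _ assms(2)] differentiableI by blast
next
  fix g i assume "g \<in> {conv k f | k. tf r k}"
  then show "pd i g \<in> {conv k f | k. tf r k}" using pd_conv[OF _ assms(2)] tf_pd by blast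
qed (use assms in auto)

section \<open>Change of variables, integration by parts and symmetry of convolution\<close>

lemma lborel_integral_affine:
  fixes f :: "R3 \<Rightarrow> real" and c :: real
  assumes "c \<noteq> 0" "f \<in> borel_measurable borel"
  shows "(\<integral>x. f x \<partial>lborel) = \<bar>c\<bar> ^ 3 * (\<integral>x. f (t + c *\<^sub>R x) \<partial>lborel)"
proof -
  have "(\<integral>x. f x \<partial>lborel) = (\<integral>x. f x \<partial>density (distr lborel borel (\<lambda>x. t + c *\<^sub>R x)) (\<lambda>_. \<bar>c\<bar> ^ DIM(R3)))"
    using lborel_affine[OF assms(1), of t] by simp
  also have "\<dots> = \<bar>c\<bar> ^ 3 * (\<integral>x. f (t + c *\<^sub>R x) \<partial>lborel)"
    using assms(2) by (subst integral_density) (auto simp: integral_distr)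
  finally show ?thesis .
qed

lemma lborel_integral_reflect:
  fixes f :: "R3 \<Rightarrow> real"
  assumes "f \<in> borel_measurable borel"
  shows "(\<integral>y. f (x - y) \<partial>lborel) = (\<integral>y. f y \<partial>lborel)"
  using lborel_integral_affine[of "-1" f x] assms by simp

lemma conv_commute:
  assumes "k \<in> borel_measurable borel" "f \<in> borel_measurable borel"
  shows "conv k f x = conv f k x"
  unfolding conv_def
  using assms by (subst lborel_integral_reflect[symmetric, of _ x]) (auto simp: mult.commute)

lemma conv_zero_outside:
  assumes "\<And>x. norm x > r \<Longrightarrow> k x = 0" "\<And>x. norm x > s \<Longrightarrow> f x = 0" "norm x > r + s"
  shows "conv k f x = 0"
proof -
  have "(\<lambda>y. k (x - y) * f y) = (\<lambda>y. 0)"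
  proof
    fix y show "k (x - y) * f y = 0"
      using assms(1)[of "x - y"] assms(2)[of y] assms(3) norm_triangle_ineq2[of x y] by fastforce
  qed
  then show ?thesis unfolding conv_def by simp
qed

lemma tf_conv: "tf r k \<Longrightarrow> tf s f \<Longrightarrow> tf (r + s) (conv k f)"
  unfolding tf_def[of "r + s"] using smooth_conv[of r k f] conv_zero_outside[of r k s f]
  by (auto simp: tf_def locint_smooth)

lemma pd_conv_right:
  assumes "tf r k" "tf s f"
  shows "pd i (conv k f) = conv k (pd i f)"
proof -
  have b: "k \<in> borel_measurable borel" "f \<in> borel_measurable borel" "pd i f \<in> borel_measurable borel"
    using assms tf_pd by (auto simp: tf_def smooth_borel smooth_pd)
  have "conv k f = conv f k" using conv_commute b by auto
  then have "pd i (conv k f) = conv (pd i f) k"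
    using assms pd_conv[of s f k] by (simp add: tf_def locint_smooth)
  then show ?thesis using conv_commute b by auto
qed

lemma conv_one: "tf r k \<Longrightarrow> conv k (\<lambda>x. 1) x = (\<integral>y. k y \<partial>lborel)"
  unfolding conv_def using lborel_integral_reflect[of k x] by (simp add: tf_def smooth_borel)

text \<open>The convolution of \<open>h\<close> with the constant 1 is a constant function, the
  integral of \<open>h\<close>. Differentiating it through the kernel gives the claim.\<close>

lemma integral_pd:
  assumes "tf r h"
  shows "(\<integral>x. pd i h x \<partial>lborel) = 0"
proof -
  have "(\<integral>x. pd i h x \<partial>lborel) = conv (pd i h) (\<lambda>x. 1) 0"
    using conv_one[OF tf_pd[OF assms]] by simp
  also have "\<dots> = pd i (conv h (\<lambda>x. 1)) 0"
    using assms by (subst pd_conv) (auto simp: locint_continuous)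
  also have "conv h (\<lambda>x. 1) = (\<lambda>x. \<integral>y. h y \<partial>lborel)"
    using conv_one[OF assms] by auto
  finally show ?thesis by (simp add: pd_const)
qed

lemma integral_by_parts:
  assumes "tf r f" "smooth g"
  shows "(\<integral>x. f x * pd i g x \<partial>lborel) = - (\<integral>x. pd i f x * g x \<partial>lborel)"
proof -
  have "(\<integral>x. pd i (\<lambda>x. f x * g x) x \<partial>lborel) = 0"
    using assms by (intro integral_pd[of r] tf_mult)
  moreover have "pd i (\<lambda>x. f x * g x) = (\<lambda>x. pd i f x * g x + f x * pd i g x)"
    using assms by (intro pd_mult) (auto simp: tf_def)
  moreover have "integrable lborel (\<lambda>x. pd i f x * g x)" "integrable lborel (\<lambda>x. f x * pd i g x)"
    using assms by (auto intro!: tf_integrable_mult(1)[of r] locint_smooth smooth_pd tf_pd)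
  ultimately show ?thesis by simp
qed

text \<open>Fubini's theorem, where evenness turns the transposed kernel back into \<open>k\<close>.
  The function \<open>h\<close> may be discontinuous because the lemma is applied to indicators of
  balls as well as to test functions.\<close>

lemma integral_conv_swap:
  assumes k: "tf r k" and even: "\<And>x. k (- x) = k x" and f: "locint f"
    and h: "h \<in> borel_measurable borel" "\<And>x. \<bar>h x\<bar> \<le> C" "\<And>x. norm x > s \<Longrightarrow> h x = 0"
  shows "(\<integral>x. f x * conv k h x \<partial>lborel) = (\<integral>x. conv k f x * h x \<partial>lborel)"
    and "integrable lborel (\<lambda>x. conv k f x * h x)"
proof -
  obtain D where D: "D \<ge> 0" "\<And>x. \<bar>k x\<bar> \<le> D" using tf_bounded[OF k] by blast
  have [measurable]: "f \<in> borel_measurable borel" "k \<in> borel_measurable borel" "h \<in> borel_measurable borel"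
    using f k h by (auto simp: locint_def tf_def smooth_borel)
  have i1: "integrable lborel (\<lambda>x. indicator (cball 0 (r + s)) x * f x)" using f by (simp add: locint_def)
  have i2: "integrable lborel h"
    using integrable_bounded_mult[OF locint_continuous[of "\<lambda>x. 1"] h] by simp
  \<comment> \<open>When h(y) and k(x - y) are both nonzero, x lies in B(r + s). So \<open>f\<close>
    can be cut off there, and the integrand is dominated by a product of two integrable functions of
    one variable.\<close>
  have P: "integrable (lborel \<Otimes>\<^sub>M lborel) (\<lambda>(x, y). f x * k (x - y) * h y)"
  proof (rule Bochner_Integration.integrable_bound)
    have "integrable (lborel \<Otimes>\<^sub>M lborel) (\<lambda>(x, y). (indicator (cball 0 (r + s)) x * f x) * h y)"
    proof (rule lborel_pair.Fubini_integrable)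
      have m1: "(\<lambda>x. indicator (cball 0 (r + s)) x * f x) \<in> borel_measurable lborel"
        using borel_measurable_integrable[OF i1] by simp
      have m2: "h \<in> borel_measurable lborel" by measurable
      show "(\<lambda>(x, y). (indicator (cball 0 (r + s)) x * f x) * h y) \<in> borel_measurable (lborel \<Otimes>\<^sub>M lborel)"
        unfolding case_prod_beta
        by (intro borel_measurable_times measurable_compose[OF measurable_fst m1] measurable_compose[OF measurable_snd m2])
      show "integrable lborel (\<lambda>x. \<integral>y. norm (case (x, y) of (x, y) \<Rightarrow> (indicator (cball 0 (r + s)) x * f x) * h y) \<partial>lborel)"
        using integrable_abs[OF i1] by (simp add: abs_mult)
      show "AE x in lborel. integrable lborel (\<lambda>y. case (x, y) of (x, y) \<Rightarrow> (indicator (cball 0 (r + s)) x * f x) * h y)"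
        using i2 by simp
    qed
    then show "integrable (lborel \<Otimes>\<^sub>M lborel) (\<lambda>z. D * (case z of (x, y) \<Rightarrow> (indicator (cball 0 (r + s)) x * f x) * h y))"
      by simp
    show "AE z in lborel \<Otimes>\<^sub>M lborel. norm (case z of (x, y) \<Rightarrow> f x * k (x - y) * h y)
        \<le> norm (D * (case z of (x, y) \<Rightarrow> (indicator (cball 0 (r + s)) x * f x) * h y))"
    proof (rule AE_I2, clarify)
      fix x y :: R3
      show "norm (f x * k (x - y) * h y) \<le> norm (D * ((indicator (cball 0 (r + s)) x * f x) * h y))"
      proof (cases "norm x \<le> r + s")
        case True
        have "\<bar>k (x - y)\<bar> * (\<bar>f x\<bar> * \<bar>h y\<bar>) \<le> D * (\<bar>f x\<bar> * \<bar>h y\<bar>)"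
          using D by (intro mult_right_mono) auto
        with True D show ?thesis by (simp add: abs_mult mult_ac)
      next
        case False
        then have "norm y > s \<or> norm (x - y) > r"
          using norm_triangle_ineq2[of x y] by linarith
        then have "k (x - y) * h y = 0" using h(3) tf_zero[OF k] by auto
        then show ?thesis by auto
      qed
    qed
  qed measurable
  have e: "(\<integral>x. f x * k (x - y) \<partial>lborel) = conv k f y" for y
    unfolding conv_def using even[of "_ - y"] by (simp add: mult.commute)
  have "(\<integral>x. f x * conv k h x \<partial>lborel) = (\<integral>x. \<integral>y. f x * k (x - y) * h y \<partial>lborel \<partial>lborel)"
    unfolding conv_def by (simp add: mult.assoc)
  also have "\<dots> = (\<integral>y. \<integral>x. f x * k (x - y) * h y \<partial>lborel \<partial>lborel)"
    using lborel_pair.Fubini_integral[OF P] by simp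
  also have "\<dots> = (\<integral>x. conv k f x * h x \<partial>lborel)" by (simp add: e)
  finally show "(\<integral>x. f x * conv k h x \<partial>lborel) = (\<integral>x. conv k f x * h x \<partial>lborel)" .
  show "integrable lborel (\<lambda>x. conv k f x * h x)"
    using lborel_pair.integrable_snd[OF P] by (simp add: e)
qed

lemma tf_conv_swap:
  assumes "tf r k" "\<And>x. k (- x) = k x" "locint f" "tf s h"
  shows "(\<integral>x. f x * conv k h x \<partial>lborel) = (\<integral>x. conv k f x * h x \<partial>lborel)"
proof -
  obtain C where "\<And>x. \<bar>h x\<bar> \<le> C" using tf_bounded[OF assms(4)] by blast
  then show ?thesis
    using assms by (intro integral_conv_swap) (auto simp: tf_def smooth_borel)
qed

subsection \<open>Mollifiers and cut-off functions\<close>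

text \<open>The redundant \<open>0 +\<close> gives the argument the shape required by \<open>smooth_affine\<close>.\<close>

definition scaled :: "real \<Rightarrow> real \<Rightarrow> (R3 \<Rightarrow> real) \<Rightarrow> R3 \<Rightarrow> real" where
  "scaled c s f = (\<lambda>x. c * f (0 + (1 / s) *\<^sub>R x))"

lemma smooth_scaled: "smooth f \<Longrightarrow> smooth (scaled c s f)"
  unfolding scaled_def by (intro smooth_cmult smooth_affine)

lemma pd_scaled: "smooth f \<Longrightarrow> pd i (scaled c s f) = scaled (c / s) s (pd i f)"
  unfolding scaled_def by (subst pd_cmult, rule smooth_affine, assumption, subst pd_affine) auto

lemma tf_scaled: "tf 1 f \<Longrightarrow> s > 0 \<Longrightarrow> tf s (scaled c s f)"
  unfolding tf_def by (auto simp: smooth_scaled) (simp add: scaled_def)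

lemma laplacian_scaled: "smooth f \<Longrightarrow> laplacian (scaled c s f) = scaled (c / s\<^sup>2) s (laplacian f)"
  unfolding laplacian_eq
  by (simp add: pd_scaled smooth_pd) (simp add: scaled_def power2_eq_square sum_distrib_left)

section \<open>The regularised Newtonian potential and its Laplacian\<close>

definition bump0 :: "real \<Rightarrow> real" where "bump0 = bump 1"
definition bump1 :: "real \<Rightarrow> real" where "bump1 = bump (bump_der 1)"
definition bump2 :: "real \<Rightarrow> real" where "bump2 = bump (bump_der (bump_der 1))"

lemma bump_der_1: "bump_der 1 = [:0, 0, -2:]"
  by (simp add: bump_der_def)

lemma bump0_pos: "t < 1 \<Longrightarrow> bump0 t > 0" and bump0_nonneg: "bump0 t \<ge> 0"
  and bump0_le_1: "bump0 t \<le> 1" and bump0_zero: "t \<ge> 1 \<Longrightarrow> bump0 t = 0"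
  by (auto simp: bump0_def bump_def)

text \<open>In y = 1/(1-t) the function is -2 y^2 exp(-2y), and exp(2y) > 2 y^2 by the quadratic
  Taylor polynomial. The strict bound keeps \<open>1 + bump1\<close>, the radial factor in the
  gradient of \<open>soft\<close>, positive.\<close>

lemma bump1_bounds: "bump1 t \<le> 0" "t \<ge> 0 \<Longrightarrow> bump1 t > -1"
  and bump1_zero: "t \<ge> 1 \<Longrightarrow> bump1 t = 0"
proof -
  show "bump1 t \<le> 0" by (auto simp: bump1_def bump_def bump_der_1 mult_nonpos_nonneg)
  show "t \<ge> 1 \<Longrightarrow> bump1 t = 0" by (auto simp: bump1_def bump_def)
  assume t: "t \<ge> 0"
  show "bump1 t > -1"
  proof (cases "t < 1")
    case True
    define y where "y = 1 / (1 - t)"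
    have "y > 0" using True by (simp add: y_def)
    then have "1 + 2 * y + (2 * y)\<^sup>2 / 2 \<le> exp (2 * y)"
      by (intro exp_lower_Taylor_quadratic) auto
    with \<open>y > 0\<close> have *: "2 * y\<^sup>2 < exp (2 * y)" by (simp add: power2_eq_square)
    have "bump1 t = - (2 * y\<^sup>2 * exp (- (2 * y)))"
      using True by (simp add: bump1_def bump_def bump_der_1 y_def power2_eq_square)
    also have "\<dots> > -1" using * by (simp add: exp_minus field_simps)
    finally show ?thesis .
  qed (auto simp: bump1_def bump_def)
qed

text \<open>The second derivative is 4 y^3 (y - 1) exp(-2y), and t >= 0 means y >= 1. With 0 < c < 2
  in place of 2 in the exponent it would be c y^3 (c y - 2) exp(-c y), which is negative near t =
  0.\<close>

lemma bump2_nonneg: "t \<ge> 0 \<Longrightarrow> bump2 t \<ge> 0"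
  and bump2_zero: "t \<ge> 1 \<Longrightarrow> bump2 t = 0"
proof -
  show "t \<ge> 1 \<Longrightarrow> bump2 t = 0" by (auto simp: bump2_def bump_def)
  assume t: "t \<ge> 0"
  show "bump2 t \<ge> 0"
  proof (cases "t < 1")
    case True
    define y where "y = 1 / (1 - t)"
    have "y \<ge> 1" using True t by (simp add: y_def)
    have e: "2 / (1 - t) = 2 * y" by (simp add: y_def)
    have "bump2 t = 4 * y ^ 3 * (y - 1) * exp (- (2 * y))"
      using True
      by (simp add: bump2_def bump_def bump_der_1 e y_def[symmetric] bump_der_def[of "[:0,0,-2:]"] pderiv_pCons)
        (simp add: power2_eq_square power3_eq_cube algebra_simps)
    also have "\<dots> \<ge> 0" using \<open>y \<ge> 1\<close> by simp
    finally show ?thesis .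
  qed (auto simp: bump2_def bump_def)
qed

text \<open>The Newtonian potential (up to a factor), regularised inside the unit ball so that it stays
  subharmonic: the factor 2 in the exponent of \<open>bump\<close> makes \<open>bump0\<close> convex on the positive axis.\<close>

definition soft :: "R3 \<Rightarrow> real" where
  "soft x = x \<bullet> x + bump0 (x \<bullet> x)"

definition newton :: "R3 \<Rightarrow> real" where
  "newton x = - (soft x powr (-1/2))"

lemma soft_pos: "soft x > 0"
  using bump0_pos[of "x \<bullet> x"] bump0_nonneg[of "x \<bullet> x"]
  by (cases "x \<bullet> x < 1") (auto simp: soft_def add_nonneg_pos)

lemma smooth_soft: "smooth soft"
  unfolding soft_def bump0_def by (intro smooth_intros)

lemma pd_soft: "pd i soft = (\<lambda>x. 2 * ((1 + bump1 (x \<bullet> x)) * x $ i))"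
proof -
  have "pd i (\<lambda>x. x \<bullet> x + bump0 (x \<bullet> x)) = (\<lambda>x. 2 * x $ i + bump1 (x \<bullet> x) * (2 * x $ i))"
    unfolding bump0_def bump1_def
    by (simp add: pd_add pd_bump smooth_normsq smooth_bump pd_normsq)
  then show ?thesis by (simp add: soft_def[abs_def] algebra_simps)
qed

lemma smooth_newton: "smooth newton"
  unfolding newton_def[abs_def] by (intro smooth_minus smooth_powr smooth_soft soft_pos)

lemma pd_newton: "pd i newton = (\<lambda>x. soft x powr (-3/2) * ((1 + bump1 (x \<bullet> x)) * x $ i))"
  unfolding newton_def[abs_def]
  by (subst pd_minus, intro smooth_powr smooth_soft soft_pos, subst pd_powr)
    (auto simp: smooth_soft soft_pos pd_soft)

definition newton_density :: "R3 \<Rightarrow> real" where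
  "newton_density = laplacian newton"

lemma smooth_one_bump1: "smooth (\<lambda>x. 1 + bump1 (x \<bullet> x))"
  unfolding bump1_def by (intro smooth_intros)

lemma pd_one_bump1: "pd i (\<lambda>x. 1 + bump1 (x \<bullet> x)) = (\<lambda>x. bump2 (x \<bullet> x) * (2 * x $ i))"
  unfolding bump1_def bump2_def
  by (subst pd_add) (auto intro!: smooth_intros simp: pd_const pd_bump smooth_normsq pd_normsq)

text \<open>Taking the divergence of the gradient soft^(-3/2) (1 + bump1) x and pulling out
  soft^(-5/2) leaves two summands whose signs can be read off separately.\<close>

lemma newton_density_eq:
  "newton_density x = soft x powr (-5/2) *
     (3 * (1 + bump1 (x \<bullet> x)) * (soft x - (1 + bump1 (x \<bullet> x)) * (x \<bullet> x)) + 2 * bump2 (x \<bullet> x) * (x \<bullet> x) * soft x)"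
proof -
  have s: "smooth (\<lambda>x. soft x powr (-3/2))" by (intro smooth_powr smooth_soft soft_pos)
  have p: "pd i (\<lambda>x. soft x powr (-3/2)) = (\<lambda>x. (-3) * soft x powr (-5/2) * ((1 + bump1 (x \<bullet> x)) * x $ i))" for i
    by (subst pd_powr) (auto simp: smooth_soft soft_pos pd_soft)
  have q: "pd i (\<lambda>x. (1 + bump1 (x \<bullet> x)) * x $ i) = (\<lambda>x. bump2 (x \<bullet> x) * (2 * x $ i) * x $ i + (1 + bump1 (x \<bullet> x)))" for i
    by (subst pd_mult[OF smooth_one_bump1 smooth_coord]) (simp add: pd_one_bump1 pd_coord)
  have sp: "soft x powr (-3/2) = soft x powr (-5/2) * soft x"
    using soft_pos[of x] powr_add[of "soft x" "-5/2" 1] by simp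
  have "newton_density x = (\<Sum>i\<in>UNIV.
      (-3) * soft x powr (-5/2) * ((1 + bump1 (x \<bullet> x)) * x $ i) * ((1 + bump1 (x \<bullet> x)) * x $ i) +
      soft x powr (-3/2) * (bump2 (x \<bullet> x) * (2 * x $ i) * x $ i + (1 + bump1 (x \<bullet> x))))"
    unfolding newton_density_def laplacian_eq pd_newton
    by (subst pd_mult[OF s smooth_mult[OF smooth_one_bump1 smooth_coord]]) (simp only: p q)
  also have "\<dots> = (-3) * soft x powr (-5/2) * (1 + bump1 (x \<bullet> x))\<^sup>2 * (\<Sum>i\<in>UNIV. (x $ i)\<^sup>2) +
      soft x powr (-3/2) * (2 * bump2 (x \<bullet> x) * (\<Sum>i\<in>UNIV. (x $ i)\<^sup>2) + 3 * (1 + bump1 (x \<bullet> x)))"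
    by (simp add: sum_3 power2_eq_square algebra_simps)
  finally show ?thesis unfolding inner_R3[symmetric] sp
    by (simp add: algebra_simps power2_eq_square)
qed

text \<open>In the first summand \<open>1 + bump1\<close> lies between 0 and 1 while
  \<open>soft x\<close> is at least \<open>x \<bullet> x\<close>; the second is nonnegative by the
  convexity of \<open>bump0\<close>.\<close>

lemma newton_density_nonneg: "newton_density x \<ge> 0"
proof -
  define t where "t = x \<bullet> x"
  have t: "t \<ge> 0" by (simp add: t_def)
  have b: "bump1 t \<le> 0" "bump1 t > -1" "bump2 t \<ge> 0" "bump0 t \<ge> 0"
    using bump1_bounds bump2_nonneg bump0_nonneg t by auto
  have "(1 + bump1 t) * t \<le> 1 * t" using b t by (intro mult_right_mono) auto
  then have "soft x - (1 + bump1 t) * t \<ge> 0" using b by (simp add: soft_def t_def)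
  then have "0 \<le> 3 * (1 + bump1 t) * (soft x - (1 + bump1 t) * t)"
    using b by (intro mult_nonneg_nonneg) auto
  moreover have "0 \<le> 2 * bump2 t * t * soft x"
    using b t soft_pos[of x] by (intro mult_nonneg_nonneg) auto
  ultimately show ?thesis unfolding newton_density_eq t_def[symmetric]
    by (rule mult_nonneg_nonneg[OF powr_ge_zero add_nonneg_nonneg])
qed

text \<open>Outside the unit ball the potential is -1/|x|, which is harmonic.\<close>

lemma tf_newton_density: "tf 1 newton_density"
proof -
  have "newton_density x = 0" if "norm x > 1" for x
  proof -
    have "x \<bullet> x \<ge> 1" using that by (simp add: dot_square_norm)
    then show ?thesis
      by (simp add: newton_density_eq bump1_zero bump2_zero soft_def bump0_zero)
  qed
  moreover have "smooth newton_density"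
    unfolding newton_density_def laplacian_eq by (intro smooth_sum smooth_pd smooth_newton)
  ultimately show ?thesis by (simp add: tf_def)
qed

definition newton_mass :: real where
  "newton_mass = (\<integral>x. newton_density x \<partial>lborel)"

lemma newton_mass_pos: "newton_mass > 0"
proof -
  have i: "integrable lborel newton_density" using tf_integrable[OF tf_newton_density] .
  have c: "continuous_on UNIV newton_density" using tf_newton_density by (simp add: tf_def smooth_continuous)
  have "newton_mass \<noteq> 0"
  proof
    assume "newton_mass = 0"
    then have "AE x in lborel. newton_density x = 0"
      using integral_nonneg_eq_0_iff_AE[OF i] newton_density_nonneg by (simp add: newton_mass_def)
    then have "AE x in lebesgue. x \<notin> {x. newton_density x \<noteq> 0}"
      by (intro AE_completion) simp
    moreover have o: "open {x. newton_density x \<noteq> 0}"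
      by (intro open_Collect_neq c continuous_on_const)
    ultimately have "negligible {x. newton_density x \<noteq> 0}"
      unfolding negligible_iff_null_sets by (subst AE_iff_null_sets) auto
    with o have "{x. newton_density x \<noteq> 0} = {}" using open_not_negligible by blast
    \<comment> \<open>At the origin the terms containing \<open>x \<bullet> x\<close> drop out, and
      3 (1 + bump1 0) soft(0)^(-3/2) remains.\<close>
    moreover have "newton_density 0 > 0"
      using bump1_bounds(2)[of 0] soft_pos[of 0] by (simp add: newton_density_eq)
    ultimately show False by auto
  qed
  moreover have "newton_mass \<ge> 0"
    unfolding newton_mass_def by (simp add: newton_density_nonneg)
  ultimately show ?thesis by simp
qed

definition mollifier :: "real \<Rightarrow> R3 \<Rightarrow> real" where
  "mollifier s = scaled (1 / (newton_mass * s ^ 3)) s newton_density"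

lemma tf_mollifier: "s > 0 \<Longrightarrow> tf s (mollifier s)"
  unfolding mollifier_def by (intro tf_scaled tf_newton_density)

lemma mollifier_even: "mollifier s (- x) = mollifier s x"
  by (simp add: mollifier_def scaled_def newton_density_eq soft_def)

lemma mollifier_nonneg: "s > 0 \<Longrightarrow> mollifier s x \<ge> 0"
  using newton_mass_pos newton_density_nonneg by (simp add: mollifier_def scaled_def)

lemma integral_mollifier:
  assumes "s > 0"
  shows "(\<integral>x. mollifier s x \<partial>lborel) = 1"
proof -
  have "newton_mass = \<bar>1 / s\<bar> ^ 3 * (\<integral>x. newton_density (0 + (1 / s) *\<^sub>R x) \<partial>lborel)"
    unfolding newton_mass_def
    using assms tf_newton_density by (intro lborel_integral_affine) (auto simp: tf_def smooth_borel)
  then have "(\<integral>x. newton_density (0 + (1 / s) *\<^sub>R x) \<partial>lborel) = newton_mass * s ^ 3"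
    using assms by (simp add: field_simps)
  then show ?thesis using assms newton_mass_pos by (simp add: mollifier_def scaled_def)
qed

lemma mollifier_bounds:
  obtains C where "C \<ge> 0" "\<And>s i x. s > 0 \<Longrightarrow> \<bar>pd i (mollifier s) x\<bar> \<le> C / s ^ 4"
    "\<And>s x. s > 0 \<Longrightarrow> \<bar>laplacian (mollifier s) x\<bar> \<le> C / s ^ 5"
proof -
  have "\<exists>C\<ge>0. \<forall>x. \<bar>pd i newton_density x\<bar> \<le> C" for i
    using tf_bounded[OF tf_pd[OF tf_newton_density]] by metis
  then obtain A where A: "\<And>i. A i \<ge> 0" "\<And>i x. \<bar>pd i newton_density x\<bar> \<le> A i" by metis
  obtain B where B: "B \<ge> 0" "\<And>x. \<bar>laplacian newton_density x\<bar> \<le> B"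
    using tf_bounded[OF tf_laplacian[OF tf_newton_density]] by metis
  define D where "D = B + (\<Sum>i\<in>UNIV. A i)"
  have D: "D \<ge> 0" "A i \<le> D" "B \<le> D" for i
    using A(1) B(1) sum_nonneg[of UNIV A] member_le_sum[of i UNIV A] by (auto simp: D_def)
  have s: "smooth newton_density" using tf_newton_density by (simp add: tf_def)
  show ?thesis
  proof (rule that[of "D / newton_mass"])
    show "D / newton_mass \<ge> 0" using D newton_mass_pos by simp
    fix s :: real and x :: R3 assume s0: "s > 0"
    have "\<bar>pd i newton_density ((1 / s) *\<^sub>R x)\<bar> \<le> D" for i using A(2) D(2) order_trans by blast
    moreover have "pd i (mollifier s) x = pd i newton_density ((1 / s) *\<^sub>R x) / (newton_mass * s ^ 4)" for i
      unfolding mollifier_def pd_scaled[OF s] by (simp add: scaled_def eval_nat_numeral)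
    ultimately show "\<bar>pd i (mollifier s) x\<bar> \<le> D / newton_mass / s ^ 4" for i
      using s0 newton_mass_pos by (simp add: abs_mult divide_right_mono)
    have "\<bar>laplacian newton_density ((1 / s) *\<^sub>R x)\<bar> \<le> D" using B(2) D(3) order_trans by blast
    moreover have "laplacian (mollifier s) x = laplacian newton_density ((1 / s) *\<^sub>R x) / (newton_mass * s ^ 5)"
      unfolding mollifier_def laplacian_scaled[OF s] by (simp add: scaled_def eval_nat_numeral)
    ultimately show "\<bar>laplacian (mollifier s) x\<bar> \<le> D / newton_mass / s ^ 5"
      using s0 newton_mass_pos by (simp add: abs_mult divide_right_mono)
  qed
qed

text \<open>Outside the ball of radius s the rescaled potential \<open>N s\<close> is
  -1/(newton_mass |x|), whatever s is: from outside only the total mass of the density is seen.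
  Hence the potentials at the scales e and R cancel beyond R, although neither has compact
  support.\<close>

lemma mollifier_diff_laplacian:
  assumes "0 < e" "e \<le> R"
  obtains Z where "tf R Z" "laplacian Z = (\<lambda>x. mollifier e x - mollifier R x)"
proof -
  define N where "N s = scaled (1 / (newton_mass * s)) s newton" for s
  have sN: "smooth (N s)" for s unfolding N_def by (intro smooth_scaled smooth_newton)
  have lap: "laplacian (N s) = mollifier s" for s
    unfolding N_def laplacian_scaled[OF smooth_newton] mollifier_def newton_density_def
    by (simp add: power2_eq_square power3_eq_cube mult_ac)
  have val: "N s x = - (1 / (newton_mass * norm x))" if "0 < s" "s < norm x" for s x
  proof -
    have x: "norm x > 0" using that by linarith
    have "((1 / s) *\<^sub>R x) \<bullet> ((1 / s) *\<^sub>R x) = (norm x / s)\<^sup>2"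
      by (simp add: dot_square_norm power2_eq_square)
    moreover have "(norm x / s)\<^sup>2 \<ge> 1" using that by simp
    ultimately have "soft ((1 / s) *\<^sub>R x) = (norm x / s)\<^sup>2" by (simp add: soft_def bump0_zero)
    moreover have "((norm x / s)\<^sup>2) powr (-1/2) = s / norm x"
      using x that by (simp add: powr_minus powr_half_sqrt divide_simps real_sqrt_divide)
    ultimately have "newton (0 + (1 / s) *\<^sub>R x) = - (s / norm x)"
      unfolding newton_def by (simp only: add_0_left)
    then show ?thesis using that x newton_mass_pos
      by (simp add: N_def scaled_def field_simps)
  qed
  show ?thesis
  proof (rule that[of "\<lambda>x. N e x - N R x"])
    show "tf R (\<lambda>x. N e x - N R x)"
      using assms by (auto simp: tf_def val intro!: smooth_diff sN)
    show "laplacian (\<lambda>x. N e x - N R x) = (\<lambda>x. mollifier e x - mollifier R x)"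
      unfolding lap[symmetric] laplacian_eq
      by (simp add: pd_diff sN smooth_pd sum_subtractf)
  qed
qed

section \<open>Cut-off functions at scale R\<close>

definition cutoff :: "real \<Rightarrow> R3 \<Rightarrow> real" where
  "cutoff R = scaled 1 R (\<lambda>x. bump0 (x \<bullet> x))"

lemma tf_cutoff1: "tf 1 (\<lambda>x. bump0 (x \<bullet> x))"
  unfolding tf_def
proof (intro conjI allI impI)
  show "smooth (\<lambda>x. bump0 (x \<bullet> x))" unfolding bump0_def by (intro smooth_intros)
  show "bump0 (x \<bullet> x) = 0" if "norm x > 1" for x :: R3
    using that by (intro bump0_zero) (simp add: dot_square_norm)
qed

lemma tf_cutoff: "R > 0 \<Longrightarrow> tf R (cutoff R)"
  unfolding cutoff_def by (intro tf_scaled tf_cutoff1)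

lemma cutoff_range: "0 \<le> cutoff R x" "cutoff R x \<le> 1"
  by (auto simp: cutoff_def scaled_def bump0_nonneg bump0_le_1)

lemma cutoff_lower:
  obtains c where "c > 0" "\<And>R x. R > 0 \<Longrightarrow> norm x \<le> R / 2 \<Longrightarrow> c \<le> cutoff R x"
\<comment> \<open>On |x| <= R/2 the argument of \<open>bump0\<close> is at most 1/4, and 2/(1 - 1/4)
  = 8/3.\<close>
proof (rule that[of "exp (- (8 / 3))"])
  fix R :: real and x :: R3 assume R: "R > 0" "norm x \<le> R / 2"
  define t where "t = ((1 / R) *\<^sub>R x) \<bullet> ((1 / R) *\<^sub>R x)"
  have "t = (norm x / R)\<^sup>2" by (simp add: t_def dot_square_norm power2_eq_square)
  also have "\<dots> \<le> (1 / 2)\<^sup>2" using R by (intro power_mono) (auto simp: field_simps)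
  finally have t: "t \<le> 1 / 4" by (simp add: power2_eq_square)
  then have "2 / (1 - t) \<le> 8 / 3" by (simp add: field_simps)
  moreover have "cutoff R x = bump0 t" by (simp add: cutoff_def scaled_def t_def)
  ultimately show "exp (- (8 / 3)) \<le> cutoff R x"
    using t by (simp add: bump0_def bump_def)
qed simp

lemma cutoff_bounds:
  obtains C where "C \<ge> 0" "\<And>R i x. R > 0 \<Longrightarrow> \<bar>pd i (cutoff R) x\<bar> \<le> C / R"
    "\<And>R x. R > 0 \<Longrightarrow> \<bar>laplacian (cutoff R) x\<bar> \<le> C / R\<^sup>2"
proof -
  let ?f = "\<lambda>x::R3. bump0 (x \<bullet> x)"
  have "\<exists>C\<ge>0. \<forall>x. \<bar>pd i ?f x\<bar> \<le> C" for i
    using tf_bounded[OF tf_pd[OF tf_cutoff1]] by metis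
  then obtain A where A: "\<And>i. A i \<ge> 0" "\<And>i x. \<bar>pd i ?f x\<bar> \<le> A i" by metis
  obtain B where B: "B \<ge> 0" "\<And>x. \<bar>laplacian ?f x\<bar> \<le> B"
    using tf_bounded[OF tf_laplacian[OF tf_cutoff1]] by metis
  define D where "D = B + (\<Sum>i\<in>UNIV. A i)"
  have D: "D \<ge> 0" "A i \<le> D" "B \<le> D" for i
    using A(1) B(1) sum_nonneg[of UNIV A] member_le_sum[of i UNIV A] by (auto simp: D_def)
  have s: "smooth ?f" using tf_cutoff1 by (simp add: tf_def)
  show ?thesis
  proof (rule that[OF D(1)])
    fix R :: real and x :: R3 assume R: "R > 0"
    have "\<bar>pd i ?f ((1 / R) *\<^sub>R x)\<bar> \<le> D" for i using A(2) D(2) order_trans by blast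
    then show "\<bar>pd i (cutoff R) x\<bar> \<le> D / R" for i
      using R unfolding cutoff_def pd_scaled[OF s] by (simp add: scaled_def abs_mult divide_right_mono)
    have "\<bar>laplacian ?f ((1 / R) *\<^sub>R x)\<bar> \<le> D" using B(2) D(3) order_trans by blast
    then show "\<bar>laplacian (cutoff R) x\<bar> \<le> D / R\<^sup>2"
      using R unfolding cutoff_def laplacian_scaled[OF s] by (simp add: scaled_def abs_mult divide_right_mono)
  qed
qed

subsection \<open>Averages and translations\<close>

lemma locint_bound:
  assumes "locint g" "f \<in> borel_measurable borel" "\<And>x. \<bar>f x\<bar> \<le> \<bar>g x\<bar>"
  shows "locint f"
  unfolding locint_def
proof (intro conjI allI)
  fix r
  show "integrable lborel (\<lambda>x. indicator (cball 0 r) x * f x)"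
  proof (rule Bochner_Integration.integrable_bound)
    show "integrable lborel (\<lambda>x. indicator (cball 0 r) x * g x)" using assms by (simp add: locint_def)
    show "(\<lambda>x. indicator (cball 0 r) x * f x) \<in> borel_measurable lborel"
      using assms by (auto intro!: borel_measurable_times borel_measurable_indicator)
    show "AE x in lborel. norm (indicator (cball 0 r) x * f x) \<le> norm (indicator (cball 0 r) x * g x)"
      using assms by (intro AE_I2) (auto simp: indicator_def)
  qed
qed (use assms in auto)

lemma locint_add: "locint f \<Longrightarrow> locint g \<Longrightarrow> locint (\<lambda>x. f x + g x)"
  and locint_diff: "locint f \<Longrightarrow> locint g \<Longrightarrow> locint (\<lambda>x. f x - g x)"
  and locint_cmult: "locint f \<Longrightarrow> locint (\<lambda>x. c * f x)"
  by (auto simp: locint_def distrib_left right_diff_distrib mult.left_commute[of _ c])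

lemma locint_const: "locint (\<lambda>x. c)"
  by (intro locint_continuous continuous_on_const)

lemma locint_sum: "(\<And>i. i \<in> I \<Longrightarrow> locint (f i)) \<Longrightarrow> locint (\<lambda>x. \<Sum>i\<in>I. f i x)"
  by (induction I rule: infinite_finite_induct) (auto intro: locint_add locint_const)

lemma conv_add: "tf r k \<Longrightarrow> locint f \<Longrightarrow> locint g \<Longrightarrow> conv k (\<lambda>y. f y + g y) x = conv k f x + conv k g x"
  unfolding conv_def by (simp add: distrib_left conv_integrable)

lemma conv_cmult: "conv k (\<lambda>y. c * f y) x = c * conv k f x"
  unfolding conv_def by (simp add: mult.left_commute)

lemma conv_diff: "tf r k \<Longrightarrow> locint f \<Longrightarrow> locint g \<Longrightarrow> conv k (\<lambda>y. f y - g y) x = conv k f x - conv k g x"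
  unfolding conv_def by (simp add: right_diff_distrib conv_integrable)

lemma conv_sum:
  assumes "tf r k" "\<And>i. i \<in> I \<Longrightarrow> locint (f i)"
  shows "conv k (\<lambda>y. \<Sum>i\<in>I. f i y) x = (\<Sum>i\<in>I. conv k (f i) x)"
  unfolding conv_def sum_distrib_left
  using assms by (intro Bochner_Integration.integral_sum conv_integrable)

lemma conv_mono:
  assumes "tf r k" "\<And>x. k x \<ge> 0" "locint f" "locint g" "\<And>y. f y \<le> g y"
  shows "conv k f x \<le> conv k g x"
  unfolding conv_def
  using assms by (intro integral_mono conv_integrable mult_left_mono)

lemma conv_mollifier_const: "s > 0 \<Longrightarrow> conv (mollifier s) (\<lambda>y. c) x = c"
  using conv_cmult[of "mollifier s" c "\<lambda>y. 1" x] conv_one[OF tf_mollifier, of s x]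
  by (simp add: integral_mollifier)

text \<open>\<open>mollifier s\<close> is a probability density, so convolution with it is an
  expectation. Jensen's inequality and the minimality of the variance are both read off this
  expansion of a square.\<close>

lemma conv_variance:
  assumes s: "s > 0" and f: "locint f" "locint (\<lambda>x. (f x)\<^sup>2)"
  shows "conv (mollifier s) (\<lambda>y. (f y - c)\<^sup>2) x = conv (mollifier s) (\<lambda>y. (f y)\<^sup>2) x - 2 * c * conv (mollifier s) f x + c\<^sup>2"
proof -
  have "conv (mollifier s) (\<lambda>y. (f y - c)\<^sup>2) x = conv (mollifier s) (\<lambda>y. ((f y)\<^sup>2 - 2 * c * f y) + c\<^sup>2) x"
    by (simp add: power2_diff algebra_simps)
  also have "\<dots> = conv (mollifier s) (\<lambda>y. (f y)\<^sup>2 - 2 * c * f y) x + c\<^sup>2"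
    using f by (subst conv_add[OF tf_mollifier[OF s]])
      (auto intro!: locint_diff locint_cmult locint_const simp: conv_mollifier_const[OF s])
  also have "conv (mollifier s) (\<lambda>y. (f y)\<^sup>2 - 2 * c * f y) x = conv (mollifier s) (\<lambda>y. (f y)\<^sup>2) x - 2 * c * conv (mollifier s) f x"
    using f by (subst conv_diff[OF tf_mollifier[OF s]]) (auto intro!: locint_cmult simp: conv_cmult)
  finally show ?thesis .
qed

lemma locint_affine_square:
  assumes "locint f" "locint (\<lambda>x. (f x)\<^sup>2)"
  shows "locint (\<lambda>x. (f x - c)\<^sup>2)"
  using assms by (auto simp: power2_diff intro!: locint_add locint_diff locint_const)
    (use locint_cmult[of f "2 * c"] in \<open>simp add: mult_ac\<close>)

lemma conv_jensen:
  assumes s: "s > 0" and f: "locint f" "locint (\<lambda>x. (f x)\<^sup>2)"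
  shows "(conv (mollifier s) f x)\<^sup>2 \<le> conv (mollifier s) (\<lambda>y. (f y)\<^sup>2) x"
proof -
  define c where "c = conv (mollifier s) f x"
  have "0 \<le> conv (mollifier s) (\<lambda>y. (f y - c)\<^sup>2) x"
    unfolding conv_def using mollifier_nonneg[OF s] by (intro integral_nonneg_AE AE_I2) auto
  then show ?thesis
    unfolding conv_variance[OF assms] c_def[symmetric] by (simp add: power2_eq_square)
qed

lemma conv_variance_le:
  assumes s: "s > 0" and f: "locint f" "locint (\<lambda>x. (f x)\<^sup>2)"
  shows "conv (mollifier s) (\<lambda>y. (f y)\<^sup>2) x - (conv (mollifier s) f x)\<^sup>2 \<le> conv (mollifier s) (\<lambda>y. (f y - c)\<^sup>2) x"
  unfolding conv_variance[OF assms] using zero_le_power2[of "conv (mollifier s) f x - c"]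
  by (simp add: power2_diff algebra_simps)

text \<open>Polarisation: the off-diagonal commutators are controlled by the diagonal ones.\<close>

lemma conv_covariance:
  fixes x :: R3
  assumes s: "s > 0" and f: "locint f" "locint (\<lambda>x. (f x)\<^sup>2)" and g: "locint g" "locint (\<lambda>x. (g x)\<^sup>2)"
    and fg: "locint (\<lambda>x. f x * g x)"
  defines "\<And>a b. cov a b \<equiv> conv (mollifier s) (\<lambda>y. a y * b y) x - conv (mollifier s) a x * conv (mollifier s) b x"
  shows "\<bar>cov f g\<bar> \<le> (cov f f + cov g g) / 2"
proof -
  let ?E = "\<lambda>a. conv (mollifier s) a x"
  have t: "tf s (mollifier s)" using s by (rule tf_mollifier)
  have l: "locint (\<lambda>y. c * f y + d * g y)" for c d using f g by (intro locint_add locint_cmult)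
  have e2: "(\<lambda>y. (f y + c * g y)\<^sup>2) = (\<lambda>y. ((f y)\<^sup>2 + c\<^sup>2 * (g y)\<^sup>2) + 2 * c * (f y * g y))" for c
    by (auto simp: power2_eq_square algebra_simps)
  have "(?E f + c * ?E g)\<^sup>2 \<le> ?E (\<lambda>y. (f y)\<^sup>2) + c\<^sup>2 * ?E (\<lambda>y. (g y)\<^sup>2) + 2 * c * ?E (\<lambda>y. f y * g y)" for c
  proof -
    have "locint (\<lambda>y. f y + c * g y)" using l[of 1 c] by simp
    moreover have "locint (\<lambda>y. (f y + c * g y)\<^sup>2)"
      unfolding e2 using f g fg by (intro locint_add locint_cmult)
    ultimately have "(?E (\<lambda>y. f y + c * g y))\<^sup>2 \<le> ?E (\<lambda>y. (f y + c * g y)\<^sup>2)"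
      by (rule conv_jensen[OF s])
    then show ?thesis unfolding e2
      using f g fg by (simp add: conv_add[OF t] locint_cmult locint_add conv_cmult)
  qed
  from this[of 1] this[of "-1"] show ?thesis
    unfolding assms(7) by (auto simp: power2_eq_square algebra_simps abs_if)
qed

section \<open>Continuity of translations in L^1 and L^4\<close>

lemma integrable_shift:
  fixes f :: "R3 \<Rightarrow> real"
  assumes "integrable lborel f"
  shows "integrable lborel (\<lambda>x. f (x - z))"
proof -
  have "lborel = distr lborel borel (\<lambda>x. x - z)"
    using lborel_affine[of 1 "- z"] by (simp add: density_1)
  then have "integrable (distr lborel borel (\<lambda>x. x - z)) f" using assms by simp
  then show ?thesis
    using borel_measurable_integrable[OF assms] by (subst (asm) integrable_distr_eq) auto
qed

lemma integral_shift:
  fixes f :: "R3 \<Rightarrow> real"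
  assumes "f \<in> borel_measurable borel"
  shows "(\<integral>x. f (x - z) \<partial>lborel) = (\<integral>x. f x \<partial>lborel)"
  using lborel_integral_affine[of 1 f "- z"] assms by simp

definition shift_dist :: "(R3 \<Rightarrow> real) \<Rightarrow> R3 \<Rightarrow> real" where
  "shift_dist f z = (\<integral>x. \<bar>f (x - z) - f x\<bar> \<partial>lborel)"

lemma shift_dist_nonneg: "shift_dist f z \<ge> 0"
  by (simp add: shift_dist_def)

lemma shift_dist_perturb:
  assumes f: "integrable lborel f" and g: "integrable lborel g"
  shows "shift_dist f z \<le> shift_dist g z + 2 * (\<integral>x. \<bar>f x - g x\<bar> \<partial>lborel)"
proof -
  note i = f g integrable_shift[OF f, of z] integrable_shift[OF g, of z]
  have b: "(\<lambda>x. \<bar>f x - g x\<bar>) \<in> borel_measurable borel"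
    using borel_measurable_integrable[OF f] borel_measurable_integrable[OF g] by simp
  have "shift_dist f z \<le> (\<integral>x. \<bar>g (x - z) - g x\<bar> + (\<bar>f (x - z) - g (x - z)\<bar> + \<bar>f x - g x\<bar>) \<partial>lborel)"
    unfolding shift_dist_def using i by (intro integral_mono) auto
  also have "\<dots> = shift_dist g z + ((\<integral>x. \<bar>f (x - z) - g (x - z)\<bar> \<partial>lborel) + (\<integral>x. \<bar>f x - g x\<bar> \<partial>lborel))"
    unfolding shift_dist_def using i by simp
  also have "(\<integral>x. \<bar>f (x - z) - g (x - z)\<bar> \<partial>lborel) = (\<integral>x. \<bar>f x - g x\<bar> \<partial>lborel)"
    using integral_shift[OF b, of z] by simp
  finally show ?thesis by simp
qed

text \<open>Translations are isometries of L^1, so replacing \<open>f\<close> by an approximation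
  costs twice the error, uniformly in the shift. Continuity at 0 therefore survives L^1
  limits.\<close>

lemma shift_dist_approx:
  assumes f: "integrable lborel f"
    and a: "\<And>e. e > 0 \<Longrightarrow> \<exists>g. integrable lborel g \<and> (\<integral>x. \<bar>f x - g x\<bar> \<partial>lborel) \<le> e \<and> (shift_dist g \<longlongrightarrow> 0) (at 0)"
  shows "(shift_dist f \<longlongrightarrow> 0) (at 0)"
proof (rule tendstoI)
  fix e :: real assume "e > 0"
  then obtain g where g: "integrable lborel g" "(\<integral>x. \<bar>f x - g x\<bar> \<partial>lborel) \<le> e / 4" "(shift_dist g \<longlongrightarrow> 0) (at 0)"
    using a[of "e / 4"] by auto
  have "\<forall>\<^sub>F z in at 0. dist (shift_dist g z) 0 < e / 4"
    using g(3) \<open>e > 0\<close> by (intro tendstoD) auto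
  then show "\<forall>\<^sub>F z in at 0. dist (shift_dist f z) 0 < e"
  proof eventually_elim
    case (elim z)
    then show ?case using shift_dist_perturb[OF f g(1), of z] g(2) shift_dist_nonneg[of f z] \<open>e > 0\<close> by (simp add: dist_norm)
  qed
qed

text \<open>Translation preserves the measure of S, so the L^1 distance is twice the integral of the
  positive part \<open>P z\<close>. That part is dominated by the indicator of S and, as S is open,
  vanishes at each point for small z.\<close>

lemma shift_dist_open:
  assumes "open S" "emeasure lborel S < \<infinity>"
  shows "(shift_dist (indicator S) \<longlongrightarrow> 0) (at 0)"
proof -
  have i: "integrable lborel (indicator S :: R3 \<Rightarrow> real)" using assms by simp
  define P where "P z x = max 0 (indicator S x - indicator S (x - z) :: real)" for z x
  have ish: "integrable lborel (\<lambda>x. indicator S (x - z) :: real)" for z using integrable_shift[OF i] .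
  have P: "integrable lborel (P z)" for z unfolding P_def by (intro Bochner_Integration.integrable_max Bochner_Integration.integrable_diff i ish) simp
  have eq: "shift_dist (indicator S) z = 2 * (\<integral>x. P z x \<partial>lborel)" for z
  proof -
    have "shift_dist (indicator S) z = (\<integral>x. 2 * P z x + (indicator S (x - z) - indicator S x) \<partial>lborel)"
      unfolding shift_dist_def P_def by (intro Bochner_Integration.integral_cong) (auto simp: indicator_def)
    also have "\<dots> = 2 * (\<integral>x. P z x \<partial>lborel) + ((\<integral>x. indicator S (x - z) \<partial>lborel) - (\<integral>x. indicator S x \<partial>lborel))"
      using i ish P by simp
    also have "(\<integral>x. indicator S (x - z) \<partial>lborel) = (\<integral>x. (indicator S x :: real) \<partial>lborel)"
      using assms by (intro integral_shift) auto
    finally show ?thesis by simp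
  qed
  have "((\<lambda>z. \<integral>x. P z x \<partial>lborel) \<longlongrightarrow> (\<integral>x. (0::real) \<partial>(lborel :: R3 measure))) (at 0)"
    unfolding tendsto_at_iff_sequentially
  proof (intro allI impI)
    fix X :: "nat \<Rightarrow> R3" assume "\<forall>i. X i \<in> UNIV - {0}" and X: "X \<longlonglongrightarrow> 0"
    show "((\<lambda>z. \<integral>x. P z x \<partial>lborel) \<circ> X) \<longlonglongrightarrow> (\<integral>x. (0::real) \<partial>(lborel :: R3 measure))"
      unfolding comp_def
    proof (rule integral_dominated_convergence[where w = "indicator S"])
      show "AE x in lborel. (\<lambda>n. P (X n) x) \<longlonglongrightarrow> 0"
      proof (rule AE_I2)
        fix x :: R3
        show "(\<lambda>n. P (X n) x) \<longlonglongrightarrow> 0"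
        proof (cases "x \<in> S")
          case True
          have "(\<lambda>n. x - X n) \<longlonglongrightarrow> x - 0" by (intro tendsto_intros X)
          then have "\<forall>\<^sub>F n in sequentially. x - X n \<in> S"
            using True assms(1) by (simp add: topological_tendstoD)
          then have "\<forall>\<^sub>F n in sequentially. P (X n) x = 0"
            by eventually_elim (auto simp: P_def)
          then show ?thesis by (rule tendsto_eventually)
        next
          case False
          then show ?thesis by (simp add: P_def)
        qed
      qed
      show "AE x in lborel. norm (P (X n) x) \<le> indicator S x" for n
        by (auto simp: P_def indicator_def)
      show "P (X n) \<in> borel_measurable lborel" for n using P by (rule borel_measurable_integrable)
    qed (use i in auto)
  qed
  then show ?thesis unfolding eq[abs_def] by (auto intro!: tendsto_eq_intros)
qed

lemma shift_dist_cmult: "shift_dist (\<lambda>x. c * f x) z = \<bar>c\<bar> * shift_dist f z"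
  unfolding shift_dist_def by (simp add: abs_mult flip: right_diff_distrib)

text \<open>Measure-theoretic induction: a Borel set is approximated from outside by open sets, for
  which dominated convergence was available; sums and dominated limits inherit the property.\<close>

lemma shift_dist_tendsto_0:
  assumes "integrable lborel f"
  shows "(shift_dist f \<longlongrightarrow> 0) (at 0)"
  using assms
proof (induction rule: integrable_induct)
  case (base A c)
  have iA: "integrable lborel (indicator A :: R3 \<Rightarrow> real)" using base by simp
  have "(shift_dist (indicator A) \<longlongrightarrow> 0) (at 0)"
  proof (rule shift_dist_approx[OF iA])
    fix e :: real assume e: "e > 0"
    obtain T where T: "open T" "A \<subseteq> T" "emeasure lebesgue (T - A) < ennreal e"
      using sets_lebesgue_outer_open[OF sets_completionI_sets[OF base(1)] e] by metis
    have TA: "T - A \<in> sets lborel" using borel_open[OF T(1)] base(1) by (simp add: sets.Diff)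
    have m: "emeasure lborel (T - A) < ennreal e" using T(3) TA by simp
    have "emeasure lborel T = emeasure lborel (T - A) + emeasure lborel A"
      using T base by (subst plus_emeasure) (auto simp: Un_absorb2)
    also have "\<dots> < \<infinity>" using m base by (auto simp: less_top[symmetric])
    finally have fin: "emeasure lborel T < \<infinity>" .
    have "(\<integral>x. \<bar>indicator A x - indicator T x :: real\<bar> \<partial>lborel) = (\<integral>x. indicator (T - A) x \<partial>lborel)"
      using T(2) by (intro Bochner_Integration.integral_cong) (auto simp: indicator_def)
    also have "\<dots> = measure lborel (T - A)" using TA by simp
    also have "\<dots> \<le> e"
      using m e by (simp add: measure_def enn2real_leI less_imp_le)
    finally show "\<exists>g. integrable lborel g \<and> (\<integral>x. \<bar>indicator A x - g x\<bar> \<partial>lborel) \<le> e \<and> (shift_dist g \<longlongrightarrow> 0) (at 0)"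
      using T fin shift_dist_open[OF T(1) fin] by (intro exI[of _ "indicator T"]) auto
  qed
  then have "((\<lambda>z. \<bar>c\<bar> * shift_dist (indicator A) z) \<longlongrightarrow> \<bar>c\<bar> * 0) (at 0)" by (intro tendsto_intros)
  then show ?case using shift_dist_cmult[of c "indicator A", abs_def] by (simp add: mult.commute fun_eq_iff)
next
  case (add f g)
  have "shift_dist (\<lambda>x. f x + g x) z \<le> shift_dist f z + shift_dist g z" for z
  proof -
    note i = add.hyps integrable_shift[OF add.hyps(1), of z] integrable_shift[OF add.hyps(2), of z]
    have "shift_dist (\<lambda>x. f x + g x) z \<le> (\<integral>x. \<bar>f (x - z) - f x\<bar> + \<bar>g (x - z) - g x\<bar> \<partial>lborel)"
      unfolding shift_dist_def using i by (intro integral_mono) auto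
    also have "\<dots> = shift_dist f z + shift_dist g z"
      unfolding shift_dist_def using i by simp
    finally show ?thesis .
  qed
  then show ?case
    by (intro tendsto_sandwich[OF always_eventually always_eventually tendsto_const tendsto_add_zero[OF add.IH]] allI shift_dist_nonneg)
next
  case (lim f s)
  show ?case
  proof (rule shift_dist_approx[OF lim.hyps(4)])
    fix e :: real assume e: "e > 0"
    have "(\<lambda>i. \<integral>x. \<bar>f x - s i x\<bar> \<partial>lborel) \<longlonglongrightarrow> (\<integral>x. (0::real) \<partial>(lborel :: R3 measure))"
    proof (rule integral_dominated_convergence[where w = "\<lambda>x. 3 * \<bar>f x\<bar>"])
      show "AE x in lborel. (\<lambda>i. \<bar>f x - s i x\<bar>) \<longlonglongrightarrow> 0"
      proof (rule AE_I2)
        fix x :: R3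
        have "(\<lambda>i. \<bar>f x - s i x\<bar>) \<longlonglongrightarrow> \<bar>f x - f x\<bar>" using lim.hyps(2)[of x] by (intro tendsto_intros) auto
        then show "(\<lambda>i. \<bar>f x - s i x\<bar>) \<longlonglongrightarrow> 0" by simp
      qed
      show "AE x in lborel. norm \<bar>f x - s i x\<bar> \<le> 3 * \<bar>f x\<bar>" for i
      proof (rule AE_I2)
        show "norm \<bar>f x - s i x\<bar> \<le> 3 * \<bar>f x\<bar>" for x using lim.hyps(3)[of x i] by simp
      qed
      show "(\<lambda>x. \<bar>f x - s i x\<bar>) \<in> borel_measurable lborel" for i
        using borel_measurable_integrable[OF lim.hyps(1)[of i]] borel_measurable_integrable[OF lim.hyps(4)] by simp
    qed (use lim.hyps(4) in auto)
    then have "\<forall>\<^sub>F i in sequentially. dist (\<integral>x. \<bar>f x - s i x\<bar> \<partial>lborel) 0 < e"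
      using e by (intro tendstoD) auto
    then obtain i where "(\<integral>x. \<bar>f x - s i x\<bar> \<partial>lborel) < e"
      by (auto simp: dist_norm eventually_sequentially)
    then show "\<exists>g. integrable lborel g \<and> (\<integral>x. \<bar>f x - g x\<bar> \<partial>lborel) \<le> e \<and> (shift_dist g \<longlongrightarrow> 0) (at 0)"
      using lim.hyps(1) lim.IH by (intro exI[of _ "s i"]) auto
  qed
qed

text \<open>This transfers the continuity of translations from L^1 to L^4: it is applied to the
  values of f at x - z and x, and |f|^3 f is locally integrable if f is locally in L^4. The constant
  8 stems from opposite signs, through (a + b)^4 <= 8 (a^4 + b^4).\<close>

lemma diff_power4_le: "((a::real) - b) ^ 4 \<le> 8 * \<bar>\<bar>a\<bar> ^ 3 * a - \<bar>b\<bar> ^ 3 * b\<bar>"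
proof -
  have same: "(a - b) ^ 4 \<le> \<bar>\<bar>a\<bar> ^ 3 * a - \<bar>b\<bar> ^ 3 * b\<bar>" if "0 \<le> b" "b \<le> a" for a b :: real
  proof -
    define d where "d = a - b"
    have d: "d \<ge> 0" "a = b + d" using that by (auto simp: d_def)
    have "\<bar>a\<bar> ^ 3 * a - \<bar>b\<bar> ^ 3 * b = (b + d) ^ 4 - b ^ 4"
      using that d by (simp add: eval_nat_numeral)
    also have "\<dots> = d ^ 4 + (4 * b ^ 3 * d + 6 * b\<^sup>2 * d\<^sup>2 + 4 * b * d ^ 3)" by (simp add: eval_nat_numeral algebra_simps)
    also have "\<dots> \<ge> d ^ 4" using that d by simp
    finally show ?thesis by (simp add: d_def)
  qed
  have opp: "(a + b) ^ 4 \<le> 8 * (a ^ 4 + b ^ 4)" for a b :: real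
  proof -
    have q: "(x + y)\<^sup>2 \<le> 2 * (x\<^sup>2 + y\<^sup>2)" for x y :: real
      using zero_le_power2[of "x - y"] by (simp add: power2_eq_square algebra_simps)
    have "(a + b) ^ 4 = ((a + b)\<^sup>2)\<^sup>2" by simp
    also have "\<dots> \<le> (2 * (a\<^sup>2 + b\<^sup>2))\<^sup>2" by (intro power_mono q) auto
    also have "\<dots> = 4 * (a\<^sup>2 + b\<^sup>2)\<^sup>2" by (simp only: power_mult_distrib) simp
    also have "\<dots> \<le> 4 * (2 * ((a\<^sup>2)\<^sup>2 + (b\<^sup>2)\<^sup>2))" using q[of "a\<^sup>2" "b\<^sup>2"] by (intro mult_left_mono) auto
    finally show ?thesis by simp
  qed
  have e8: "t \<le> 8 * \<bar>u\<bar>" if "t \<le> \<bar>u\<bar>" for t u :: real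
    using that abs_ge_zero[of u] by linarith
  have sym: "(a - b) ^ 4 = (b - a) ^ 4" by (simp add: eval_nat_numeral algebra_simps)
  consider "0 \<le> b" "b \<le> a" | "0 \<le> a" "a \<le> b" | "a \<le> 0" "b \<le> 0" "a \<le> b" | "a \<le> 0" "b \<le> 0" "b \<le> a"
    | "a \<ge> 0" "b \<le> 0" | "a \<le> 0" "b \<ge> 0" by linarith
  then show ?thesis
  proof cases
    case 1 then show ?thesis by (intro e8 same)
  next
    case 2
    then have "(b - a) ^ 4 \<le> \<bar>\<bar>a\<bar> ^ 3 * a - \<bar>b\<bar> ^ 3 * b\<bar>"
      using same[of a b] by (simp only: abs_minus_commute)
    then show ?thesis unfolding sym by (rule e8)
  next
    case 3
    then have "(b - a) ^ 4 \<le> \<bar>\<bar>a\<bar> ^ 3 * a - \<bar>b\<bar> ^ 3 * b\<bar>"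
      using same[of "-b" "-a"] by (simp add: abs_minus_commute)
    then show ?thesis unfolding sym by (rule e8)
  next
    case 4
    then have "(a - b) ^ 4 \<le> \<bar>\<bar>a\<bar> ^ 3 * a - \<bar>b\<bar> ^ 3 * b\<bar>"
      using same[of "-a" "-b"] by (simp add: abs_minus_commute)
    then show ?thesis by (rule e8)
  next
    case 5
    then have e: "\<bar>a\<bar> ^ 3 * a = a ^ 4" "\<bar>b\<bar> ^ 3 * b = - (b ^ 4)" by (simp_all add: eval_nat_numeral)
    show ?thesis unfolding e using opp[of a "-b"] abs_ge_self[of "a ^ 4 + b ^ 4"] by simp
  next
    case 6
    then have e: "\<bar>a\<bar> ^ 3 * a = - (a ^ 4)" "\<bar>b\<bar> ^ 3 * b = b ^ 4" by (simp_all add: eval_nat_numeral)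
    show ?thesis unfolding e sym using opp[of b "-a"] abs_ge_minus_self[of "- (a ^ 4) - b ^ 4"] by simp
  qed
qed

lemma shift_power4:
  assumes f: "f \<in> borel_measurable borel" "locint (\<lambda>x. (f x) ^ 4)" and \<eta>: "\<eta> > 0"
  obtains \<delta> where "\<delta> > 0"
    "\<And>z. norm z \<le> \<delta> \<Longrightarrow> (\<integral>\<^sup>+x. ennreal (indicator (cball 0 R) x * (f (x - z) - f x) ^ 4) \<partial>lborel) \<le> ennreal \<eta>"
proof -
  \<comment> \<open>The radius R + 1 keeps x - z inside the cut-off when |x| <= R and |z| <=
    1.\<close>
  define H where "H x = indicator (cball 0 (R + 1)) x * (\<bar>f x\<bar> ^ 3 * f x)" for x
  have "locint (\<lambda>x. \<bar>f x\<bar> ^ 3 * f x)"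
    by (rule locint_bound[OF f(2)]) (use f in \<open>auto simp: abs_mult eval_nat_numeral\<close>)
  then have H: "integrable lborel H" unfolding H_def[abs_def] by (simp add: locint_def)
  have "\<forall>\<^sub>F z in at 0. dist (shift_dist H z) 0 < \<eta> / 8"
    using shift_dist_tendsto_0[OF H] \<eta> by (intro tendstoD) auto
  then obtain d where d: "d > 0" "\<forall>z. z \<noteq> 0 \<and> dist z 0 < d \<longrightarrow> dist (shift_dist H z) 0 < \<eta> / 8"
    by (auto simp: eventually_at)
  show ?thesis
  proof (rule that[of "min (d / 2) 1"])
    fix z :: R3 assume z: "norm z \<le> min (d / 2) 1"
    have le: "shift_dist H z \<le> \<eta> / 8"
    proof (cases "z = 0")
      case True then show ?thesis using \<eta> by (simp add: shift_dist_def)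
    next
      case False
      then have "dist (shift_dist H z) 0 < \<eta> / 8" using d z by simp
      then show ?thesis by (simp add: dist_norm)
    qed
    have "(\<integral>\<^sup>+x. ennreal (indicator (cball 0 R) x * (f (x - z) - f x) ^ 4) \<partial>lborel)
        \<le> (\<integral>\<^sup>+x. ennreal (8 * \<bar>H (x - z) - H x\<bar>) \<partial>lborel)"
    proof (intro nn_integral_mono ennreal_leI)
      fix x :: R3
      show "indicator (cball 0 R) x * (f (x - z) - f x) ^ 4 \<le> 8 * \<bar>H (x - z) - H x\<bar>"
      proof (cases "norm x \<le> R")
        case True
        then have "norm (x - z) \<le> R + 1" using z norm_triangle_ineq4[of x z] by linarith
        then show ?thesis using True diff_power4_le[of "f (x - z)" "f x"] by (simp add: H_def)
      qed auto
    qed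
    also have "\<dots> = ennreal (\<integral>x. 8 * \<bar>H (x - z) - H x\<bar> \<partial>lborel)"
      using H integrable_shift[OF H, of z] by (intro nn_integral_eq_integral) auto
    also have "(\<integral>x. 8 * \<bar>H (x - z) - H x\<bar> \<partial>lborel) = 8 * shift_dist H z" by (simp add: shift_dist_def)
    also have "ennreal \<dots> \<le> ennreal \<eta>" using le by (intro ennreal_leI) simp
    finally show "(\<integral>\<^sup>+x. ennreal (indicator (cball 0 R) x * (f (x - z) - f x) ^ 4) \<partial>lborel) \<le> ennreal \<eta>" .
  qed (use d in auto)
qed

lemma nn_integral_reflect:
  fixes f :: "R3 \<Rightarrow> ennreal"
  assumes "f \<in> borel_measurable borel"
  shows "(\<integral>\<^sup>+y. f (x - y) \<partial>lborel) = (\<integral>\<^sup>+y. f y \<partial>lborel)"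
proof -
  have "(\<integral>\<^sup>+y. f y \<partial>lborel) = (\<integral>\<^sup>+y. f y \<partial>density (distr lborel borel (\<lambda>y. x - y)) (\<lambda>_. 1))"
    using lborel_affine[of "-1" x] by (simp add: density_1)
  also have "\<dots> = (\<integral>\<^sup>+y. f (x - y) \<partial>lborel)"
    using assms by (simp add: density_1 nn_integral_distr)
  finally show ?thesis by simp
qed

text \<open>Substituting y = x - z and exchanging the integrals turns the left-hand side into an
  average, with weights of total mass one, of the shift errors of \<open>shift_power4\<close> over
  |z| <= s.\<close>

lemma mollified_oscillation:
  assumes f: "f \<in> borel_measurable borel" "locint (\<lambda>x. (f x) ^ 4)" and \<eta>: "\<eta> > 0"
  obtains \<delta> where "\<delta> > 0"
    "\<And>s. 0 < s \<Longrightarrow> s \<le> \<delta> \<Longrightarrow>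
      (\<integral>\<^sup>+x. ennreal (indicator (cball 0 R) x) * (\<integral>\<^sup>+y. ennreal (mollifier s (x - y) * (f y - f x) ^ 4) \<partial>lborel) \<partial>lborel) \<le> ennreal \<eta>"
proof -
  obtain \<delta> where \<delta>: "\<delta> > 0"
    "\<And>z. norm z \<le> \<delta> \<Longrightarrow> (\<integral>\<^sup>+x. ennreal (indicator (cball 0 R) x * (f (x - z) - f x) ^ 4) \<partial>lborel) \<le> ennreal \<eta>"
    using shift_power4[OF assms] by blast
  show ?thesis
  proof (rule that[OF \<delta>(1)])
    fix s :: real assume s: "0 < s" "s \<le> \<delta>"
    have [measurable]: "mollifier s \<in> borel_measurable borel"
      using tf_mollifier[OF s(1)] by (simp add: tf_def smooth_borel)
    note [measurable] = f(1)
    have "(\<integral>\<^sup>+x. ennreal (indicator (cball 0 R) x) * (\<integral>\<^sup>+y. ennreal (mollifier s (x - y) * (f y - f x) ^ 4) \<partial>lborel) \<partial>lborel)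
      = (\<integral>\<^sup>+x. \<integral>\<^sup>+z. ennreal (mollifier s z) * ennreal (indicator (cball 0 R) x * (f (x - z) - f x) ^ 4) \<partial>lborel \<partial>lborel)"
    proof (intro nn_integral_cong)
      fix x :: R3
      have "(\<integral>\<^sup>+y. ennreal (mollifier s (x - y) * (f y - f x) ^ 4) \<partial>lborel) =
        (\<integral>\<^sup>+z. ennreal (mollifier s z * (f (x - z) - f x) ^ 4) \<partial>lborel)"
        by (subst nn_integral_reflect[symmetric, of _ x]) auto
      then have "ennreal (indicator (cball 0 R) x) * (\<integral>\<^sup>+y. ennreal (mollifier s (x - y) * (f y - f x) ^ 4) \<partial>lborel) =
        (\<integral>\<^sup>+z. ennreal (indicator (cball 0 R) x) * ennreal (mollifier s z * (f (x - z) - f x) ^ 4) \<partial>lborel)"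
        by (simp add: nn_integral_cmult)
      also have "\<dots> = (\<integral>\<^sup>+z. ennreal (mollifier s z) * ennreal (indicator (cball 0 R) x * (f (x - z) - f x) ^ 4) \<partial>lborel)"
        using mollifier_nonneg[OF s(1)]
        by (intro nn_integral_cong) (auto simp: indicator_def ennreal_mult')
      finally show "ennreal (indicator (cball 0 R) x) * (\<integral>\<^sup>+y. ennreal (mollifier s (x - y) * (f y - f x) ^ 4) \<partial>lborel) = \<dots>" .
    qed
    also have "\<dots> = (\<integral>\<^sup>+z. \<integral>\<^sup>+x. ennreal (mollifier s z) * ennreal (indicator (cball 0 R) x * (f (x - z) - f x) ^ 4) \<partial>lborel \<partial>lborel)"
    proof (rule lborel_pair.Fubini')
      have c: "cball 0 R \<in> sets (borel :: R3 measure)" by simp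
      have [measurable]: "(indicator (cball 0 R) :: R3 \<Rightarrow> real) \<in> borel_measurable borel"
        by (intro borel_measurable_indicator c)
      have m: "(\<lambda>z::R3 \<times> R3. g (fst z)) \<in> borel_measurable (lborel \<Otimes>\<^sub>M lborel)" "(\<lambda>z::R3 \<times> R3. g (snd z)) \<in> borel_measurable (lborel \<Otimes>\<^sub>M lborel)"
        if "g \<in> borel_measurable borel" for g :: "R3 \<Rightarrow> real"
        using that by measurable
      have m3: "(\<lambda>z::R3 \<times> R3. f (snd z - fst z)) \<in> borel_measurable (lborel \<Otimes>\<^sub>M lborel)"
        by measurable
      show "(\<lambda>(z, x). ennreal (mollifier s z) * ennreal (indicator (cball 0 R) x * (f (x - z) - f x) ^ 4))
          \<in> borel_measurable (lborel \<Otimes>\<^sub>M lborel)"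
        unfolding case_prod_beta
        by (intro borel_measurable_times_ennreal borel_measurable_times measurable_compose[OF _ measurable_ennreal] borel_measurable_power
            borel_measurable_diff m m3 f(1)) auto
    qed
    also have "\<dots> \<le> (\<integral>\<^sup>+z. ennreal (mollifier s z) * ennreal \<eta> \<partial>lborel)"
    proof (rule nn_integral_mono)
      fix z :: R3
      show "(\<integral>\<^sup>+x. ennreal (mollifier s z) * ennreal (indicator (cball 0 R) x * (f (x - z) - f x) ^ 4) \<partial>lborel) \<le> ennreal (mollifier s z) * ennreal \<eta>"
      proof (cases "norm z \<le> s")
        case True
        then have "(\<integral>\<^sup>+x. ennreal (indicator (cball 0 R) x * (f (x - z) - f x) ^ 4) \<partial>lborel) \<le> ennreal \<eta>"
          using s by (intro \<delta>) auto
        moreover have "(\<lambda>x. ennreal (indicator (cball 0 R) x * (f (x - z) - f x) ^ 4)) \<in> borel_measurable lborel"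
          by (intro measurable_compose[OF _ measurable_ennreal] borel_measurable_times borel_measurable_indicator
              borel_measurable_power borel_measurable_diff measurable_compose[OF _ f(1)]) auto
        ultimately show ?thesis by (subst nn_integral_cmult) (auto intro!: mult_left_mono)
      next
        case False
        then show ?thesis using tf_zero[OF tf_mollifier[OF s(1)], of z] by simp
      qed
    qed
    also have "\<dots> = (\<integral>\<^sup>+z. ennreal (mollifier s z) \<partial>lborel) * ennreal \<eta>"
      by (simp add: nn_integral_multc)
    also have "(\<integral>\<^sup>+z. ennreal (mollifier s z) \<partial>lborel) = ennreal (\<integral>z. mollifier s z \<partial>lborel)"
      using tf_integrable[OF tf_mollifier[OF s(1)]] mollifier_nonneg[OF s(1)]
      by (intro nn_integral_eq_integral) auto
    finally show "(\<integral>\<^sup>+x. ennreal (indicator (cball 0 R) x) * (\<integral>\<^sup>+y. ennreal (mollifier s (x - y) * (f y - f x) ^ 4) \<partial>lborel) \<partial>lborel) \<le> ennreal \<eta>"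
      by (simp add: integral_mollifier[OF s(1)])
  qed
qed

lemma abs_le_1_plus_power4: "\<bar>a\<bar> \<le> 1 + (a::real) ^ 4" "a\<^sup>2 \<le> 1 + a ^ 4"
proof -
  have s: "b \<le> 1 + b\<^sup>2" for b :: real using zero_le_power2[of "b - 1"] by (simp add: power2_diff) (smt (verit) zero_le_power2)
  show *: "a\<^sup>2 \<le> 1 + a ^ 4" using s[of "a\<^sup>2"] by simp
  show "\<bar>a\<bar> \<le> 1 + a ^ 4"
  proof (cases "\<bar>a\<bar> \<le> 1")
    case True
    moreover have "0 \<le> a ^ 4" by simp
    ultimately show ?thesis by linarith
  next
    case False
    then have "\<bar>a\<bar> ^ 1 \<le> \<bar>a\<bar> ^ 4" by (intro power_increasing) auto
    then show ?thesis by simp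
  qed
qed

lemma locint_power4D:
  assumes "f \<in> borel_measurable borel" "locint (\<lambda>x. (f x) ^ 4)"
  shows "locint f" "locint (\<lambda>x. (f x)\<^sup>2)" "locint (\<lambda>x. (f x - c) ^ 4)"
proof -
  have l: "locint (\<lambda>x. 1 + (f x) ^ 4)" using assms by (intro locint_add locint_const)
  show "locint f" by (rule locint_bound[OF l assms(1)]) (smt (verit) abs_le_1_plus_power4)
  show "locint (\<lambda>x. (f x)\<^sup>2)"
    by (rule locint_bound[OF l]) (use assms(1) in \<open>auto intro: order_trans[OF abs_le_1_plus_power4(2)]\<close>)
  have l2: "locint (\<lambda>x. 8 * (f x) ^ 4 + 8 * c ^ 4)" using assms by (intro locint_add locint_const locint_cmult)
  show "locint (\<lambda>x. (f x - c) ^ 4)"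
  proof (rule locint_bound[OF l2])
    show "(\<lambda>x. (f x - c) ^ 4) \<in> borel_measurable borel" using assms(1) by simp
    fix x
    have "(f x - c) ^ 4 \<le> 8 * \<bar>\<bar>f x\<bar> ^ 3 * f x - \<bar>c\<bar> ^ 3 * c\<bar>" by (rule diff_power4_le)
    also have "\<dots> \<le> 8 * (\<bar>f x\<bar> ^ 4 + \<bar>c\<bar> ^ 4)"
    proof -
      have e: "\<bar>\<bar>a\<bar> ^ 3 * a\<bar> = \<bar>a\<bar> ^ 4" for a :: real by (simp add: abs_mult eval_nat_numeral)
      show ?thesis
        using abs_triangle_ineq4[of "\<bar>f x\<bar> ^ 3 * f x" "\<bar>c\<bar> ^ 3 * c"] unfolding e by simp
    qed
    finally show "\<bar>(f x - c) ^ 4\<bar> \<le> \<bar>8 * (f x) ^ 4 + 8 * c ^ 4\<bar>" by simp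
  qed
qed

lemma locint_mult:
  assumes "f \<in> borel_measurable borel" "locint (\<lambda>x. (f x) ^ 4)" "g \<in> borel_measurable borel" "locint (\<lambda>x. (g x) ^ 4)"
  shows "locint (\<lambda>x. f x * g x)"
proof (rule locint_bound[OF locint_add[OF locint_power4D(2)[OF assms(1,2)] locint_power4D(2)[OF assms(3,4)]]])
  show "(\<lambda>x. f x * g x) \<in> borel_measurable borel" using assms by simp
  fix x
  have "2 * \<bar>f x * g x\<bar> \<le> (f x)\<^sup>2 + (g x)\<^sup>2"
    using sum_squares_bound[of "\<bar>f x\<bar>" "\<bar>g x\<bar>"] by (simp add: abs_mult)
  then show "\<bar>f x * g x\<bar> \<le> \<bar>(f x)\<^sup>2 + (g x)\<^sup>2\<bar>" by linarith
qed

text \<open>Both bounds compare with the value c = f(x). The variance is at most the mean of (f -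
  c)^2, whose square is at most the mean of (f - c)^4; for the second bound Jensen's inequality is
  applied twice to f - c. The first serves the commutator, the second the convergence of
  mollifications in L^4.\<close>

lemma oscillation_bounds:
  assumes f: "f \<in> borel_measurable borel" "locint (\<lambda>x. (f x) ^ 4)" and s: "s > 0"
  defines "E \<equiv> \<lambda>x. \<integral>\<^sup>+y. ennreal (mollifier s (x - y) * (f y - f x) ^ 4) \<partial>lborel"
  shows "ennreal ((conv (mollifier s) (\<lambda>y. (f y)\<^sup>2) x - (conv (mollifier s) f x)\<^sup>2)\<^sup>2) \<le> E x"
    and "ennreal ((conv (mollifier s) f x - f x) ^ 4) \<le> E x"
proof -
  note l = locint_power4D[OF f]
  define c where "c = f x"
  let ?E = "\<lambda>g. conv (mollifier s) g x"
  have l2: "locint (\<lambda>y. (f y - c)\<^sup>2)" using l by (intro locint_affine_square)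
  have l1: "locint (\<lambda>y. f y - c)" using l by (intro locint_diff locint_const)
  have "integrable lborel (\<lambda>y. mollifier s (x - y) * (f y - c) ^ 4)"
    using tf_mollifier[OF s] l by (intro conv_integrable)
  then have E: "E x = ennreal (?E (\<lambda>y. (f y - c) ^ 4))"
    unfolding E_def conv_def c_def using mollifier_nonneg[OF s] by (intro nn_integral_eq_integral) auto
  have J: "(?E (\<lambda>y. (f y - c)\<^sup>2))\<^sup>2 \<le> ?E (\<lambda>y. (f y - c) ^ 4)"
    using conv_jensen[OF s l2] l(3)[of c] by simp
  have v: "0 \<le> ?E (\<lambda>y. (f y)\<^sup>2) - (?E f)\<^sup>2" using conv_jensen[OF s l(1,2)] by simp
  have "(?E (\<lambda>y. (f y)\<^sup>2) - (?E f)\<^sup>2)\<^sup>2 \<le> (?E (\<lambda>y. (f y - c)\<^sup>2))\<^sup>2"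
    using conv_variance_le[OF s l(1,2)] v by (intro power_mono)
  then show "ennreal ((?E (\<lambda>y. (f y)\<^sup>2) - (?E f)\<^sup>2)\<^sup>2) \<le> E x"
    unfolding E using J by (intro ennreal_leI) linarith
  have "?E f - c = ?E (\<lambda>y. f y - c)"
    using conv_diff[OF tf_mollifier[OF s] l(1) locint_const] by (simp add: conv_mollifier_const[OF s])
  then have "(?E f - c) ^ 4 = ((?E (\<lambda>y. f y - c))\<^sup>2)\<^sup>2" by simp
  also have "\<dots> \<le> (?E (\<lambda>y. (f y - c)\<^sup>2))\<^sup>2" using conv_jensen[OF s l1 l2] by (intro power_mono) auto
  finally show "ennreal ((?E f - f x) ^ 4) \<le> E x"
    unfolding E c_def[symmetric] using J by (intro ennreal_leI) linarith
qed

subsection \<open>The energy identity\<close>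

lemma laplacian_diff: "smooth f \<Longrightarrow> smooth g \<Longrightarrow> laplacian (\<lambda>x. f x - g x) = (\<lambda>x. laplacian f x - laplacian g x)"
  unfolding laplacian_eq by (simp add: pd_diff smooth_pd sum_subtractf)

lemma laplacian_conv_right:
  assumes "tf r k" "tf s f"
  shows "laplacian (conv k f) = conv k (laplacian f)"
  unfolding laplacian_eq
  using assms by (simp add: fun_eq_iff pd_conv_right[OF assms] pd_conv_right[OF assms(1) tf_pd[OF assms(2)]]
      conv_sum[OF assms(1)] locint_smooth tf_smooth[OF tf_pd[OF tf_pd]])

lemma conv_commute_tf: "tf r k \<Longrightarrow> tf s f \<Longrightarrow> conv k f = conv f k"
  using conv_commute[of k f] by (auto simp: smooth_borel tf_smooth)

lemma laplacian_conv:
  assumes "tf r k" "tf s f"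
  shows "laplacian (conv k f) = conv (laplacian k) f"
  using laplacian_conv_right[OF assms(2,1)] conv_commute_tf[OF assms] conv_commute_tf[OF tf_laplacian[OF assms(1)] assms(2)]
  by simp

text \<open>The weak equations for Borel representatives of the components, tested only with
  divergence free fields and therefore without pressure. The assumption \<open>L4\<close> puts all
  products U_i U_j locally in L^2.\<close>

locale weak_flow =
  fixes U :: "3 \<Rightarrow> R3 \<Rightarrow> real"
  assumes meas: "\<And>i. U i \<in> borel_measurable borel"
    and L4: "\<And>i. locint (\<lambda>x. (U i x) ^ 4)"
    and momentum: "\<And>s \<Phi>. (\<And>j. tf s (\<Phi> j)) \<Longrightarrow> (\<And>x. (\<Sum>j\<in>UNIV. pd j (\<Phi> j) x) = 0) \<Longrightarrow>
      (\<Sum>j\<in>UNIV. \<integral>x. U j x * laplacian (\<Phi> j) x \<partial>lborel) +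
      (\<Sum>i\<in>UNIV. \<Sum>j\<in>UNIV. \<integral>x. U i x * U j x * pd i (\<Phi> j) x \<partial>lborel) = 0"
    and divfree: "\<And>s \<psi>. tf s \<psi> \<Longrightarrow> (\<Sum>i\<in>UNIV. \<integral>x. U i x * pd i \<psi> x \<partial>lborel) = 0"
begin

lemma locint_U: "locint (U i)" and locint_U2: "locint (\<lambda>x. (U i x)\<^sup>2)"
  using locint_power4D[OF meas L4] by auto

lemma locint_UU: "locint (\<lambda>x. U i x * U j x)"
  by (rule locint_mult[OF meas L4 meas L4])

definition u :: "real \<Rightarrow> 3 \<Rightarrow> R3 \<Rightarrow> real" where
  "u e i = conv (mollifier e) (U i)"

definition stress :: "real \<Rightarrow> 3 \<Rightarrow> 3 \<Rightarrow> R3 \<Rightarrow> real" where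
  "stress e i j = conv (mollifier e) (\<lambda>x. U i x * U j x)"

definition energy :: "real \<Rightarrow> R3 \<Rightarrow> real" where
  "energy e x = (\<Sum>j\<in>UNIV. (u e j x)\<^sup>2)"

lemma smooth_u: "e > 0 \<Longrightarrow> smooth (u e i)"
  unfolding u_def by (rule smooth_conv[OF tf_mollifier locint_U])

lemma smooth_stress: "e > 0 \<Longrightarrow> smooth (stress e i j)"
  unfolding stress_def by (rule smooth_conv[OF tf_mollifier locint_UU])

lemma smooth_energy: "e > 0 \<Longrightarrow> smooth (energy e)"
  unfolding energy_def[abs_def] by (intro smooth_sum smooth_power smooth_u)

text \<open>The reflected kernel is itself a test function, so the pointwise divergence of
  \<open>u\<close> is an instance of \<open>divfree\<close>.\<close>

lemma div_u:
  assumes e: "e > 0"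
  shows "(\<Sum>i\<in>UNIV. pd i (u e i) x) = 0"
proof -
  note t = tf_mollifier[OF e]
  have "pd i (u e i) x = - (\<integral>y. U i y * pd i (\<lambda>y. mollifier e (x - y)) y \<partial>lborel)" for i
    unfolding u_def pd_conv[OF t locint_U] tf_reflect(2)[OF t] conv_def
    by (simp add: mult.commute)
  then show ?thesis using divfree[OF tf_reflect(1)[OF t], of x] by (simp add: sum_negf)
qed

text \<open>As u is divergence free, g is the divergence of v. The Laplacian of w is the difference
  of the convolutions of g with \<open>mollifier e\<close> and \<open>mollifier R\<close>, that is,
  the divergence of the difference of the mollified v; subtracting the gradient of w restores
  divergence zero.\<close>

lemma local_identity:
  assumes e: "0 < e" "e \<le> R" and \<psi>: "tf R \<psi>" and Z: "tf R Z" "laplacian Z = (\<lambda>x. mollifier e x - mollifier R x)"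
  defines "v \<equiv> \<lambda>j x. \<psi> x * u e j x" and "g \<equiv> \<lambda>x. \<Sum>j\<in>UNIV. pd j \<psi> x * u e j x"
  defines "w \<equiv> conv Z g"
  shows "(\<Sum>i\<in>UNIV. \<Sum>j\<in>UNIV. \<integral>x. pd i (v j) x * pd i (u e j) x \<partial>lborel) =
     (\<Sum>i\<in>UNIV. \<Sum>j\<in>UNIV. \<integral>x. stress e i j x * pd i (v j) x \<partial>lborel)
     - (\<Sum>j\<in>UNIV. \<integral>x. U j x * conv (laplacian (mollifier R)) (v j) x \<partial>lborel)
     - (\<Sum>i\<in>UNIV. \<Sum>j\<in>UNIV. \<integral>x. U i x * U j x * conv (pd i (mollifier R)) (v j) x \<partial>lborel)
     - (\<Sum>i\<in>UNIV. \<Sum>j\<in>UNIV. \<integral>x. U i x * U j x * pd i (pd j w) x \<partial>lborel)"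
proof -
  let ?m = mollifier
  note s = smooth_u[OF e(1)]
  have R: "R > 0" using e by simp
  note te = tf_mollifier[OF e(1)] and tR = tf_mollifier[OF R]
  have tv: "tf R (v j)" for j unfolding v_def by (intro tf_mult \<psi> s)
  have tg: "tf R g" unfolding g_def by (intro tf_sum tf_mult tf_pd \<psi> s)
  have pdv: "pd i (v j) = (\<lambda>x. pd i \<psi> x * u e j x + \<psi> x * pd i (u e j) x)" for i j
    unfolding v_def by (intro pd_mult tf_smooth[OF \<psi>] s)
  have divv: "(\<Sum>j\<in>UNIV. pd j (v j) x) = g x" for x
    unfolding pdv g_def using div_u[OF e(1), of x] by (simp add: sum.distrib flip: sum_distrib_left)
  have tev: "tf (R + R) (conv (?m e) (v j))" for j
    using tf_mono[OF tf_conv[OF te tv]] e by simp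
  have tRv: "tf (R + R) (conv (?m R) (v j))" for j by (rule tf_conv[OF tR tv])
  have tw: "tf (R + R) w" unfolding w_def by (rule tf_conv[OF Z(1) tg])
  define \<Phi> where "\<Phi> j x = conv (?m e) (v j) x - conv (?m R) (v j) x - pd j w x" for j x
  have t\<Phi>: "tf (R + R) (\<Phi> j)" for j
    unfolding \<Phi>_def[abs_def] by (intro tf_diff tev tRv tf_pd tw)
  have pd\<Phi>: "pd i (\<Phi> j) = (\<lambda>x. conv (?m e) (pd i (v j)) x - conv (pd i (?m R)) (v j) x - pd i (pd j w) x)" for i j
    unfolding \<Phi>_def[abs_def]
    by (simp add: pd_diff tf_smooth[OF tev] tf_smooth[OF tRv] tf_smooth[OF tf_pd[OF tw]] smooth_diff
        pd_conv_right[OF te tv] pd_conv[OF tR locint_smooth[OF tf_smooth[OF tv]]])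
  have "(\<Sum>j\<in>UNIV. pd j (\<Phi> j) x) = 0" for x
  proof -
    have l: "locint (pd j (v j))" for j by (intro locint_smooth tf_smooth[OF tf_pd[OF tv]])
    have "(\<Sum>j\<in>UNIV. pd j (\<Phi> j) x) = (\<Sum>j\<in>UNIV. conv (?m e) (pd j (v j)) x) - (\<Sum>j\<in>UNIV. conv (?m R) (pd j (v j)) x) - laplacian w x"
      unfolding pd\<Phi> laplacian_eq pd_conv[OF tR locint_smooth[OF tf_smooth[OF tv]], symmetric] pd_conv_right[OF tR tv]
      by (simp add: sum_subtractf)
    also have "(\<Sum>j\<in>UNIV. conv (?m e) (pd j (v j)) x) = conv (?m e) g x"
      using conv_sum[OF te, of UNIV "\<lambda>j. pd j (v j)"] l by (simp add: divv)
    also have "(\<Sum>j\<in>UNIV. conv (?m R) (pd j (v j)) x) = conv (?m R) g x"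
      using conv_sum[OF tR, of UNIV "\<lambda>j. pd j (v j)"] l by (simp add: divv)
    also have "laplacian w = conv g (laplacian Z)"
      unfolding w_def laplacian_conv[OF Z(1) tg] by (rule conv_commute_tf[OF tf_laplacian[OF Z(1)] tg])
    also have "conv g (laplacian Z) x = conv (?m e) g x - conv (?m R) g x"
      unfolding Z(2) conv_commute_tf[OF te tg] conv_commute_tf[OF tR tg]
      by (intro conv_diff[OF tg] locint_smooth tf_smooth[OF te] tf_smooth[OF tR])
    finally show ?thesis by simp
  qed
  note mom = momentum[OF t\<Phi> this]
  have lap: "laplacian (\<Phi> j) x = conv (?m e) (laplacian (v j)) x - conv (laplacian (?m R)) (v j) x - pd j (conv Z (laplacian g)) x" for j x
  proof -
    \<comment> \<open>In this form the viscous contribution of the correction is the gradient of a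
      test function, which \<open>divfree\<close> annihilates in \<open>C\<close>.\<close>
    have 1: "laplacian (pd j w) = pd j (conv Z (laplacian g))"
      unfolding w_def pd_conv[OF Z(1) locint_smooth[OF tf_smooth[OF tg]]] laplacian_conv_right[OF tf_pd[OF Z(1)] tg]
      by (rule pd_conv[OF Z(1) locint_smooth[OF tf_smooth[OF tf_laplacian[OF tg]]], symmetric])
    show ?thesis unfolding \<Phi>_def[abs_def] 1[symmetric]
      by (simp add: laplacian_diff tf_smooth[OF tev] tf_smooth[OF tRv] tf_smooth[OF tf_pd[OF tw]] smooth_diff
        laplacian_conv_right[OF te tv] laplacian_conv[OF tR tv])
  qed
  have tlg: "tf (R + R) (conv Z (laplacian g))" by (rule tf_conv[OF Z(1) tf_laplacian[OF tg]])
  have A: "(\<integral>x. U j x * laplacian (\<Phi> j) x \<partial>lborel) = - (\<Sum>i\<in>UNIV. \<integral>x. pd i (v j) x * pd i (u e j) x \<partial>lborel)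
     - (\<integral>x. U j x * conv (laplacian (?m R)) (v j) x \<partial>lborel) - (\<integral>x. U j x * pd j (conv Z (laplacian g)) x \<partial>lborel)" for j
  proof -
    have i1: "integrable lborel (\<lambda>x. U j x * conv (?m e) (laplacian (v j)) x)"
      by (rule tf_integrable_mult(2)[OF tf_conv[OF te tf_laplacian[OF tv]] locint_U])
    have i2: "integrable lborel (\<lambda>x. U j x * conv (laplacian (?m R)) (v j) x)"
      by (rule tf_integrable_mult(2)[OF tf_conv[OF tf_laplacian[OF tR] tv] locint_U])
    have i3: "integrable lborel (\<lambda>x. U j x * pd j (conv Z (laplacian g)) x)"
      by (rule tf_integrable_mult(2)[OF tf_pd[OF tlg] locint_U])
    have "(\<integral>x. U j x * laplacian (\<Phi> j) x \<partial>lborel) = (\<integral>x. U j x * conv (?m e) (laplacian (v j)) x \<partial>lborel)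
      - (\<integral>x. U j x * conv (laplacian (?m R)) (v j) x \<partial>lborel) - (\<integral>x. U j x * pd j (conv Z (laplacian g)) x \<partial>lborel)"
      unfolding lap using i1 i2 i3 by (simp add: right_diff_distrib)
    also have "(\<integral>x. U j x * conv (?m e) (laplacian (v j)) x \<partial>lborel) = (\<integral>x. u e j x * laplacian (v j) x \<partial>lborel)"
      unfolding u_def by (rule tf_conv_swap[OF te mollifier_even locint_U tf_laplacian[OF tv]])
    also have "\<dots> = (\<Sum>i\<in>UNIV. \<integral>x. u e j x * pd i (pd i (v j)) x \<partial>lborel)"
      unfolding laplacian_eq sum_distrib_left
      by (intro Bochner_Integration.integral_sum tf_integrable_mult(2)[OF tf_pd[OF tf_pd[OF tv]]] locint_smooth s)
    also have "\<dots> = (\<Sum>i\<in>UNIV. - (\<integral>x. pd i (v j) x * pd i (u e j) x \<partial>lborel))"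
      using integral_by_parts[OF tf_pd[OF tv] s] by (simp add: mult.commute)
    finally show ?thesis by (simp add: sum_negf)
  qed
  have B: "(\<integral>x. U i x * U j x * pd i (\<Phi> j) x \<partial>lborel) = (\<integral>x. stress e i j x * pd i (v j) x \<partial>lborel)
     - (\<integral>x. U i x * U j x * conv (pd i (?m R)) (v j) x \<partial>lborel) - (\<integral>x. U i x * U j x * pd i (pd j w) x \<partial>lborel)" for i j
  proof -
    have i1: "integrable lborel (\<lambda>x. U i x * U j x * conv (?m e) (pd i (v j)) x)"
      by (rule tf_integrable_mult(2)[OF tf_conv[OF te tf_pd[OF tv]] locint_UU])
    have i2: "integrable lborel (\<lambda>x. U i x * U j x * conv (pd i (?m R)) (v j) x)"
      by (rule tf_integrable_mult(2)[OF tf_conv[OF tf_pd[OF tR] tv] locint_UU])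
    have i3: "integrable lborel (\<lambda>x. U i x * U j x * pd i (pd j w) x)"
      by (rule tf_integrable_mult(2)[OF tf_pd[OF tf_pd[OF tw]] locint_UU])
    have "(\<integral>x. U i x * U j x * pd i (\<Phi> j) x \<partial>lborel) = (\<integral>x. U i x * U j x * conv (?m e) (pd i (v j)) x \<partial>lborel)
      - (\<integral>x. U i x * U j x * conv (pd i (?m R)) (v j) x \<partial>lborel) - (\<integral>x. U i x * U j x * pd i (pd j w) x \<partial>lborel)"
      unfolding pd\<Phi> using i1 i2 i3 by (simp add: right_diff_distrib)
    also have "(\<integral>x. U i x * U j x * conv (?m e) (pd i (v j)) x \<partial>lborel) = (\<integral>x. stress e i j x * pd i (v j) x \<partial>lborel)"
      unfolding stress_def by (rule tf_conv_swap[OF te mollifier_even locint_UU tf_pd[OF tv]])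
    finally show ?thesis .
  qed
  have C: "(\<Sum>j\<in>UNIV. \<integral>x. U j x * pd j (conv Z (laplacian g)) x \<partial>lborel) = 0"
    by (rule divfree[OF tlg])
  have sw: "(\<Sum>j\<in>UNIV. \<Sum>i\<in>UNIV. \<integral>x. pd i (v j) x * pd i (u e j) x \<partial>lborel) = (\<Sum>i\<in>UNIV. \<Sum>j\<in>UNIV. \<integral>x. pd i (v j) x * pd i (u e j) x \<partial>lborel)"
    by (rule sum.swap)
  show ?thesis
    using mom unfolding A B sum_subtractf sum_negf C sw by linarith
qed

text \<open>Pointwise, \<nabla>(\<psi>u) \<cdot> \<nabla>u is \<psi>|\<nabla>u|^2 plus
  \<nabla>\<psi> \<cdot> \<nabla>|u|^2 / 2, and one integration by parts moves the last gradient to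
  the cut-off.\<close>

lemma dissipation_term:
  assumes e: "e > 0" and \<psi>: "tf R \<psi>"
  defines "v \<equiv> \<lambda>j x. \<psi> x * u e j x"
  shows "(\<Sum>i\<in>UNIV. \<Sum>j\<in>UNIV. \<integral>x. pd i (v j) x * pd i (u e j) x \<partial>lborel) =
    (\<Sum>i\<in>UNIV. \<Sum>j\<in>UNIV. \<integral>x. \<psi> x * (pd i (u e j) x)\<^sup>2 \<partial>lborel) - (\<integral>x. laplacian \<psi> x * energy e x \<partial>lborel) / 2"
proof -
  note s = smooth_u[OF e]
  have pdv: "pd i (v j) = (\<lambda>x. pd i \<psi> x * u e j x + \<psi> x * pd i (u e j) x)" for i j
    unfolding v_def by (intro pd_mult tf_smooth[OF \<psi>] s)
  have 1: "(\<integral>x. pd i (v j) x * pd i (u e j) x \<partial>lborel) =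
      (\<integral>x. \<psi> x * (pd i (u e j) x)\<^sup>2 \<partial>lborel) - (\<integral>x. pd i (pd i \<psi>) x * (u e j x)\<^sup>2 \<partial>lborel) / 2" for i j
  proof -
    have "(\<integral>x. pd i (v j) x * pd i (u e j) x \<partial>lborel) =
       (\<integral>x. \<psi> x * (pd i (u e j) x)\<^sup>2 + pd i \<psi> x * pd i (\<lambda>x. (u e j x)\<^sup>2) x / 2 \<partial>lborel)"
      unfolding pdv pd_power2[OF s] by (intro Bochner_Integration.integral_cong) (auto simp: power2_eq_square algebra_simps)
    also have "\<dots> = (\<integral>x. \<psi> x * (pd i (u e j) x)\<^sup>2 \<partial>lborel) + (\<integral>x. pd i \<psi> x * pd i (\<lambda>x. (u e j x)\<^sup>2) x / 2 \<partial>lborel)"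
      by (intro Bochner_Integration.integral_add integrable_divide_zero tf_integrable_mult(1)[OF \<psi>] tf_integrable_mult(1)[OF tf_pd[OF \<psi>]]
          locint_smooth smooth_power smooth_pd s)
    also have "(\<integral>x. pd i \<psi> x * pd i (\<lambda>x. (u e j x)\<^sup>2) x / 2 \<partial>lborel) = - (\<integral>x. pd i (pd i \<psi>) x * (u e j x)\<^sup>2 \<partial>lborel) / 2"
      using integral_by_parts[OF tf_pd[OF \<psi>] smooth_power[OF s]] by simp
    finally show ?thesis by simp
  qed
  have 2: "(\<integral>x. laplacian \<psi> x * energy e x \<partial>lborel) = (\<Sum>i\<in>UNIV. \<Sum>j\<in>UNIV. \<integral>x. pd i (pd i \<psi>) x * (u e j x)\<^sup>2 \<partial>lborel)"
  proof -
    have i: "integrable lborel (\<lambda>x. pd i (pd i \<psi>) x * (u e j x)\<^sup>2)" for i j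
      by (intro tf_integrable_mult(1)[OF tf_pd[OF tf_pd[OF \<psi>]]] locint_smooth smooth_power s)
    show ?thesis unfolding laplacian_eq energy_def sum_product
      using i by (simp add: Bochner_Integration.integral_sum Bochner_Integration.integrable_sum)
  qed
  show ?thesis unfolding 1 2 by (simp add: sum_subtractf sum_divide_distrib)
qed

text \<open>The integrand is g|u|^2 + v \<cdot> \<nabla>|u|^2 / 2, and integrating by parts with div
  v = g cancels half of the first summand.\<close>

lemma convection_term:
  assumes e: "e > 0" and \<psi>: "tf R \<psi>"
  defines "v \<equiv> \<lambda>j x. \<psi> x * u e j x"
  shows "(\<Sum>i\<in>UNIV. \<Sum>j\<in>UNIV. \<integral>x. u e i x * u e j x * pd i (v j) x \<partial>lborel) =
    (\<integral>x. (\<Sum>j\<in>UNIV. pd j \<psi> x * u e j x) * energy e x \<partial>lborel) / 2"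
proof -
  note s = smooth_u[OF e]
  define g where "g x = (\<Sum>j\<in>UNIV. pd j \<psi> x * u e j x)" for x
  have tv: "tf R (v j)" for j unfolding v_def by (intro tf_mult \<psi> s)
  have tg: "tf R g" unfolding g_def[abs_def] by (intro tf_sum tf_mult tf_pd \<psi> s)
  have pdv: "pd i (v j) = (\<lambda>x. pd i \<psi> x * u e j x + \<psi> x * pd i (u e j) x)" for i j
    unfolding v_def by (intro pd_mult tf_smooth[OF \<psi>] s)
  have divv: "(\<Sum>j\<in>UNIV. pd j (v j) x) = g x" for x
    unfolding pdv g_def using div_u[OF e, of x] by (simp add: sum.distrib flip: sum_distrib_left)
  have pde: "pd i (energy e) = (\<lambda>x. \<Sum>j\<in>UNIV. 2 * u e j x * pd i (u e j) x)" for i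
    unfolding energy_def[abs_def] by (simp add: pd_sum smooth_power s pd_power2)
  have pt: "(\<Sum>i\<in>UNIV. \<Sum>j\<in>UNIV. u e i x * u e j x * pd i (v j) x) = g x * energy e x + (\<Sum>i\<in>UNIV. v i x * pd i (energy e) x) / 2" for x
  proof -
    have "(\<Sum>i\<in>UNIV. \<Sum>j\<in>UNIV. u e i x * u e j x * pd i (v j) x) =
      (\<Sum>i\<in>UNIV. \<Sum>j\<in>UNIV. (pd i \<psi> x * u e i x) * (u e j x)\<^sup>2) + (\<Sum>i\<in>UNIV. \<Sum>j\<in>UNIV. v i x * (2 * u e j x * pd i (u e j) x)) / 2"
      unfolding pdv unfolding v_def by (simp add: sum_divide_distrib flip: sum.distrib) (simp add: algebra_simps power2_eq_square)
    also have "(\<Sum>i\<in>UNIV. \<Sum>j\<in>UNIV. (pd i \<psi> x * u e i x) * (u e j x)\<^sup>2) = g x * energy e x"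
      unfolding g_def energy_def sum_product ..
    also have "(\<Sum>i\<in>UNIV. \<Sum>j\<in>UNIV. v i x * (2 * u e j x * pd i (u e j) x)) = (\<Sum>i\<in>UNIV. v i x * pd i (energy e) x)"
      unfolding pde sum_distrib_left ..
    finally show ?thesis .
  qed
  have i1: "integrable lborel (\<lambda>x. u e i x * u e j x * pd i (v j) x)" for i j
    by (intro tf_integrable_mult(2)[OF tf_pd[OF tv]] locint_smooth smooth_mult s)
  have i2: "integrable lborel (\<lambda>x. v i x * pd i (energy e) x)" for i
    by (intro tf_integrable_mult(1)[OF tv] locint_smooth smooth_pd smooth_energy e)
  have i3: "integrable lborel (\<lambda>x. g x * energy e x)"
    by (intro tf_integrable_mult(1)[OF tg] locint_smooth smooth_energy e)
  have i4: "integrable lborel (\<lambda>x. pd i (v i) x * energy e x)" for i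
    by (intro tf_integrable_mult(1)[OF tf_pd[OF tv]] locint_smooth smooth_energy e)
  have "(\<Sum>i\<in>UNIV. \<Sum>j\<in>UNIV. \<integral>x. u e i x * u e j x * pd i (v j) x \<partial>lborel) =
     (\<integral>x. (\<Sum>i\<in>UNIV. \<Sum>j\<in>UNIV. u e i x * u e j x * pd i (v j) x) \<partial>lborel)"
    using i1 by (simp add: Bochner_Integration.integral_sum Bochner_Integration.integrable_sum)
  also have "\<dots> = (\<integral>x. g x * energy e x \<partial>lborel) + (\<Sum>i\<in>UNIV. \<integral>x. v i x * pd i (energy e) x \<partial>lborel) / 2"
    unfolding pt using i2 i3 by (simp add: Bochner_Integration.integral_sum Bochner_Integration.integrable_sum)
  also have "(\<Sum>i\<in>UNIV. \<integral>x. v i x * pd i (energy e) x \<partial>lborel) = - (\<Sum>i\<in>UNIV. \<integral>x. pd i (v i) x * energy e x \<partial>lborel)"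
    using integral_by_parts[OF tv smooth_energy[OF e]] by (simp add: sum_negf)
  also have "(\<Sum>i\<in>UNIV. \<integral>x. pd i (v i) x * energy e x \<partial>lborel) = (\<integral>x. g x * energy e x \<partial>lborel)"
    using i4 by (simp add: divv flip: Bochner_Integration.integral_sum sum_distrib_right)
  finally show ?thesis by (simp add: g_def)
qed

text \<open>Splitting the mollified stress into u \<otimes> u and a commutator makes the cubic part
  explicit. Every other term on the right carries a derivative of \<open>\<psi>\<close> or a kernel
  at scale R, and so gains powers of 1/R.\<close>

lemma energy_identity:
  assumes e: "0 < e" "e \<le> R" and \<psi>: "tf R \<psi>" and Z: "tf R Z" "laplacian Z = (\<lambda>x. mollifier e x - mollifier R x)"
  defines "v \<equiv> \<lambda>j x. \<psi> x * u e j x" and "g \<equiv> \<lambda>x. \<Sum>j\<in>UNIV. pd j \<psi> x * u e j x"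
  defines "w \<equiv> conv Z g"
  shows "(\<Sum>i\<in>UNIV. \<Sum>j\<in>UNIV. \<integral>x. \<psi> x * (pd i (u e j) x)\<^sup>2 \<partial>lborel) =
     (\<integral>x. laplacian \<psi> x * energy e x \<partial>lborel) / 2 + (\<integral>x. g x * energy e x \<partial>lborel) / 2
     + (\<Sum>i\<in>UNIV. \<Sum>j\<in>UNIV. \<integral>x. (stress e i j x - u e i x * u e j x) * pd i (v j) x \<partial>lborel)
     - (\<Sum>j\<in>UNIV. \<integral>x. U j x * conv (laplacian (mollifier R)) (v j) x \<partial>lborel)
     - (\<Sum>i\<in>UNIV. \<Sum>j\<in>UNIV. \<integral>x. U i x * U j x * conv (pd i (mollifier R)) (v j) x \<partial>lborel)
     - (\<Sum>i\<in>UNIV. \<Sum>j\<in>UNIV. \<integral>x. U i x * U j x * pd i (pd j w) x \<partial>lborel)"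
proof -
  note s = smooth_u[OF e(1)]
  have tv: "tf R (v j)" for j unfolding v_def by (intro tf_mult \<psi> s)
  have "(\<integral>x. (stress e i j x - u e i x * u e j x) * pd i (v j) x \<partial>lborel) =
     (\<integral>x. stress e i j x * pd i (v j) x \<partial>lborel) - (\<integral>x. u e i x * u e j x * pd i (v j) x \<partial>lborel)" for i j
  proof -
    have "integrable lborel (\<lambda>x. stress e i j x * pd i (v j) x)" "integrable lborel (\<lambda>x. u e i x * u e j x * pd i (v j) x)"
      by (intro tf_integrable_mult(2)[OF tf_pd[OF tv]] locint_smooth smooth_mult s smooth_stress e)+
    then show ?thesis by (simp add: left_diff_distrib)
  qed
  then show ?thesis
    using local_identity[OF e \<psi> Z] dissipation_term[OF e(1) \<psi>] convection_term[OF e(1) \<psi>]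
    unfolding v_def g_def w_def by (simp add: sum_subtractf)
qed

end

subsection \<open>Integrals over balls\<close>

definition bint :: "real \<Rightarrow> (R3 \<Rightarrow> real) \<Rightarrow> real" where
  "bint r f = (\<integral>x. indicator (cball 0 r) x * f x \<partial>lborel)"

lemma bint_integrable: "locint f \<Longrightarrow> integrable lborel (\<lambda>x. indicator (cball 0 r) x * f x)"
  by (simp add: locint_def)

lemma bint_mono:
  assumes "locint f" "locint g" "\<And>x. norm x \<le> r \<Longrightarrow> f x \<le> g x"
  shows "bint r f \<le> bint r g"
  unfolding bint_def using assms by (intro integral_mono bint_integrable) (auto simp: indicator_def)

lemma bint_mono_radius:
  assumes "locint f" "\<And>x. f x \<ge> 0" "r \<le> s"
  shows "bint r f \<le> bint s f"
  unfolding bint_def using assms by (intro integral_mono bint_integrable) (auto simp: indicator_def)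

lemma bint_nonneg: "(\<And>x. f x \<ge> 0) \<Longrightarrow> bint r f \<ge> 0"
  unfolding bint_def by (intro integral_nonneg_AE AE_I2) (auto simp: indicator_def)

lemma bint_add: "locint f \<Longrightarrow> locint g \<Longrightarrow> bint r (\<lambda>x. f x + g x) = bint r f + bint r g"
  unfolding bint_def by (simp add: distrib_left bint_integrable)

lemma bint_cmult: "bint r (\<lambda>x. c * f x) = c * bint r f"
  unfolding bint_def by (simp add: mult.left_commute)

lemma bint_sum:
  assumes "\<And>i. i \<in> I \<Longrightarrow> locint (f i)"
  shows "bint r (\<lambda>x. \<Sum>i\<in>I. f i x) = (\<Sum>i\<in>I. bint r (f i))"
  unfolding bint_def sum_distrib_left
  using assms by (intro Bochner_Integration.integral_sum bint_integrable)

definition ball_const :: real where "ball_const = unit_ball_vol 3"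

lemma ball_const_pos: "ball_const > 0"
  by (simp add: ball_const_def)

lemma bint_const: "r \<ge> 0 \<Longrightarrow> bint r (\<lambda>x. c) = c * (ball_const * r ^ 3)"
proof -
  assume r: "r \<ge> 0"
  have "bint r (\<lambda>x. 1) = measure lborel (cball (0::R3) r)" unfolding bint_def by simp
  also have "\<dots> = ball_const * r ^ 3" using content_cball[OF r, of "0::R3"] by (simp add: ball_const_def)
  finally show ?thesis using bint_cmult[of r c "\<lambda>x. 1"] by simp
qed

lemma locint_abs: "locint f \<Longrightarrow> locint (\<lambda>x. \<bar>f x\<bar>)"
  by (rule locint_bound[of f]) (auto intro!: borel_measurable_abs dest: locint_borel)

lemma integral_bounded_mult_le:
  assumes f: "locint f" and h: "h \<in> borel_measurable borel" "\<And>x. \<bar>h x\<bar> \<le> B" "\<And>x. norm x > r \<Longrightarrow> h x = 0"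
  shows "\<bar>\<integral>x. h x * f x \<partial>lborel\<bar> \<le> B * bint r (\<lambda>x. \<bar>f x\<bar>)"
proof -
  have "norm (\<integral>x. h x * f x \<partial>lborel) \<le> (\<integral>x. B * (indicator (cball 0 r) x * \<bar>f x\<bar>) \<partial>lborel)"
  proof (rule Bochner_Integration.integral_norm_bound_integral)
    show "integrable lborel (\<lambda>x. h x * f x)" by (rule integrable_bounded_mult[OF f h])
    show "integrable lborel (\<lambda>x. B * (indicator (cball 0 r) x * \<bar>f x\<bar>))"
      using bint_integrable[OF locint_abs[OF f]] by simp
    show "norm (h x * f x) \<le> B * (indicator (cball 0 r) x * \<bar>f x\<bar>)" for x
      using h(2)[of x] h(3)[of x] by (cases "norm x \<le> r") (auto simp: abs_mult mult_right_mono)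
  qed
  then show ?thesis by (simp add: bint_def)
qed

lemma tf_integral_le:
  assumes "tf r h" "locint f" "\<And>x. \<bar>h x\<bar> \<le> B"
  shows "\<bar>\<integral>x. h x * f x \<partial>lborel\<bar> \<le> B * bint r (\<lambda>x. \<bar>f x\<bar>)" "\<bar>\<integral>x. f x * h x \<partial>lborel\<bar> \<le> B * bint r (\<lambda>x. \<bar>f x\<bar>)"
proof -
  show "\<bar>\<integral>x. h x * f x \<partial>lborel\<bar> \<le> B * bint r (\<lambda>x. \<bar>f x\<bar>)"
    using assms by (intro integral_bounded_mult_le) (auto simp: tf_def smooth_borel)
  then show "\<bar>\<integral>x. f x * h x \<partial>lborel\<bar> \<le> B * bint r (\<lambda>x. \<bar>f x\<bar>)" by (simp add: mult.commute)
qed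

lemma conv_sup_le:
  assumes "tf r k" "tf s f" "\<And>x. \<bar>k x\<bar> \<le> B"
  shows "\<bar>conv k f x\<bar> \<le> B * bint s (\<lambda>x. \<bar>f x\<bar>)"
proof -
  have "norm (conv k f x) \<le> (\<integral>y. B * (indicator (cball 0 s) y * \<bar>f y\<bar>) \<partial>lborel)"
    unfolding conv_def
  proof (rule Bochner_Integration.integral_norm_bound_integral)
    show "integrable lborel (\<lambda>y. k (x - y) * f y)"
      by (rule conv_integrable[OF assms(1) locint_smooth[OF tf_smooth[OF assms(2)]]])
    show "integrable lborel (\<lambda>x. B * (indicator (cball 0 s) x * \<bar>f x\<bar>))"
      using bint_integrable[OF locint_abs[OF locint_smooth[OF tf_smooth[OF assms(2)]]]] by simp
    show "norm (k (x - y) * f y) \<le> B * (indicator (cball 0 s) y * \<bar>f y\<bar>)" for y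
      using assms(3)[of "x - y"] tf_zero[OF assms(2), of y] by (cases "norm y \<le> s") (auto simp: abs_mult mult_right_mono)
  qed
  then show ?thesis by (simp add: bint_def)
qed

text \<open>Duality moves the average onto the indicator of B(r), whose mollification takes values
  in [0, 1] and vanishes outside B(r + s).\<close>

lemma bint_conv_le:
  assumes s: "s > 0" and f: "locint f" "\<And>x. f x \<ge> 0"
  shows "bint r (conv (mollifier s) f) \<le> bint (r + s) f"
proof -
  note t = tf_mollifier[OF s]
  let ?h = "indicator (cball 0 r) :: R3 \<Rightarrow> real"
  have lh: "locint ?h"
    by (rule locint_bound[OF locint_const[of 1]], rule borel_measurable_indicator) (auto simp: indicator_def)
  have h: "?h \<in> borel_measurable borel" "\<And>x. \<bar>?h x\<bar> \<le> 1" "\<And>x. norm x > r \<Longrightarrow> ?h x = 0"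
    using locint_borel[OF lh] by (auto simp: indicator_def)
  have le1: "conv (mollifier s) ?h x \<le> 1" for x
    using conv_mono[OF t mollifier_nonneg[OF s] lh locint_const[of 1], of x] by (simp add: conv_mollifier_const[OF s] indicator_def)
  have ge0: "conv (mollifier s) ?h x \<ge> 0" for x
    unfolding conv_def using mollifier_nonneg[OF s] by (intro integral_nonneg_AE AE_I2) auto
  have z: "conv (mollifier s) ?h x = 0" if "norm x > r + s" for x
    using that by (intro conv_zero_outside[of s _ r]) (auto simp: tf_zero[OF t])
  have "bint r (conv (mollifier s) f) = (\<integral>x. f x * conv (mollifier s) ?h x \<partial>lborel)"
    unfolding bint_def using integral_conv_swap(1)[OF t mollifier_even f(1) h] by (simp add: mult.commute)
  also have "\<dots> \<le> bint (r + s) f"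
    unfolding bint_def
  proof (rule integral_mono)
    have b: "conv (mollifier s) ?h \<in> borel_measurable borel"
      by (intro smooth_borel smooth_conv[OF t lh])
    show "integrable lborel (\<lambda>x. f x * conv (mollifier s) ?h x)"
      using integrable_bounded_mult[OF f(1) b, of 1 "r + s"] le1 ge0 z by (simp add: mult.commute)
    show "integrable lborel (\<lambda>x. indicator (cball 0 (r + s)) x * f x)" using f by (intro bint_integrable)
    show "f x * conv (mollifier s) ?h x \<le> indicator (cball 0 (r + s)) x * f x" for x
      using z[of x] le1[of x] f(2)[of x] by (cases "norm x \<le> r + s") (auto simp: mult_left_le)
  qed
  finally show ?thesis .
qed

text \<open>In a convolution one derivative can be placed on each factor, which makes their order
  immaterial.\<close>

lemma pd_conv_commute:
  assumes "tf r k" "tf s f"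
  shows "pd i (pd j (conv k f)) = pd j (pd i (conv k f))"
proof -
  have "pd i (pd j (conv k f)) = conv (pd j k) (pd i f)"
    unfolding pd_conv[OF assms(1) locint_smooth[OF tf_smooth[OF assms(2)]]]
    by (rule pd_conv_right[OF tf_pd[OF assms(1)] assms(2)])
  also have "\<dots> = pd j (pd i (conv k f))"
    unfolding pd_conv_right[OF assms]
    by (rule pd_conv[OF assms(1) locint_smooth[OF tf_smooth[OF tf_pd[OF assms(2)]]], symmetric])
  finally show ?thesis .
qed

text \<open>Two integrations by parts turn the square of a mixed derivative into the product of two
  pure ones, and these products add up to (\<Delta>w)^2. The convolution structure of
  \<open>w\<close> supplies the commutation of derivatives.\<close>

lemma hessian_integral:
  assumes Z: "tf r Z" and g: "tf s g"
  defines "w \<equiv> conv Z g"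
  shows "(\<Sum>i\<in>UNIV. \<Sum>j\<in>UNIV. \<integral>x. (pd i (pd j w) x)\<^sup>2 \<partial>lborel) = (\<integral>x. (laplacian w x)\<^sup>2 \<partial>lborel)"
proof -
  have w: "tf (r + s) w" unfolding w_def by (rule tf_conv[OF Z g])
  note wi = tf_pd[OF w] note wii = tf_pd[OF wi] note sm = tf_smooth[OF wi] tf_smooth[OF wii]
  have c: "pd i (pd j w) = pd j (pd i w)" for i j unfolding w_def by (rule pd_conv_commute[OF Z g])
  have c2: "pd i (pd i (pd j w)) = pd j (pd i (pd i w))" for i j
  proof -
    have pw: "pd i w = conv Z (pd i g)" unfolding w_def by (rule pd_conv_right[OF Z g])
    have "pd i (pd i (pd j w)) = pd i (pd j (pd i w))" unfolding c[of i j] ..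
    also have "\<dots> = pd j (pd i (pd i w))" unfolding pw by (rule pd_conv_commute[OF Z tf_pd[OF g]])
    finally show ?thesis .
  qed
  have 1: "(\<integral>x. (pd i (pd j w) x)\<^sup>2 \<partial>lborel) = (\<integral>x. pd i (pd i w) x * pd j (pd j w) x \<partial>lborel)" for i j
  proof -
    have "(\<integral>x. (pd i (pd j w) x)\<^sup>2 \<partial>lborel) = - (\<integral>x. pd i (pd i (pd j w)) x * pd j w x \<partial>lborel)"
      using integral_by_parts[OF tf_pd[OF tf_pd[OF w, of j], of i] tf_smooth[OF tf_pd[OF w, of j]], of i]
      by (simp add: power2_eq_square)
    also have "\<dots> = (\<integral>x. pd i (pd i w) x * pd j (pd j w) x \<partial>lborel)"
      unfolding c2[of i j] using integral_by_parts[OF tf_pd[OF tf_pd[OF w, of i], of i] tf_smooth[OF tf_pd[OF w, of j]], of j] by simp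
    finally show ?thesis .
  qed
  have i: "integrable lborel (\<lambda>x. pd i (pd i w) x * pd j (pd j w) x)" for i j
    by (intro tf_integrable_mult(1)[OF wii] locint_smooth sm)
  have "(\<integral>x. (laplacian w x)\<^sup>2 \<partial>lborel) = (\<integral>x. (\<Sum>i\<in>UNIV. \<Sum>j\<in>UNIV. pd i (pd i w) x * pd j (pd j w) x) \<partial>lborel)"
    unfolding laplacian_eq power2_eq_square sum_product ..
  also have "\<dots> = (\<Sum>i\<in>UNIV. \<Sum>j\<in>UNIV. \<integral>x. pd i (pd i w) x * pd j (pd j w) x \<partial>lborel)"
    using i by (simp add: Bochner_Integration.integral_sum Bochner_Integration.integrable_sum)
  finally show ?thesis unfolding 1 by simp
qed

text \<open>Jensen's inequality pointwise, then preservation of mass: the even kernel is moved onto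
  the constant 1.\<close>

lemma integral_conv_square_le:
  assumes s: "s > 0" and g: "tf r g"
  shows "(\<integral>x. (conv (mollifier s) g x)\<^sup>2 \<partial>lborel) \<le> (\<integral>x. (g x)\<^sup>2 \<partial>lborel)"
proof -
  note t = tf_mollifier[OF s]
  have g2: "tf r (\<lambda>x. (g x)\<^sup>2)" unfolding power2_eq_square by (intro tf_mult g tf_smooth[OF g])
  have c2: "tf (s + r) (\<lambda>x. (conv (mollifier s) g x)\<^sup>2)"
    unfolding power2_eq_square by (intro tf_mult tf_conv[OF t g] tf_smooth[OF tf_conv[OF t g]])
  have "(\<integral>x. (conv (mollifier s) g x)\<^sup>2 \<partial>lborel) \<le> (\<integral>x. conv (mollifier s) (\<lambda>x. (g x)\<^sup>2) x \<partial>lborel)"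
    by (intro integral_mono tf_integrable[OF c2] tf_integrable[OF tf_conv[OF t g2]] conv_jensen[OF s] locint_smooth
        tf_smooth[OF g] tf_smooth[OF g2])
  also have "\<dots> = (\<integral>x. (g x)\<^sup>2 \<partial>lborel)"
    using tf_conv_swap[OF t mollifier_even locint_const[of 1] g2] by (simp add: conv_mollifier_const[OF s])
  finally show ?thesis .
qed

text \<open>Below the level m the power k is compared with m^k, above it with a^4 / m^(4-k). If m is
  the fourth-power mean, both contributions have the same size after integration.\<close>

lemma power_interpolation:
  fixes a m :: real
  assumes m: "m > 0"
  shows "\<bar>a\<bar> \<le> m + a ^ 4 / m ^ 3" "a\<^sup>2 \<le> m\<^sup>2 + a ^ 4 / m\<^sup>2" "\<bar>a\<bar> ^ 3 \<le> m ^ 3 + a ^ 4 / m"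
proof -
  have *: "\<bar>a\<bar> ^ k \<le> m ^ k + a ^ 4 / m ^ (4 - k)" if "k \<le> 4" for k
  proof (cases "\<bar>a\<bar> \<le> m")
    case True
    then have "\<bar>a\<bar> ^ k \<le> m ^ k" by (intro power_mono) auto
    moreover have "0 \<le> a ^ 4 / m ^ (4 - k)" using m by simp
    ultimately show ?thesis by linarith
  next
    case False
    then have "m ^ (4 - k) \<le> \<bar>a\<bar> ^ (4 - k)" using m by (intro power_mono) auto
    then have "\<bar>a\<bar> ^ k * m ^ (4 - k) \<le> \<bar>a\<bar> ^ k * \<bar>a\<bar> ^ (4 - k)" by (intro mult_left_mono) auto
    also have "\<dots> = a ^ 4" using that by (simp flip: power_add)
    finally have "\<bar>a\<bar> ^ k \<le> a ^ 4 / m ^ (4 - k)" using m by (simp add: field_simps)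
    moreover have "0 \<le> m ^ k" using m by simp
    ultimately show ?thesis by linarith
  qed
  show "\<bar>a\<bar> \<le> m + a ^ 4 / m ^ 3" "a\<^sup>2 \<le> m\<^sup>2 + a ^ 4 / m\<^sup>2" "\<bar>a\<bar> ^ 3 \<le> m ^ 3 + a ^ 4 / m"
    using *[of 1] *[of 2] *[of 3] by simp_all
qed

text \<open>A fourth moment of size m^4 R^3 forces the lower moments to have size m^k R^3, with one
  constant for all. The 27 is the cube of the 3 in r <= 3R.\<close>

lemma bint_moments:
  assumes f: "f \<in> borel_measurable borel" "locint (\<lambda>x. (f x) ^ 4)" and m: "m > 0" and R: "R \<ge> 0" and r: "0 \<le> r" "r \<le> 3 * R"
    and b: "bint r (\<lambda>x. (f x) ^ 4) \<le> K * m ^ 4 * R ^ 3"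
  defines "M \<equiv> 27 * ball_const + K"
  shows "bint r (\<lambda>x. \<bar>f x\<bar>) \<le> M * m * R ^ 3" "bint r (\<lambda>x. (f x)\<^sup>2) \<le> M * m\<^sup>2 * R ^ 3"
    "bint r (\<lambda>x. \<bar>f x\<bar> ^ 3) \<le> M * m ^ 3 * R ^ 3" "bint r (\<lambda>x. (f x) ^ 4) \<le> M * m ^ 4 * R ^ 3"
proof -
  have vol: "ball_const * r ^ 3 \<le> 27 * ball_const * R ^ 3"
  proof -
    have "r ^ 3 \<le> (3 * R) ^ 3" using r by (intro power_mono) auto
    then show ?thesis using ball_const_pos by (simp add: power_mult_distrib mult_left_mono)
  qed
  \<comment> \<open>The weight c of the fourth power is tuned by c m^4 = a, so that the volume and
    the fourth moment both contribute a multiple of a R^3.\<close>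
  have gen: "bint r g \<le> M * a * R ^ 3"
    if g: "g \<in> borel_measurable borel" "\<And>x. 0 \<le> g x" "\<And>x. g x \<le> a + c * (f x) ^ 4" and c: "c * m ^ 4 = a" "c \<ge> 0" "a \<ge> 0" for g a c
  proof -
    have l: "locint (\<lambda>x. a + c * (f x) ^ 4)" using f by (intro locint_add locint_const locint_cmult)
    have nn: "0 \<le> a + c * (f x) ^ 4" for x using c by simp
    have lg: "locint g" by (rule locint_bound[OF l g(1)]) (use g nn in auto)
    have "bint r g \<le> bint r (\<lambda>x. a + c * (f x) ^ 4)" by (intro bint_mono lg l g)
    also have "\<dots> = a * (ball_const * r ^ 3) + c * bint r (\<lambda>x. (f x) ^ 4)"
      using f r by (subst bint_add) (auto intro!: locint_const locint_cmult simp: bint_cmult bint_const)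
    also have "\<dots> \<le> a * (27 * ball_const * R ^ 3) + c * (K * m ^ 4 * R ^ 3)"
      using vol b c by (intro add_mono mult_left_mono) auto
    also have "c * (K * m ^ 4 * R ^ 3) = K * (c * m ^ 4) * R ^ 3" by simp
    finally show ?thesis unfolding c(1) by (simp add: M_def algebra_simps)
  qed
  have m4: "m ^ 4 / m ^ 3 = m" "m ^ 4 / m\<^sup>2 = m\<^sup>2" "m ^ 4 / m = m ^ 3" using m by (simp_all add: eval_nat_numeral field_simps)
  show "bint r (\<lambda>x. \<bar>f x\<bar>) \<le> M * m * R ^ 3"
    by (rule gen[where c = "1 / m ^ 3"]) (use f m power_interpolation[OF m] m4 in auto)
  show "bint r (\<lambda>x. (f x)\<^sup>2) \<le> M * m\<^sup>2 * R ^ 3"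
    by (rule gen[where c = "1 / m\<^sup>2"]) (use f m power_interpolation[OF m] m4 in auto)
  show "bint r (\<lambda>x. \<bar>f x\<bar> ^ 3) \<le> M * m ^ 3 * R ^ 3"
    by (rule gen[where c = "1 / m"]) (use f m power_interpolation[OF m] m4 in auto)
  show "bint r (\<lambda>x. (f x) ^ 4) \<le> M * m ^ 4 * R ^ 3"
    by (rule gen[where c = 1]) (use f m in auto)
qed

subsection \<open>The Caccioppoli inequality\<close>

lemma abs_mult_square_le: "\<bar>a\<bar> * b\<^sup>2 \<le> \<bar>a\<bar> ^ 3 + \<bar>b::real\<bar> ^ 3"
proof (cases "\<bar>a\<bar> \<le> \<bar>b\<bar>")
  case True
  then have "\<bar>a\<bar> * \<bar>b\<bar>\<^sup>2 \<le> \<bar>b\<bar> * \<bar>b\<bar>\<^sup>2" by (intro mult_right_mono) auto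
  also have "\<dots> = \<bar>b\<bar> ^ 3" by (simp add: eval_nat_numeral)
  finally show ?thesis by (simp add: add_increasing)
next
  case False
  then have "\<bar>a\<bar> * \<bar>b\<bar>\<^sup>2 \<le> \<bar>a\<bar> * \<bar>a\<bar>\<^sup>2" by (intro mult_left_mono power_mono) auto
  also have "\<dots> = \<bar>a\<bar> ^ 3" by (simp add: eval_nat_numeral)
  finally show ?thesis by (simp add: add_increasing2)
qed

lemma sum_3_square_le: "(\<Sum>i\<in>(UNIV::3 set). a i)\<^sup>2 \<le> 3 * (\<Sum>i\<in>UNIV. (a i :: real)\<^sup>2)"
  using zero_le_power2[of "a 1 - a 2"] zero_le_power2[of "a 1 - a 3"] zero_le_power2[of "a 2 - a 3"]
  by (simp add: sum_3 power2_eq_square algebra_simps)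

lemma sum_3_const_le: "(\<And>i. f i \<le> B) \<Longrightarrow> (\<Sum>i\<in>(UNIV::3 set). f i) \<le> 3 * (B::real)"
  using sum_mono[of UNIV f "\<lambda>_. B"] by simp

context weak_flow
begin

lemma u_power4_le:
  assumes "e > 0"
  shows "(u e i x) ^ 4 \<le> conv (mollifier e) (\<lambda>x. (U i x) ^ 4) x"
proof -
  have "(u e i x)\<^sup>2 \<le> conv (mollifier e) (\<lambda>x. (U i x)\<^sup>2) x"
    unfolding u_def by (rule conv_jensen[OF assms locint_U locint_U2])
  then have "((u e i x)\<^sup>2)\<^sup>2 \<le> (conv (mollifier e) (\<lambda>x. (U i x)\<^sup>2) x)\<^sup>2" by (intro power_mono) auto
  also have "\<dots> \<le> conv (mollifier e) (\<lambda>x. ((U i x)\<^sup>2)\<^sup>2) x"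
    using L4 by (intro conv_jensen[OF assms locint_U2]) simp
  finally show ?thesis by simp
qed

lemma bint_u4_le:
  assumes "e > 0" "r + e \<le> s"
  shows "bint r (\<lambda>x. (u e i x) ^ 4) \<le> bint s (\<lambda>x. (U i x) ^ 4)"
proof -
  have "bint r (\<lambda>x. (u e i x) ^ 4) \<le> bint r (conv (mollifier e) (\<lambda>x. (U i x) ^ 4))"
    using assms(1) by (intro bint_mono locint_smooth smooth_power smooth_u smooth_conv[OF tf_mollifier L4] u_power4_le)
  also have "\<dots> \<le> bint (r + e) (\<lambda>x. (U i x) ^ 4)" using assms(1) by (intro bint_conv_le L4) auto
  also have "\<dots> \<le> bint s (\<lambda>x. (U i x) ^ 4)" using assms(2) by (intro bint_mono_radius L4) auto
  finally show ?thesis .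
qed

text \<open>Every term of the energy identity is measured in the units X = m^2 R and Y = m^3 R^2,
  except the commutator, which is kept because it vanishes with e for fixed R. A single A has to
  serve all R, m and e, since R tends to infinity later.\<close>

lemma energy_bound:
  assumes K: "K \<ge> 0"
  obtains A where "A \<ge> 0" "\<And>R m e. R \<ge> 1 \<Longrightarrow> m > 0 \<Longrightarrow> 0 < e \<Longrightarrow> e \<le> 1 \<Longrightarrow>
      (\<And>i. bint (3 * R) (\<lambda>x. (U i x) ^ 4) \<le> K * m ^ 4 * R ^ 3) \<Longrightarrow>
      (\<Sum>i\<in>UNIV. \<Sum>j\<in>UNIV. bint (R / 2) (\<lambda>x. (pd i (u e j) x)\<^sup>2)) \<le>
        A * (m\<^sup>2 * R + m ^ 3 * R\<^sup>2) +
        A * (\<Sum>i\<in>UNIV. \<Sum>j\<in>UNIV. bint R (\<lambda>x. (stress e i j x - u e i x * u e j x)\<^sup>2))"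
proof -
  obtain C1 where C1: "C1 \<ge> 0" "\<And>s i x. s > 0 \<Longrightarrow> \<bar>pd i (mollifier s) x\<bar> \<le> C1 / s ^ 4"
    "\<And>s x. s > 0 \<Longrightarrow> \<bar>laplacian (mollifier s) x\<bar> \<le> C1 / s ^ 5"
    using mollifier_bounds by blast
  obtain C2 where C2: "C2 \<ge> 0" "\<And>s i x. s > 0 \<Longrightarrow> \<bar>pd i (cutoff s) x\<bar> \<le> C2 / s"
    "\<And>s x. s > 0 \<Longrightarrow> \<bar>laplacian (cutoff s) x\<bar> \<le> C2 / s\<^sup>2"
    using cutoff_bounds by blast
  obtain c where c: "c > 0" "\<And>R x. R > 0 \<Longrightarrow> norm x \<le> R / 2 \<Longrightarrow> c \<le> cutoff R x"
    using cutoff_lower by blast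
  define C where "C = C1 + C2"
  have C0: "C \<ge> 0" "C1 \<le> C" "C2 \<le> C" using C1(1) C2(1) by (auto simp: C_def)
  define M where "M = 27 * ball_const + K"
  have M0: "M \<ge> 0" using K ball_const_pos by (simp add: M_def)
  \<comment> \<open>The factor 20 exceeds every numerical coefficient in the estimates
    \<open>Ta\<close> to \<open>T3\<close>; the largest of them is 18.\<close>
  define A0 where "A0 = 20 * (C * M + C * C * M + C * M * M + M)"
  have A00: "A0 \<ge> 0" using C0 M0 by (simp add: A0_def)
  show ?thesis
  proof (rule that[of "(2 + 2 * A0) / c"])
    show "(2 + 2 * A0) / c \<ge> 0" using A00 c by simp
    fix R m e :: real
    assume R1: "R \<ge> 1" and m: "m > 0" and e: "0 < e" "e \<le> 1"
      and hyp: "\<And>i. bint (3 * R) (\<lambda>x. (U i x) ^ 4) \<le> K * m ^ 4 * R ^ 3"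
    have R: "R > 0" "e \<le> R" using R1 e by auto
    define \<psi> where "\<psi> = cutoff R"
    have \<psi>: "tf R \<psi>" unfolding \<psi>_def by (rule tf_cutoff[OF R(1)])
    have \<psi>r: "0 \<le> \<psi> x" "\<psi> x \<le> 1" for x unfolding \<psi>_def by (rule cutoff_range)+
    have pd\<psi>: "\<bar>pd i \<psi> x\<bar> \<le> C / R" for i x
      unfolding \<psi>_def using C2(2)[OF R(1), of i x] divide_right_mono[OF C0(3), of R] R(1) by simp
    have lap\<psi>: "\<bar>laplacian \<psi> x\<bar> \<le> C / R\<^sup>2" for x
      unfolding \<psi>_def using C2(3)[OF R(1), of x] divide_right_mono[OF C0(3), of "R\<^sup>2"] R(1) by simp
    have pdm: "\<bar>pd i (mollifier R) x\<bar> \<le> C / R ^ 4" for i x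
      using C1(2)[OF R(1), of i x] divide_right_mono[OF C0(2), of "R ^ 4"] R(1) by simp
    have lapm: "\<bar>laplacian (mollifier R) x\<bar> \<le> C / R ^ 5" for x
      using C1(3)[OF R(1), of x] divide_right_mono[OF C0(2), of "R ^ 5"] R(1) by simp
    obtain Z where Z: "tf R Z" "laplacian Z = (\<lambda>x. mollifier e x - mollifier R x)"
      using mollifier_diff_laplacian[OF e(1) R(2)] by blast
    note s = smooth_u[OF e(1)]
    define v where "v j x = \<psi> x * u e j x" for j x
    define g where "g x = (\<Sum>j\<in>UNIV. pd j \<psi> x * u e j x)" for x
    define w where "w = conv Z g"
    have tv: "tf R (v j)" for j unfolding v_def[abs_def] by (intro tf_mult \<psi> s)
    have tg: "tf R g" unfolding g_def[abs_def] by (intro tf_sum tf_mult tf_pd \<psi> s)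
    have tw: "tf (R + R) w" unfolding w_def by (rule tf_conv[OF Z(1) tg])
    have pdv: "pd i (v j) = (\<lambda>x. pd i \<psi> x * u e j x + \<psi> x * pd i (u e j) x)" for i j
      unfolding v_def[abs_def] by (intro pd_mult tf_smooth[OF \<psi>] s)
    define S where "S = (\<Sum>i\<in>UNIV. \<Sum>j\<in>UNIV. \<integral>x. \<psi> x * (pd i (u e j) x)\<^sup>2 \<partial>lborel)"
    define r where "r i j x = stress e i j x - u e i x * u e j x" for i j x
    have sr: "smooth (r i j)" for i j unfolding r_def[abs_def] by (intro smooth_diff smooth_mult s smooth_stress e)
    define RR where "RR = (\<Sum>i\<in>UNIV. \<Sum>j\<in>UNIV. bint R (\<lambda>x. (r i j x)\<^sup>2))"
    define X where "X = m\<^sup>2 * R"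
    define Y where "Y = m ^ 3 * R\<^sup>2"
    have XY: "X \<ge> 0" "Y \<ge> 0" using m R by (auto simp: X_def Y_def)

    \<comment> \<open>Functions supported in B(R), convolved with kernels of radius R, live in B(R +
      R), while u on B(R) depends on U in B(R + e). The radius 3R of the hypothesis covers
      both.\<close>
    have U4: "bint (R + R) (\<lambda>x. (U i x) ^ 4) \<le> K * m ^ 4 * R ^ 3" for i
      using bint_mono_radius[OF L4, of i "R + R" "3 * R"] hyp[of i] R by simp
    have u4: "bint R (\<lambda>x. (u e i x) ^ 4) \<le> K * m ^ 4 * R ^ 3" for i
      using bint_u4_le[OF e(1), of R "3 * R" i] hyp[of i] R by simp
    have R2: "0 \<le> R" "0 \<le> R + R" "R + R \<le> 3 * R" "R \<le> 3 * R" using R by auto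
    note mU = bint_moments[OF meas L4 m R2(1,2,3) U4, folded M_def]
    note mu = bint_moments[OF smooth_borel[OF s] locint_smooth[OF smooth_power[OF s]] m R2(1,1,4) u4, folded M_def]

    have Ta: "\<bar>\<integral>x. laplacian \<psi> x * energy e x \<partial>lborel\<bar> \<le> 3 * (C * M * X)"
    proof -
      have "\<bar>\<integral>x. laplacian \<psi> x * energy e x \<partial>lborel\<bar> \<le> C / R\<^sup>2 * bint R (\<lambda>x. \<bar>energy e x\<bar>)"
        by (intro tf_integral_le(1)[OF tf_laplacian[OF \<psi>]] locint_smooth smooth_energy e lap\<psi>)
      also have "bint R (\<lambda>x. \<bar>energy e x\<bar>) = (\<Sum>j\<in>UNIV. bint R (\<lambda>x. (u e j x)\<^sup>2))"
        by (subst bint_sum[symmetric]) (auto intro!: locint_smooth smooth_power s simp: energy_def sum_nonneg)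
      also have "C / R\<^sup>2 * \<dots> \<le> C / R\<^sup>2 * (3 * (M * m\<^sup>2 * R ^ 3))"
        using C0 by (intro mult_left_mono sum_3_const_le mu) auto
      also have "\<dots> = 3 * (C * M * X)" using R by (simp add: X_def eval_nat_numeral field_simps)
      finally show ?thesis .
    qed

    have Tb: "\<bar>\<integral>x. g x * energy e x \<partial>lborel\<bar> \<le> 18 * (C * M * Y)"
    proof -
      have l: "locint (\<lambda>x. u e j x * energy e x)" for j by (intro locint_smooth smooth_mult s smooth_energy e)
      have l3: "locint (\<lambda>x. \<bar>u e j x\<bar> ^ 3)" for j
        by (intro locint_continuous continuous_intros smooth_continuous s)
      have b: "bint R (\<lambda>x. \<bar>u e j x * energy e x\<bar>) \<le> 6 * (M * m ^ 3 * R ^ 3)" for j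
      proof -
        have "bint R (\<lambda>x. \<bar>u e j x * energy e x\<bar>) \<le> bint R (\<lambda>x. \<Sum>k\<in>UNIV. \<bar>u e j x\<bar> ^ 3 + \<bar>u e k x\<bar> ^ 3)"
        proof (intro bint_mono locint_abs l locint_sum locint_add l3)
          fix x
          have "0 \<le> energy e x" by (simp add: energy_def sum_nonneg)
          then have "\<bar>u e j x * energy e x\<bar> = \<bar>u e j x\<bar> * energy e x" by (simp add: abs_mult)
          also have "\<dots> = (\<Sum>k\<in>UNIV. \<bar>u e j x\<bar> * (u e k x)\<^sup>2)"
            by (simp add: energy_def sum_distrib_left)
          also have "\<dots> \<le> (\<Sum>k\<in>UNIV. \<bar>u e j x\<bar> ^ 3 + \<bar>u e k x\<bar> ^ 3)" by (intro sum_mono abs_mult_square_le)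
          finally show "\<bar>u e j x * energy e x\<bar> \<le> (\<Sum>k\<in>UNIV. \<bar>u e j x\<bar> ^ 3 + \<bar>u e k x\<bar> ^ 3)" .
        qed
        also have "\<dots> = (\<Sum>k\<in>UNIV. bint R (\<lambda>x. \<bar>u e j x\<bar> ^ 3) + bint R (\<lambda>x. \<bar>u e k x\<bar> ^ 3))"
          using l3 by (simp add: bint_sum locint_add bint_add)
        also have "\<dots> \<le> 3 * (M * m ^ 3 * R ^ 3 + M * m ^ 3 * R ^ 3)"
          by (intro sum_3_const_le add_mono mu)
        finally show ?thesis by (simp add: mult_ac)
      qed
      have "(\<integral>x. g x * energy e x \<partial>lborel) = (\<Sum>j\<in>UNIV. \<integral>x. pd j \<psi> x * (u e j x * energy e x) \<partial>lborel)"
        unfolding g_def sum_distrib_right mult.assoc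
        by (intro Bochner_Integration.integral_sum tf_integrable_mult(1)[OF tf_pd[OF \<psi>]] l)
      also have "\<bar>\<dots>\<bar> \<le> (\<Sum>j\<in>UNIV. \<bar>\<integral>x. pd j \<psi> x * (u e j x * energy e x) \<partial>lborel\<bar>)" by (rule sum_abs)
      also have "\<dots> \<le> 3 * (C / R * (6 * (M * m ^ 3 * R ^ 3)))"
      proof (rule sum_3_const_le)
        fix j
        have "\<bar>\<integral>x. pd j \<psi> x * (u e j x * energy e x) \<partial>lborel\<bar> \<le> C / R * bint R (\<lambda>x. \<bar>u e j x * energy e x\<bar>)"
          by (intro tf_integral_le(1)[OF tf_pd[OF \<psi>]] l pd\<psi>)
        also have "\<dots> \<le> C / R * (6 * (M * m ^ 3 * R ^ 3))" using C0 R by (intro mult_left_mono b) auto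
        finally show "\<bar>\<integral>x. pd j \<psi> x * (u e j x * energy e x) \<partial>lborel\<bar> \<le> C / R * (6 * (M * m ^ 3 * R ^ 3))" .
      qed
      also have "\<dots> = 18 * (C * M * Y)" using R by (simp add: Y_def eval_nat_numeral field_simps)
      finally show ?thesis .
    qed

    have Tc: "(\<Sum>i\<in>UNIV. \<Sum>j\<in>UNIV. \<integral>x. r i j x * pd i (v j) x \<partial>lborel) \<le> S / 2 + RR + 9 / 2 * (C * C * M * X)"
    proof -
      \<comment> \<open>Young's inequality for r \<psi> \<partial>u and for r u \<partial>\<psi>,
        each costing half of r^2. The first leaves half of the local energy, to be absorbed at the
        end, the second a multiple of X.\<close>
      have 1: "(\<integral>x. r i j x * pd i (v j) x \<partial>lborel) \<le>
          (\<integral>x. \<psi> x * (pd i (u e j) x)\<^sup>2 \<partial>lborel) / 2 + bint R (\<lambda>x. (r i j x)\<^sup>2) + C * C * M * X / 2" for i j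
      proof -
        have i1: "integrable lborel (\<lambda>x. r i j x * pd i (v j) x)"
          by (intro tf_integrable_mult(2)[OF tf_pd[OF tv]] locint_smooth sr)
        have i2: "integrable lborel (\<lambda>x. \<psi> x * (pd i (u e j) x)\<^sup>2 / 2)"
          by (intro integrable_divide_zero tf_integrable_mult(1)[OF \<psi>] locint_smooth smooth_power smooth_pd s)
        have i3: "integrable lborel (\<lambda>x. indicator (cball 0 R) x * (r i j x)\<^sup>2)"
          by (intro bint_integrable locint_smooth smooth_power sr)
        have i4: "integrable lborel (\<lambda>x. (C / R)\<^sup>2 / 2 * (indicator (cball 0 R) x * (u e j x)\<^sup>2))"
          by (intro integrable_mult_right bint_integrable locint_smooth smooth_power s)
        have "(\<integral>x. r i j x * pd i (v j) x \<partial>lborel) \<le> (\<integral>x. (\<psi> x * (pd i (u e j) x)\<^sup>2 / 2 + indicator (cball 0 R) x * (r i j x)\<^sup>2) +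
           (C / R)\<^sup>2 / 2 * (indicator (cball 0 R) x * (u e j x)\<^sup>2) \<partial>lborel)"
        proof (intro integral_mono i1 Bochner_Integration.integrable_add i2 i3 i4)
          fix x :: R3
          show "r i j x * pd i (v j) x \<le> (\<psi> x * (pd i (u e j) x)\<^sup>2 / 2 + indicator (cball 0 R) x * (r i j x)\<^sup>2) +
           (C / R)\<^sup>2 / 2 * (indicator (cball 0 R) x * (u e j x)\<^sup>2)"
          proof (cases "norm x \<le> R")
            case True
            define a b q p D where "a = r i j x" and "b = u e j x" and "q = pd i \<psi> x" and "p = \<psi> x" and "D = pd i (u e j) x"
            have "q\<^sup>2 \<le> (C / R)\<^sup>2" using power_mono[OF pd\<psi>[of i x], of 2] by (simp add: q_def)
            then have "q\<^sup>2 * b\<^sup>2 \<le> (C / R)\<^sup>2 * b\<^sup>2" by (intro mult_right_mono) auto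
            moreover have "2 * (a * (q * b)) \<le> a\<^sup>2 + q\<^sup>2 * b\<^sup>2"
              using sum_squares_bound[of a "q * b"] by (simp add: power_mult_distrib mult_ac)
            moreover have "p * (2 * (a * D)) \<le> p * (a\<^sup>2 + D\<^sup>2)"
              using sum_squares_bound[of a D] \<psi>r(1)[of x] by (intro mult_left_mono) (auto simp: p_def mult_ac)
            moreover have "p * a\<^sup>2 \<le> 1 * a\<^sup>2" using \<psi>r(2)[of x] by (intro mult_right_mono) (auto simp: p_def)
            ultimately have "2 * (a * (q * b + p * D)) \<le> p * D\<^sup>2 + 2 * a\<^sup>2 + (C / R)\<^sup>2 * b\<^sup>2"
              by (simp add: algebra_simps)
            then show ?thesis using True unfolding pdv a_def b_def q_def p_def D_def by simp
          next
            case False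
            then show ?thesis using tf_zero[OF tf_pd[OF tv], of x] \<psi>r(1)[of x] by simp
          qed
        qed
        also have "\<dots> = (\<integral>x. \<psi> x * (pd i (u e j) x)\<^sup>2 \<partial>lborel) / 2 + bint R (\<lambda>x. (r i j x)\<^sup>2) + (C / R)\<^sup>2 / 2 * bint R (\<lambda>x. (u e j x)\<^sup>2)"
          unfolding bint_def using i2 i3 i4 by simp
        also have "(C / R)\<^sup>2 / 2 * bint R (\<lambda>x. (u e j x)\<^sup>2) \<le> (C / R)\<^sup>2 / 2 * (M * m\<^sup>2 * R ^ 3)"
          by (intro mult_left_mono mu) auto
        also have "\<dots> = C * C * M * X / 2" using R by (simp add: X_def eval_nat_numeral field_simps)
        finally show ?thesis by simp
      qed
      have "(\<Sum>i\<in>UNIV. \<Sum>j\<in>UNIV. \<integral>x. r i j x * pd i (v j) x \<partial>lborel) \<le> (\<Sum>i\<in>UNIV. \<Sum>j\<in>UNIV.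
         (\<integral>x. \<psi> x * (pd i (u e j) x)\<^sup>2 \<partial>lborel) / 2 + bint R (\<lambda>x. (r i j x)\<^sup>2) + C * C * M * X / 2)"
        by (intro sum_mono 1)
      also have "\<dots> = S / 2 + RR + 9 / 2 * (C * C * M * X)"
        unfolding S_def RR_def by (simp add: sum.distrib sum_divide_distrib)
      finally show ?thesis .
    qed

    have bv: "bint R (\<lambda>x. \<bar>v j x\<bar>) \<le> M * m * R ^ 3" for j
    proof -
      have "bint R (\<lambda>x. \<bar>v j x\<bar>) \<le> bint R (\<lambda>x. \<bar>u e j x\<bar>)"
      proof (intro bint_mono locint_abs locint_smooth s tf_smooth[OF tv])
        fix x
        show "\<bar>v j x\<bar> \<le> \<bar>u e j x\<bar>" using \<psi>r[of x] by (simp add: v_def abs_mult mult_left_le_one_le)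
      qed
      then show ?thesis using mu(1)[of j] by linarith
    qed

    \<comment> \<open>Second derivatives of the mollifier at scale R have size R^(-5); two factors m
      R^3, one from v and one from U, make this m^2 R. In \<open>T2\<close> likewise R^(-4), m R^3
      and m^2 R^3 combine to m^3 R^2.\<close>
    have T1: "\<bar>\<Sum>j\<in>UNIV. \<integral>x. U j x * conv (laplacian (mollifier R)) (v j) x \<partial>lborel\<bar> \<le> 3 * (C * M * M * X)"
    proof -
      have "\<bar>\<integral>x. U j x * conv (laplacian (mollifier R)) (v j) x \<partial>lborel\<bar> \<le> C * M * M * X" for j
      proof -
        have b: "\<bar>conv (laplacian (mollifier R)) (v j) x\<bar> \<le> C / R ^ 5 * (M * m * R ^ 3)" for x
        proof -
          have "\<bar>conv (laplacian (mollifier R)) (v j) x\<bar> \<le> C / R ^ 5 * bint R (\<lambda>x. \<bar>v j x\<bar>)"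
            by (rule conv_sup_le[OF tf_laplacian[OF tf_mollifier[OF R(1)]] tv lapm])
          also have "\<dots> \<le> C / R ^ 5 * (M * m * R ^ 3)" using C0 R by (intro mult_left_mono bv) auto
          finally show ?thesis .
        qed
        have "\<bar>\<integral>x. U j x * conv (laplacian (mollifier R)) (v j) x \<partial>lborel\<bar> \<le> C / R ^ 5 * (M * m * R ^ 3) * bint (R + R) (\<lambda>x. \<bar>U j x\<bar>)"
          by (rule tf_integral_le(2)[OF tf_conv[OF tf_laplacian[OF tf_mollifier[OF R(1)]] tv] locint_U b])
        also have "\<dots> \<le> C / R ^ 5 * (M * m * R ^ 3) * (M * m * R ^ 3)"
          using C0 R M0 m by (intro mult_left_mono mU) auto
        also have "\<dots> = C * M * M * X" using R by (simp add: X_def eval_nat_numeral field_simps)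
        finally show ?thesis .
      qed
      then show ?thesis by (intro order_trans[OF sum_abs] sum_3_const_le)
    qed

    have UU: "bint (R + R) (\<lambda>x. \<bar>U i x * U j x\<bar>) \<le> M * m\<^sup>2 * R ^ 3" for i j
    proof -
      have "bint (R + R) (\<lambda>x. \<bar>U i x * U j x\<bar>) \<le> bint (R + R) (\<lambda>x. 1/2 * (U i x)\<^sup>2 + 1/2 * (U j x)\<^sup>2)"
      proof (intro bint_mono locint_abs locint_UU locint_add locint_cmult locint_U2)
        show "\<bar>U i x * U j x\<bar> \<le> 1/2 * (U i x)\<^sup>2 + 1/2 * (U j x)\<^sup>2" for x
          using sum_squares_bound[of "\<bar>U i x\<bar>" "\<bar>U j x\<bar>"] by (simp add: abs_mult)
      qed
      also have "\<dots> = 1/2 * bint (R + R) (\<lambda>x. (U i x)\<^sup>2) + 1/2 * bint (R + R) (\<lambda>x. (U j x)\<^sup>2)"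
        by (simp only: bint_add locint_cmult locint_U2 bint_cmult)
      also have "\<dots> \<le> M * m\<^sup>2 * R ^ 3" using mU(2)[of i] mU(2)[of j] by simp
      finally show ?thesis .
    qed

    have T2: "\<bar>\<Sum>i\<in>UNIV. \<Sum>j\<in>UNIV. \<integral>x. U i x * U j x * conv (pd i (mollifier R)) (v j) x \<partial>lborel\<bar> \<le> 9 * (C * M * M * Y)"
    proof -
      have 1: "\<bar>\<integral>x. U i x * U j x * conv (pd i (mollifier R)) (v j) x \<partial>lborel\<bar> \<le> C * M * M * Y" for i j
      proof -
        have b: "\<bar>conv (pd i (mollifier R)) (v j) x\<bar> \<le> C / R ^ 4 * (M * m * R ^ 3)" for x
        proof -
          have "\<bar>conv (pd i (mollifier R)) (v j) x\<bar> \<le> C / R ^ 4 * bint R (\<lambda>x. \<bar>v j x\<bar>)"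
            by (rule conv_sup_le[OF tf_pd[OF tf_mollifier[OF R(1)]] tv pdm])
          also have "\<dots> \<le> C / R ^ 4 * (M * m * R ^ 3)" using C0 R by (intro mult_left_mono bv) auto
          finally show ?thesis .
        qed
        have "\<bar>\<integral>x. U i x * U j x * conv (pd i (mollifier R)) (v j) x \<partial>lborel\<bar> \<le> C / R ^ 4 * (M * m * R ^ 3) * bint (R + R) (\<lambda>x. \<bar>U i x * U j x\<bar>)"
          by (rule tf_integral_le(2)[OF tf_conv[OF tf_pd[OF tf_mollifier[OF R(1)]] tv] locint_UU b])
        also have "\<dots> \<le> C / R ^ 4 * (M * m * R ^ 3) * (M * m\<^sup>2 * R ^ 3)"
          using C0 R M0 m by (intro mult_left_mono UU) auto
        also have "\<dots> = C * M * M * Y" using R by (simp add: Y_def eval_nat_numeral field_simps)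
        finally show ?thesis .
      qed
      have 2: "\<bar>\<Sum>j\<in>UNIV. \<integral>x. U i x * U j x * conv (pd i (mollifier R)) (v j) x \<partial>lborel\<bar> \<le> 3 * (C * M * M * Y)" for i
        by (intro order_trans[OF sum_abs] sum_3_const_le 1)
      have "\<bar>\<Sum>i\<in>UNIV. \<Sum>j\<in>UNIV. \<integral>x. U i x * U j x * conv (pd i (mollifier R)) (v j) x \<partial>lborel\<bar> \<le> 3 * (3 * (C * M * M * Y))"
        by (rule order_trans[OF sum_abs sum_3_const_le[OF 2]])
      then show ?thesis by simp
    qed

    have g2: "(\<integral>x. (g x)\<^sup>2 \<partial>lborel) \<le> 9 * (C * C * M * X)"
    proof -
      have "(\<integral>x. (g x)\<^sup>2 \<partial>lborel) \<le> (\<integral>x. 3 * (C / R)\<^sup>2 * (indicator (cball 0 R) x * energy e x) \<partial>lborel)"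
      proof (rule integral_mono)
        show "integrable lborel (\<lambda>x. (g x)\<^sup>2)" unfolding power2_eq_square
          by (intro tf_integrable_mult(1)[OF tg] locint_smooth tf_smooth[OF tg])
        show "integrable lborel (\<lambda>x. 3 * (C / R)\<^sup>2 * (indicator (cball 0 R) x * energy e x))"
          by (intro integrable_mult_right bint_integrable locint_smooth smooth_energy e)
        fix x :: R3
        show "(g x)\<^sup>2 \<le> 3 * (C / R)\<^sup>2 * (indicator (cball 0 R) x * energy e x)"
        proof (cases "norm x \<le> R")
          case True
          have "(g x)\<^sup>2 \<le> 3 * (\<Sum>j\<in>UNIV. (pd j \<psi> x * u e j x)\<^sup>2)" unfolding g_def by (rule sum_3_square_le)
          also have "\<dots> \<le> 3 * (\<Sum>j\<in>UNIV. (C / R)\<^sup>2 * (u e j x)\<^sup>2)"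
          proof (intro mult_left_mono sum_mono)
            fix j
            have "(pd j \<psi> x)\<^sup>2 \<le> (C / R)\<^sup>2" using power_mono[OF pd\<psi>[of j x], of 2] by simp
            then show "(pd j \<psi> x * u e j x)\<^sup>2 \<le> (C / R)\<^sup>2 * (u e j x)\<^sup>2"
              unfolding power_mult_distrib by (intro mult_right_mono) auto
          qed simp
          finally show ?thesis using True by (simp add: energy_def flip: sum_distrib_left)
        qed (use tf_zero[OF tg] in simp)
      qed
      also have "\<dots> = 3 * (C / R)\<^sup>2 * (\<Sum>j\<in>UNIV. bint R (\<lambda>x. (u e j x)\<^sup>2))"
        by (subst bint_sum[symmetric]) (auto intro!: locint_smooth smooth_power s simp: bint_def energy_def)
      also have "\<dots> \<le> 3 * (C / R)\<^sup>2 * (3 * (M * m\<^sup>2 * R ^ 3))"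
        by (intro mult_left_mono sum_3_const_le mu) auto
      also have "\<dots> = 9 * (C * C * M * X)" using R by (simp add: X_def eval_nat_numeral field_simps)
      finally show ?thesis .
    qed

    \<comment> \<open>The Laplacian of w is a difference of two averages of g, and averaging does
      not increase the L^2 norm; squaring the difference costs the factor 4.\<close>
    have lapw: "(\<integral>x. (laplacian w x)\<^sup>2 \<partial>lborel) \<le> 4 * (\<integral>x. (g x)\<^sup>2 \<partial>lborel)"
    proof -
      note te = tf_mollifier[OF e(1)] and tR = tf_mollifier[OF R(1)]
      let ?a = "conv (mollifier e) g" and ?b = "conv (mollifier R) g"
      have ta: "tf (R + R) ?a" "tf (R + R) ?b"
        using tf_mono[OF tf_conv[OF te tg]] R tf_conv[OF tR tg] by auto
      have lw: "laplacian w x = ?a x - ?b x" for x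
      proof -
        have "laplacian w = conv g (laplacian Z)"
          unfolding w_def laplacian_conv[OF Z(1) tg] by (rule conv_commute_tf[OF tf_laplacian[OF Z(1)] tg])
        moreover have "conv g (laplacian Z) x = ?a x - ?b x"
          unfolding Z(2) conv_commute_tf[OF te tg] conv_commute_tf[OF tR tg]
          by (intro conv_diff[OF tg] locint_smooth tf_smooth[OF te] tf_smooth[OF tR])
        ultimately show ?thesis by simp
      qed
      have i: "integrable lborel (\<lambda>x. (?a x)\<^sup>2)" "integrable lborel (\<lambda>x. (?b x)\<^sup>2)" "integrable lborel (\<lambda>x. (laplacian w x)\<^sup>2)"
        unfolding power2_eq_square
        by (intro tf_integrable_mult(1)[OF ta(1)] tf_integrable_mult(1)[OF ta(2)] tf_integrable_mult(1)[OF tf_laplacian[OF tw]]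
            locint_smooth tf_smooth[OF ta(1)] tf_smooth[OF ta(2)] tf_smooth[OF tf_laplacian[OF tw]])+
      have "(\<integral>x. (laplacian w x)\<^sup>2 \<partial>lborel) \<le> (\<integral>x. 2 * (?a x)\<^sup>2 + 2 * (?b x)\<^sup>2 \<partial>lborel)"
      proof (intro integral_mono Bochner_Integration.integrable_add integrable_mult_right i)
        fix x
        show "(laplacian w x)\<^sup>2 \<le> 2 * (?a x)\<^sup>2 + 2 * (?b x)\<^sup>2"
          unfolding lw using zero_le_power2[of "?a x + ?b x"] by (simp add: power2_eq_square algebra_simps)
      qed
      also have "\<dots> = 2 * (\<integral>x. (?a x)\<^sup>2 \<partial>lborel) + 2 * (\<integral>x. (?b x)\<^sup>2 \<partial>lborel)" using i by simp
      also have "\<dots> \<le> 4 * (\<integral>x. (g x)\<^sup>2 \<partial>lborel)"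
        using integral_conv_square_le[OF e(1) tg] integral_conv_square_le[OF R(1) tg] by simp
      finally show ?thesis .
    qed

    have T3: "- (\<Sum>i\<in>UNIV. \<Sum>j\<in>UNIV. \<integral>x. U i x * U j x * pd i (pd j w) x \<partial>lborel) \<le> 9 / 2 * (M * Y) + 18 * (C * C * M * Y)"
    proof -
      \<comment> \<open>The weight m R in Young's inequality balances its two sides: the fourth
        moments give m^4 R^3 / (m R), the Hessian gives m R times X, and both are Y.\<close>
      have mR: "m * R > 0" using m R by simp
      have 1: "- (\<integral>x. U i x * U j x * pd i (pd j w) x \<partial>lborel) \<le> M * Y / 2 + m * R / 2 * (\<integral>x. (pd i (pd j w) x)\<^sup>2 \<partial>lborel)" for i j
      proof -
        let ?h = "pd i (pd j w)"
        have th: "tf (R + R) ?h" by (intro tf_pd tw)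
        let ?q = "\<lambda>x. (U i x) ^ 4 + (U j x) ^ 4"
        have lq: "locint ?q" by (intro locint_add L4)
        have i1: "integrable lborel (\<lambda>x. - (U i x * U j x * ?h x))"
          using tf_integrable_mult(2)[OF th locint_UU] by simp
        have i2: "integrable lborel (\<lambda>x. 1 / (4 * (m * R)) * (indicator (cball 0 (R + R)) x * ?q x))"
          by (intro integrable_mult_right bint_integrable lq)
        have i3: "integrable lborel (\<lambda>x. m * R / 2 * (?h x)\<^sup>2)"
          unfolding power2_eq_square by (intro integrable_mult_right tf_integrable_mult(1)[OF th] locint_smooth tf_smooth[OF th])
        have "- (\<integral>x. U i x * U j x * ?h x \<partial>lborel) = (\<integral>x. - (U i x * U j x * ?h x) \<partial>lborel)" by simp
        also have "\<dots> \<le> (\<integral>x. 1 / (4 * (m * R)) * (indicator (cball 0 (R + R)) x * ?q x) + m * R / 2 * (?h x)\<^sup>2 \<partial>lborel)"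
        proof (intro integral_mono i1 Bochner_Integration.integrable_add i2 i3)
          fix x :: R3
          show "- (U i x * U j x * ?h x) \<le> 1 / (4 * (m * R)) * (indicator (cball 0 (R + R)) x * ?q x) + m * R / 2 * (?h x)\<^sup>2"
          proof (cases "norm x \<le> R + R")
            case True
            define a b h k where "a = (U i x)\<^sup>2" and "b = (U j x)\<^sup>2" and "h = ?h x" and "k = m * R"
            define p where "p = U i x * U j x"
            have k: "k > 0" using mR by (simp add: k_def)
            have "p\<^sup>2 = a * b" by (simp add: p_def a_def b_def power_mult_distrib)
            also have "2 * \<dots> \<le> a\<^sup>2 + b\<^sup>2" using sum_squares_bound[of a b] by simp
            finally have p2: "p\<^sup>2 \<le> (a\<^sup>2 + b\<^sup>2) / 2" by simp
            have "0 \<le> (p + k * h)\<^sup>2" by simp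
            then have "- (p * h) * (2 * k) \<le> p\<^sup>2 + k\<^sup>2 * h\<^sup>2" by (simp add: power2_eq_square algebra_simps)
            also have "\<dots> \<le> (a\<^sup>2 + b\<^sup>2) / 2 + k\<^sup>2 * h\<^sup>2" using p2 by simp
            finally have "- (p * h) \<le> ((a\<^sup>2 + b\<^sup>2) / 2 + k\<^sup>2 * h\<^sup>2) / (2 * k)" using k by (simp add: pos_le_divide_eq)
            also have "\<dots> = 1 / (4 * k) * (a\<^sup>2 + b\<^sup>2) + k / 2 * h\<^sup>2" using k by (simp add: field_simps power2_eq_square)
            finally show ?thesis using True unfolding p_def a_def b_def h_def k_def by simp
          next
            case False
            then show ?thesis using tf_zero[OF th, of x] by simp
          qed
        qed
        also have "\<dots> = 1 / (4 * (m * R)) * bint (R + R) ?q + m * R / 2 * (\<integral>x. (?h x)\<^sup>2 \<partial>lborel)"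
          unfolding bint_def by (subst Bochner_Integration.integral_add[OF i2 i3]) simp
        also have "bint (R + R) ?q = bint (R + R) (\<lambda>x. (U i x) ^ 4) + bint (R + R) (\<lambda>x. (U j x) ^ 4)"
          by (rule bint_add[OF L4 L4])
        also have "1 / (4 * (m * R)) * \<dots> \<le> 1 / (4 * (m * R)) * (M * m ^ 4 * R ^ 3 + M * m ^ 4 * R ^ 3)"
          using mR by (intro mult_left_mono add_mono mU) auto
        also have "\<dots> = M * Y / 2" using m R by (simp add: Y_def eval_nat_numeral field_simps)
        finally show ?thesis by simp
      qed
      have "- (\<Sum>i\<in>UNIV. \<Sum>j\<in>UNIV. \<integral>x. U i x * U j x * pd i (pd j w) x \<partial>lborel) =
        (\<Sum>i\<in>UNIV. \<Sum>j\<in>UNIV. - (\<integral>x. U i x * U j x * pd i (pd j w) x \<partial>lborel))" by (simp add: sum_negf)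
      also have "\<dots> \<le> (\<Sum>i\<in>UNIV. \<Sum>j\<in>UNIV. M * Y / 2 + m * R / 2 * (\<integral>x. (pd i (pd j w) x)\<^sup>2 \<partial>lborel))"
        by (intro sum_mono 1)
      also have "\<dots> = 9 / 2 * (M * Y) + m * R / 2 * (\<integral>x. (laplacian w x)\<^sup>2 \<partial>lborel)"
        unfolding w_def hessian_integral[OF Z(1) tg, symmetric] by (simp add: sum.distrib sum_distrib_left)
      also have "m * R / 2 * (\<integral>x. (laplacian w x)\<^sup>2 \<partial>lborel) \<le> m * R / 2 * (4 * (9 * (C * C * M * X)))"
        using lapw g2 mR by (intro mult_left_mono) auto
      also have "\<dots> = 18 * (C * C * M * Y)" by (simp add: X_def Y_def eval_nat_numeral)
      finally show ?thesis by simp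
    qed

    have id: "S = (\<integral>x. laplacian \<psi> x * energy e x \<partial>lborel) / 2 + (\<integral>x. g x * energy e x \<partial>lborel) / 2
     + (\<Sum>i\<in>UNIV. \<Sum>j\<in>UNIV. \<integral>x. r i j x * pd i (v j) x \<partial>lborel)
     - (\<Sum>j\<in>UNIV. \<integral>x. U j x * conv (laplacian (mollifier R)) (v j) x \<partial>lborel)
     - (\<Sum>i\<in>UNIV. \<Sum>j\<in>UNIV. \<integral>x. U i x * U j x * conv (pd i (mollifier R)) (v j) x \<partial>lborel)
     - (\<Sum>i\<in>UNIV. \<Sum>j\<in>UNIV. \<integral>x. U i x * U j x * pd i (pd j w) x \<partial>lborel)"
      using energy_identity[OF e(1) R(2) \<psi> Z] unfolding S_def r_def v_def[abs_def] g_def[abs_def] w_def .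
    have nn: "0 \<le> C * M * X" "0 \<le> C * M * Y" "0 \<le> C * C * M * X" "0 \<le> C * C * M * Y" "0 \<le> C * M * M * X" "0 \<le> C * M * M * Y"
      "0 \<le> M * X" "0 \<le> M * Y"
      using C0 M0 XY by auto
    have A0X: "A0 * (X + Y) = 20 * (C * M * X) + 20 * (C * M * Y) + 20 * (C * C * M * X) + 20 * (C * C * M * Y)
       + 20 * (C * M * M * X) + 20 * (C * M * M * Y) + 20 * (M * X) + 20 * (M * Y)"
      by (simp add: A0_def algebra_simps)
    have RR0: "RR \<ge> 0" unfolding RR_def by (intro sum_nonneg bint_nonneg) auto
    \<comment> \<open>Absorption of s/2 on the left, stated for real variables to keep the integrals
      out of the arithmetic.\<close>
    have comb: "s \<le> 2 * rr + 2 * (20 * p1 + 20 * p2 + 20 * p3 + 20 * p4 + 20 * p5 + 20 * p6 + 20 * p7 + 20 * p8)"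
      if "s = ta / 2 + tb / 2 + tc - t1 - t2 - t3" "ta \<le> 3 * p1" "tb \<le> 18 * p2" "tc \<le> s / 2 + rr + 9 / 2 * p3"
        "- t1 \<le> 3 * p5" "- t2 \<le> 9 * p6" "- t3 \<le> 9 / 2 * p8 + 18 * p4"
        "0 \<le> p1" "0 \<le> p2" "0 \<le> p3" "0 \<le> p4" "0 \<le> p5" "0 \<le> p6" "0 \<le> p7" "0 \<le> p8"
      for s ta tb tc t1 t2 t3 rr p1 p2 p3 p4 p5 p6 p7 p8 :: real
      using that by argo
    have S2: "S \<le> 2 * RR + 2 * (A0 * (X + Y))"
      unfolding A0X
      by (rule comb[OF id abs_le_D1[OF Ta] abs_le_D1[OF Tb] Tc abs_le_D2[OF T1] abs_le_D2[OF T2] T3 nn])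
    have "c * (\<Sum>i\<in>UNIV. \<Sum>j\<in>UNIV. bint (R / 2) (\<lambda>x. (pd i (u e j) x)\<^sup>2)) \<le> S"
      unfolding S_def sum_distrib_left
    proof (intro sum_mono)
      fix i j
      have l: "locint (\<lambda>x. (pd i (u e j) x)\<^sup>2)" by (intro locint_smooth smooth_power smooth_pd s)
      have "c * bint (R / 2) (\<lambda>x. (pd i (u e j) x)\<^sup>2) = (\<integral>x. c * (indicator (cball 0 (R / 2)) x * (pd i (u e j) x)\<^sup>2) \<partial>lborel)"
        by (simp add: bint_def)
      also have "\<dots> \<le> (\<integral>x. \<psi> x * (pd i (u e j) x)\<^sup>2 \<partial>lborel)"
      proof (intro integral_mono integrable_mult_right bint_integrable l tf_integrable_mult(1)[OF \<psi>])
        fix x :: R3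
        show "c * (indicator (cball 0 (R / 2)) x * (pd i (u e j) x)\<^sup>2) \<le> \<psi> x * (pd i (u e j) x)\<^sup>2"
          using c(2)[OF R(1), of x] \<psi>r(1)[of x] by (auto simp: indicator_def \<psi>_def mult_right_mono)
      qed
      finally show "c * bint (R / 2) (\<lambda>x. (pd i (u e j) x)\<^sup>2) \<le> (\<integral>x. \<psi> x * (pd i (u e j) x)\<^sup>2 \<partial>lborel)" .
    qed
    also note S2
    also have "2 * RR + 2 * (A0 * (X + Y)) \<le> (2 + 2 * A0) * (X + Y) + (2 + 2 * A0) * RR"
      using mult_nonneg_nonneg[OF A00 RR0] XY by (simp add: algebra_simps)
    finally show "(\<Sum>i\<in>UNIV. \<Sum>j\<in>UNIV. bint (R / 2) (\<lambda>x. (pd i (u e j) x)\<^sup>2)) \<le>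
        (2 + 2 * A0) / c * (m\<^sup>2 * R + m ^ 3 * R\<^sup>2) +
        (2 + 2 * A0) / c * (\<Sum>i\<in>UNIV. \<Sum>j\<in>UNIV. bint R (\<lambda>x. (stress e i j x - u e i x * u e j x)\<^sup>2))"
      using c(1) unfolding X_def[symmetric] Y_def[symmetric] RR_def[unfolded r_def, symmetric]
      by (simp add: pos_le_divide_eq mult.commute flip: add_divide_distrib)
  qed
qed

end

subsection \<open>The Liouville theorem for flows of slow growth\<close>

lemma smooth_constant:
  assumes "smooth f" "\<And>i x. pd i f x = 0"
  obtains c where "\<And>x. f x = c"
proof -
  have "(f has_derivative (\<lambda>h. 0)) (at x within UNIV)" for x
    using has_derivative_pd[OF smooth_differentiable[OF assms(1)], of x] by (simp add: assms(2))
  then obtain c where "\<And>x. x \<in> UNIV \<Longrightarrow> f x = c"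
    using has_derivative_zero_constant[of UNIV f] by auto
  then show ?thesis using that by auto
qed

lemma conv_mollifier_approx:
  assumes s: "0 < s" and h: "locint h" "\<And>x y. \<bar>h x - h y\<bar> \<le> L * norm (x - y)" and L: "L \<ge> 0"
  shows "\<bar>conv (mollifier s) h x - h x\<bar> \<le> L * s"
proof -
  note t = tf_mollifier[OF s]
  have i: "integrable lborel (\<lambda>y. mollifier s (x - y) * (h y - h x))"
    by (rule conv_integrable[OF t locint_diff[OF h(1) locint_const]])
  have i2: "integrable lborel (\<lambda>y. mollifier s (x - y) * (L * s))"
    by (rule conv_integrable[OF t locint_const])
  have "conv (mollifier s) h x - h x = (\<integral>y. mollifier s (x - y) * (h y - h x) \<partial>lborel)"
  proof -
    have "(\<integral>y. mollifier s (x - y) * (h y - h x) \<partial>lborel) = conv (mollifier s) (\<lambda>y. h y - h x) x"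
      by (simp add: conv_def)
    also have "\<dots> = conv (mollifier s) h x - h x"
      using conv_diff[OF t h(1) locint_const] by (simp add: conv_mollifier_const[OF s])
    finally show ?thesis by simp
  qed
  also have "norm \<dots> \<le> (\<integral>y. mollifier s (x - y) * (L * s) \<partial>lborel)"
  proof (rule Bochner_Integration.integral_norm_bound_integral[OF i i2])
    fix y
    show "norm (mollifier s (x - y) * (h y - h x)) \<le> mollifier s (x - y) * (L * s)"
    proof (cases "norm (x - y) \<le> s")
      case True
      have "\<bar>h y - h x\<bar> \<le> L * norm (y - x)" by (rule h(2))
      also have "\<dots> \<le> L * s" using True L by (intro mult_left_mono) (auto simp: norm_minus_commute)
      finally show ?thesis using mollifier_nonneg[OF s, of "x - y"] by (simp add: abs_mult mult_left_mono)
    next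
      case False
      then show ?thesis using tf_zero[OF t, of "x - y"] by simp
    qed
  qed
  also have "\<dots> = L * s"
    using conv_mollifier_const[OF s, of "L * s" x] by (simp add: conv_def)
  finally show ?thesis by simp
qed

context weak_flow
begin

lemma stress_diff_square_le:
  assumes e: "e > 0"
  defines "var \<equiv> \<lambda>i x. conv (mollifier e) (\<lambda>y. (U i y)\<^sup>2) x - (conv (mollifier e) (U i) x)\<^sup>2"
  shows "(stress e i j x - u e i x * u e j x)\<^sup>2 \<le> (var i x)\<^sup>2 + (var j x)\<^sup>2"
proof -
  have "\<bar>stress e i j x - u e i x * u e j x\<bar> \<le> (var i x + var j x) / 2"
    using conv_covariance[OF e locint_U[of i] locint_U2[of i] locint_U[of j] locint_U2[of j] locint_UU[of i j], of x]
    unfolding stress_def u_def var_def by (simp add: power2_eq_square)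
  then have "(stress e i j x - u e i x * u e j x)\<^sup>2 \<le> ((var i x + var j x) / 2)\<^sup>2"
    by (metis abs_ge_zero power2_abs power_mono)
  also have "\<dots> \<le> (var i x)\<^sup>2 + (var j x)\<^sup>2"
  proof -
    have "0 \<le> (var i x - var j x)\<^sup>2 + (2 * (var i x)\<^sup>2 + 2 * (var j x)\<^sup>2)" by simp
    then show ?thesis by (simp add: power_divide power2_eq_square algebra_simps)
  qed
  finally show ?thesis .
qed

text \<open>The commutators are dominated by variances, and their squares by the mean fourth-power
  oscillation of U, which vanishes with e. The threshold \<delta> depends on R; this is harmless as
  e tends to zero before R grows.\<close>

lemma commutator_small:
  assumes \<eta>: "\<eta> > 0"
  obtains \<delta> where "\<delta> > 0" "\<And>e. 0 < e \<Longrightarrow> e \<le> \<delta> \<Longrightarrow>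
    (\<Sum>i\<in>UNIV. \<Sum>j\<in>UNIV. bint R (\<lambda>x. (stress e i j x - u e i x * u e j x)\<^sup>2)) \<le> \<eta>"
proof -
  define var where "var e i x = conv (mollifier e) (\<lambda>y. (U i y)\<^sup>2) x - (conv (mollifier e) (U i) x)\<^sup>2" for e i x
  define osc where "osc e i = (\<integral>\<^sup>+x. ennreal (indicator (cball 0 R) x) * (\<integral>\<^sup>+y. ennreal (mollifier e (x - y) * (U i y - U i x) ^ 4) \<partial>lborel) \<partial>lborel)" for e i
  \<comment> \<open>There are nine commutators, each bounded by two squared variances, which
    accounts for the 18.\<close>
  have "\<exists>\<delta>>0. \<forall>e. 0 < e \<longrightarrow> e \<le> \<delta> \<longrightarrow> osc e i \<le> ennreal (\<eta> / 18)" for i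
  proof -
    have "\<eta> / 18 > 0" using \<eta> by simp
    from mollified_oscillation[OF meas L4 this] show ?thesis unfolding osc_def by blast
  qed
  then obtain D where D: "\<And>i. D i > 0" "\<And>i e. 0 < e \<Longrightarrow> e \<le> D i \<Longrightarrow> osc e i \<le> ennreal (\<eta> / 18)"
    by metis
  have "finite (range D)" by simp
  show ?thesis
  proof (rule that[of "Min (range D)"])
    show "Min (range D) > 0" using D(1) by (subst Min_gr_iff) auto
    fix e assume e: "0 < e" "e \<le> Min (range D)"
    have eD: "e \<le> D i" for i using e(2) Min_le[of "range D" "D i"] by simp
    have sv: "smooth (var e i)" for i
      unfolding var_def[abs_def] using e(1)
      by (intro smooth_diff smooth_power smooth_conv[OF tf_mollifier] locint_U locint_U2)
    have l: "locint (\<lambda>x. (var e i x)\<^sup>2)" for i by (intro locint_smooth smooth_power sv)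
    have v: "bint R (\<lambda>x. (var e i x)\<^sup>2) \<le> \<eta> / 18" for i
    proof -
      have "ennreal (bint R (\<lambda>x. (var e i x)\<^sup>2)) = (\<integral>\<^sup>+x. ennreal (indicator (cball 0 R) x * (var e i x)\<^sup>2) \<partial>lborel)"
        unfolding bint_def by (intro nn_integral_eq_integral[symmetric] bint_integrable l) auto
      also have "\<dots> \<le> (\<integral>\<^sup>+x. ennreal (indicator (cball 0 R) x) * (\<integral>\<^sup>+y. ennreal (mollifier e (x - y) * (U i y - U i x) ^ 4) \<partial>lborel) \<partial>lborel)"
        unfolding var_def using oscillation_bounds(1)[OF meas L4 e(1)]
        by (intro nn_integral_mono) (auto simp: ennreal_mult'' intro!: mult_left_mono)
      also have "\<dots> \<le> ennreal (\<eta> / 18)" by (rule D(2)[OF e(1) eD, unfolded osc_def])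
      finally show ?thesis using \<eta> by (simp add: ennreal_le_iff)
    qed
    have r: "bint R (\<lambda>x. (stress e i j x - u e i x * u e j x)\<^sup>2) \<le> \<eta> / 9" for i j
    proof -
      have "bint R (\<lambda>x. (stress e i j x - u e i x * u e j x)\<^sup>2) \<le> bint R (\<lambda>x. (var e i x)\<^sup>2 + (var e j x)\<^sup>2)"
        using e(1) stress_diff_square_le[OF e(1)] unfolding var_def[symmetric]
        by (intro bint_mono locint_add l locint_smooth smooth_power smooth_diff smooth_mult smooth_u smooth_stress) auto
      also have "\<dots> = bint R (\<lambda>x. (var e i x)\<^sup>2) + bint R (\<lambda>x. (var e j x)\<^sup>2)" by (rule bint_add[OF l l])
      finally show ?thesis using v[of i] v[of j] by simp
    qed
    have "(\<Sum>j\<in>UNIV. bint R (\<lambda>x. (stress e i j x - u e i x * u e j x)\<^sup>2)) \<le> 3 * (\<eta> / 9)" for i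
      by (rule sum_3_const_le[OF r])
    then have "(\<Sum>i\<in>UNIV. \<Sum>j\<in>UNIV. bint R (\<lambda>x. (stress e i j x - u e i x * u e j x)\<^sup>2)) \<le> 3 * (3 * (\<eta> / 9))"
      by (rule sum_3_const_le)
    then show "(\<Sum>i\<in>UNIV. \<Sum>j\<in>UNIV. bint R (\<lambda>x. (stress e i j x - u e i x * u e j x)\<^sup>2)) \<le> \<eta>" by simp
  qed
qed

text \<open>The admissible size of the commutator is chosen as T = m^2 R + m^3 R^2 itself. Since T
  is positive, small e achieve this, and the commutator is swallowed by the other terms.\<close>

lemma caccioppoli:
  assumes K: "K \<ge> 0"
  obtains A where "A > 0" "\<And>R m. R \<ge> 1 \<Longrightarrow> m > 0 \<Longrightarrow>
      (\<And>i. bint (3 * R) (\<lambda>x. (U i x) ^ 4) \<le> K * m ^ 4 * R ^ 3) \<Longrightarrow>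
      \<exists>\<delta>>0. \<forall>e i j. 0 < e \<longrightarrow> e \<le> \<delta> \<longrightarrow> bint (R / 2) (\<lambda>x. (pd i (u e j) x)\<^sup>2) \<le> A * (m\<^sup>2 * R + m ^ 3 * R\<^sup>2)"
proof -
  obtain A where A: "A \<ge> 0" "\<And>R m e. R \<ge> 1 \<Longrightarrow> m > 0 \<Longrightarrow> 0 < e \<Longrightarrow> e \<le> 1 \<Longrightarrow>
      (\<And>i. bint (3 * R) (\<lambda>x. (U i x) ^ 4) \<le> K * m ^ 4 * R ^ 3) \<Longrightarrow>
      (\<Sum>i\<in>UNIV. \<Sum>j\<in>UNIV. bint (R / 2) (\<lambda>x. (pd i (u e j) x)\<^sup>2)) \<le>
        A * (m\<^sup>2 * R + m ^ 3 * R\<^sup>2) +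
        A * (\<Sum>i\<in>UNIV. \<Sum>j\<in>UNIV. bint R (\<lambda>x. (stress e i j x - u e i x * u e j x)\<^sup>2))"
    using energy_bound[OF K] by blast
  show ?thesis
  proof (rule that[of "2 * A + 1"])
    show "2 * A + 1 > 0" using A by simp
    fix R m :: real
    assume R: "R \<ge> 1" and m: "m > 0" and hyp: "\<And>i. bint (3 * R) (\<lambda>x. (U i x) ^ 4) \<le> K * m ^ 4 * R ^ 3"
    define T where "T = m\<^sup>2 * R + m ^ 3 * R\<^sup>2"
    have T: "T > 0" using R m by (auto simp: T_def intro!: add_pos_nonneg)
    obtain \<delta> where \<delta>: "\<delta> > 0" "\<And>e. 0 < e \<Longrightarrow> e \<le> \<delta> \<Longrightarrow>
        (\<Sum>i\<in>UNIV. \<Sum>j\<in>UNIV. bint R (\<lambda>x. (stress e i j x - u e i x * u e j x)\<^sup>2)) \<le> T"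
      using commutator_small[OF T, of R] by blast
    show "\<exists>\<delta>>0. \<forall>e i j. 0 < e \<longrightarrow> e \<le> \<delta> \<longrightarrow> bint (R / 2) (\<lambda>x. (pd i (u e j) x)\<^sup>2) \<le> (2 * A + 1) * (m\<^sup>2 * R + m ^ 3 * R\<^sup>2)"
    proof (intro exI[of _ "min \<delta> 1"] conjI allI impI)
      show "min \<delta> 1 > 0" using \<delta>(1) by simp
      fix e :: real and i j assume e: "0 < e" "e \<le> min \<delta> 1"
      have nn: "0 \<le> bint (R / 2) (\<lambda>x. (pd i (u e j) x)\<^sup>2)" for i j by (rule bint_nonneg) simp
      have "bint (R / 2) (\<lambda>x. (pd i (u e j) x)\<^sup>2) \<le> (\<Sum>j\<in>UNIV. bint (R / 2) (\<lambda>x. (pd i (u e j) x)\<^sup>2))"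
        by (rule member_le_sum) (auto simp: nn)
      also have "\<dots> \<le> (\<Sum>i\<in>UNIV. \<Sum>j\<in>UNIV. bint (R / 2) (\<lambda>x. (pd i (u e j) x)\<^sup>2))"
        by (rule member_le_sum) (auto simp: nn sum_nonneg)
      also have "\<dots> \<le> A * T + A * (\<Sum>i\<in>UNIV. \<Sum>j\<in>UNIV. bint R (\<lambda>x. (stress e i j x - u e i x * u e j x)\<^sup>2))"
        unfolding T_def using e by (intro A(2)[OF R m _ _ hyp]) auto
      also have "\<dots> \<le> A * T + A * T" using e A(1) by (intro add_left_mono mult_left_mono \<delta>(2)) auto
      also have "\<dots> \<le> (2 * A + 1) * T" using T by (simp add: algebra_simps)
      finally show "bint (R / 2) (\<lambda>x. (pd i (u e j) x)\<^sup>2) \<le> (2 * A + 1) * (m\<^sup>2 * R + m ^ 3 * R\<^sup>2)"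
        unfolding T_def .
    qed
  qed
qed

text \<open>For one fixed test function, R and then e are chosen. Integration by parts bounds the
  pairing of u with \<partial>\<phi> by the gradient of u on the support of \<phi>, which is small
  for large R; passing from u to U costs only the mollification error of \<partial>\<phi>, because
  the kernel can be moved onto it.\<close>

lemma weak_gradient_zero:
  assumes K: "K \<ge> 0" and m: "\<And>R. R \<ge> 1 \<Longrightarrow> m R > 0"
    and hyp: "\<And>R i. R \<ge> 1 \<Longrightarrow> bint (3 * R) (\<lambda>x. (U i x) ^ 4) \<le> K * m R ^ 4 * R ^ 3"
    and lim: "((\<lambda>R. (m R)\<^sup>2 * R + m R ^ 3 * R\<^sup>2) \<longlongrightarrow> 0) at_top"
    and \<phi>: "tf s \<phi>"
  shows "(\<integral>x. U j x * pd i \<phi> x \<partial>lborel) = 0"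
proof -
  obtain A where A: "A > 0" "\<And>R m. R \<ge> 1 \<Longrightarrow> m > 0 \<Longrightarrow>
      (\<And>i. bint (3 * R) (\<lambda>x. (U i x) ^ 4) \<le> K * m ^ 4 * R ^ 3) \<Longrightarrow>
      \<exists>\<delta>>0. \<forall>e i j. 0 < e \<longrightarrow> e \<le> \<delta> \<longrightarrow> bint (R / 2) (\<lambda>x. (pd i (u e j) x)\<^sup>2) \<le> A * (m\<^sup>2 * R + m ^ 3 * R\<^sup>2)"
    using caccioppoli[OF K] by blast
  let ?h = "pd i \<phi>"
  have th: "tf s ?h" by (rule tf_pd[OF \<phi>])
  note lh = locint_smooth[OF tf_smooth[OF th]]
  obtain L where L: "L \<ge> 0" "\<And>x y. \<bar>?h x - ?h y\<bar> \<le> L * norm (x - y)" using tf_lipschitz[OF th] by blast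
  define B where "B = bint (s + 1) (\<lambda>x. \<bar>U j x\<bar>)"
  define Q where "Q = (\<integral>x. (\<phi> x)\<^sup>2 \<partial>lborel)"
  have Q: "Q \<ge> 0" unfolding Q_def by simp
  have B: "B \<ge> 0" unfolding B_def by (rule bint_nonneg) simp
  have main: "\<bar>\<integral>x. U j x * ?h x \<partial>lborel\<bar> \<le> \<eta> * (1 + Q) + \<eta> * (L * B)" if \<eta>: "\<eta> > 0" for \<eta>
  proof -
    have "\<forall>\<^sub>F R in at_top. (m R)\<^sup>2 * R + m R ^ 3 * R\<^sup>2 < \<eta>\<^sup>2 / A"
      using lim \<eta> A(1) by (intro order_tendstoD) auto
    moreover have "\<forall>\<^sub>F R in at_top. R \<ge> max 1 (2 * s)" by (rule eventually_ge_at_top)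
    ultimately obtain R where R: "(m R)\<^sup>2 * R + m R ^ 3 * R\<^sup>2 < \<eta>\<^sup>2 / A" "R \<ge> 1" "R \<ge> 2 * s"
      using eventually_happens[OF eventually_conj] by force
    obtain \<delta> where \<delta>: "\<delta> > 0" "\<And>e i j. 0 < e \<Longrightarrow> e \<le> \<delta> \<Longrightarrow> bint (R / 2) (\<lambda>x. (pd i (u e j) x)\<^sup>2) \<le> A * ((m R)\<^sup>2 * R + m R ^ 3 * R\<^sup>2)"
      using A(2)[OF R(2) m[OF R(2)] hyp[OF R(2)]] by blast
    \<comment> \<open>The bound by \<eta> makes the mollification error L e B at most \<eta> L B,
      and the bound by 1 keeps the mollified test function in B(s + 1), where \<open>B\<close> is
      measured.\<close>
    define e where "e = min \<delta> (min 1 \<eta>)"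
    have e: "0 < e" "e \<le> \<delta>" "e \<le> 1" "e \<le> \<eta>" using \<delta> \<eta> by (auto simp: e_def)
    note te = tf_mollifier[OF e(1)] and su = smooth_u[OF e(1), of j]
    have lD: "locint (\<lambda>x. (pd i (u e j) x)\<^sup>2)" by (intro locint_smooth smooth_power smooth_pd su)
    have "bint s (\<lambda>x. (pd i (u e j) x)\<^sup>2) \<le> bint (R / 2) (\<lambda>x. (pd i (u e j) x)\<^sup>2)"
      using R by (intro bint_mono_radius lD) auto
    also have "\<dots> \<le> A * ((m R)\<^sup>2 * R + m R ^ 3 * R\<^sup>2)" by (rule \<delta>(2)[OF e(1,2)])
    also have "\<dots> \<le> \<eta>\<^sup>2" using R(1) A(1) by (simp add: pos_less_divide_eq mult.commute)
    finally have grad: "bint s (\<lambda>x. (pd i (u e j) x)\<^sup>2) \<le> \<eta>\<^sup>2" .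
    have i0: "integrable lborel (\<lambda>x. \<phi> x * pd i (u e j) x)"
      by (intro tf_integrable_mult(1)[OF \<phi>] locint_smooth smooth_pd su)
    have i1: "integrable lborel (\<lambda>x. 1 / \<eta> * (indicator (cball 0 s) x * (pd i (u e j) x)\<^sup>2))"
      by (intro integrable_mult_right bint_integrable lD)
    have i2: "integrable lborel (\<lambda>x. \<eta> * (\<phi> x)\<^sup>2)"
      unfolding power2_eq_square by (intro integrable_mult_right tf_integrable_mult(1)[OF \<phi>] locint_smooth tf_smooth[OF \<phi>])
    have "(\<integral>x. u e j x * ?h x \<partial>lborel) = - (\<integral>x. \<phi> x * pd i (u e j) x \<partial>lborel)"
      using integral_by_parts[OF \<phi> su, of i] by (simp add: mult.commute)
    also have "\<bar>\<dots>\<bar> = norm (\<integral>x. \<phi> x * pd i (u e j) x \<partial>lborel)" by simp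
    also have "\<dots> \<le> (\<integral>x. 1 / \<eta> * (indicator (cball 0 s) x * (pd i (u e j) x)\<^sup>2) + \<eta> * (\<phi> x)\<^sup>2 \<partial>lborel)"
    proof (rule Bochner_Integration.integral_norm_bound_integral[OF i0 Bochner_Integration.integrable_add[OF i1 i2]])
      fix x :: R3
      show "norm (\<phi> x * pd i (u e j) x) \<le> 1 / \<eta> * (indicator (cball 0 s) x * (pd i (u e j) x)\<^sup>2) + \<eta> * (\<phi> x)\<^sup>2"
      proof (cases "norm x \<le> s")
        case True
        define a b where "a = \<bar>\<phi> x\<bar>" and "b = \<bar>pd i (u e j) x\<bar>"
        have ab: "a \<ge> 0" "b \<ge> 0" by (auto simp: a_def b_def)
        have "2 * (\<eta> * a) * b \<le> (\<eta> * a)\<^sup>2 + b\<^sup>2" by (rule sum_squares_bound)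
        moreover have "0 \<le> (\<eta> * a) * b" using ab \<eta> by simp
        ultimately have "a * b * \<eta> \<le> b\<^sup>2 + \<eta> * a\<^sup>2 * \<eta>" by (simp add: power2_eq_square mult_ac)
        then have "a * b \<le> 1 / \<eta> * b\<^sup>2 + \<eta> * a\<^sup>2" using \<eta> by (simp add: field_simps)
        then show ?thesis using True by (simp add: a_def b_def abs_mult)
      next
        case False
        then show ?thesis using tf_zero[OF \<phi>, of x] by simp
      qed
    qed
    also have "\<dots> = 1 / \<eta> * bint s (\<lambda>x. (pd i (u e j) x)\<^sup>2) + \<eta> * Q"
      unfolding bint_def Q_def using i1 i2 by simp
    also have "\<dots> \<le> 1 / \<eta> * \<eta>\<^sup>2 + \<eta> * Q" using grad \<eta> by (intro add_right_mono mult_left_mono) auto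
    also have "\<dots> = \<eta> * (1 + Q)" using \<eta> by (simp add: power2_eq_square algebra_simps)
    finally have a: "\<bar>\<integral>x. u e j x * ?h x \<partial>lborel\<bar> \<le> \<eta> * (1 + Q)" .
    have tc: "tf (s + 1) (conv (mollifier e) ?h)"
      using tf_mono[OF tf_conv[OF te th], of "s + 1"] e by simp
    have td: "tf (s + 1) (\<lambda>x. conv (mollifier e) ?h x - ?h x)"
      by (intro tf_diff tc tf_mono[OF th]) simp
    have "(\<integral>x. u e j x * ?h x \<partial>lborel) = (\<integral>x. U j x * conv (mollifier e) ?h x \<partial>lborel)"
      unfolding u_def by (rule tf_conv_swap[OF te mollifier_even locint_U th, symmetric])
    then have "(\<integral>x. u e j x * ?h x \<partial>lborel) - (\<integral>x. U j x * ?h x \<partial>lborel) = (\<integral>x. U j x * (conv (mollifier e) ?h x - ?h x) \<partial>lborel)"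
      using tf_integrable_mult(2)[OF tc locint_U[of j]] tf_integrable_mult(2)[OF th locint_U[of j]]
      by (simp add: right_diff_distrib)
    also have "\<bar>\<dots>\<bar> \<le> L * e * B"
      unfolding B_def by (intro tf_integral_le(2)[OF td locint_U] conv_mollifier_approx[OF e(1) lh L(2,1)])
    also have "\<dots> \<le> L * \<eta> * B" using e(4) L(1) B by (intro mult_right_mono mult_left_mono) auto
    finally show ?thesis using a by (simp add: mult_ac)
  qed
  have "\<bar>\<integral>x. U j x * ?h x \<partial>lborel\<bar> \<le> 0"
  proof (rule field_le_epsilon)
    fix \<epsilon> :: real assume "\<epsilon> > 0"
    have p: "1 + Q + L * B > 0" using Q L(1) B by (simp add: add_pos_nonneg)
    then have "\<epsilon> / (1 + Q + L * B) > 0" using \<open>\<epsilon> > 0\<close> by simp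
    from main[OF this] have "\<bar>\<integral>x. U j x * ?h x \<partial>lborel\<bar> \<le> \<epsilon> / (1 + Q + L * B) * (1 + Q + L * B)"
      by (simp only: distrib_left)
    then show "\<bar>\<integral>x. U j x * ?h x \<partial>lborel\<bar> \<le> 0 + \<epsilon>" using p by simp
  qed
  then show ?thesis by simp
qed

text \<open>A vanishing weak gradient makes every mollification of U constant. Its mean modulus over
  B(R) is at most a multiple of \<open>m R\<close>, so the constant is zero, and letting the
  mollification scale tend to zero recovers U.\<close>

lemma liouville:
  assumes K: "K \<ge> 0" and m: "\<And>R. R \<ge> 1 \<Longrightarrow> m R > 0"
    and hyp: "\<And>R i. R \<ge> 1 \<Longrightarrow> bint (3 * R) (\<lambda>x. (U i x) ^ 4) \<le> K * m R ^ 4 * R ^ 3"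
    and lim: "((\<lambda>R. (m R)\<^sup>2 * R + m R ^ 3 * R\<^sup>2) \<longlongrightarrow> 0) at_top" and lim_m: "(m \<longlongrightarrow> 0) at_top"
  shows "AE x in lborel. U j x = 0"
proof -
  have wg: "(\<integral>x. U j x * pd i \<phi> x \<partial>lborel) = 0" if "tf s \<phi>" for s \<phi> i
    by (rule weak_gradient_zero[where K = K and m = m]) (use K m hyp lim that in auto)
  have u0: "u s j x = 0" if s: "s > 0" for s x
  proof -
    note t = tf_mollifier[OF s]
    have "pd i (u s j) x = 0" for i x
    proof -
      have "pd i (u s j) x = - (\<integral>y. U j y * pd i (\<lambda>y. mollifier s (x - y)) y \<partial>lborel)"
        unfolding u_def pd_conv[OF t locint_U] tf_reflect(2)[OF t] conv_def by (simp add: mult.commute)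
      then show ?thesis using wg[OF tf_reflect(1)[OF t]] by simp
    qed
    then obtain c where c: "\<And>x. u s j x = c" using smooth_constant[OF smooth_u[OF s]] by blast
    define M where "M = 27 * ball_const + K"
    have le: "\<bar>c\<bar> \<le> M / ball_const * m R" if R: "R \<ge> max 1 s" for R
    proof -
      have R1: "R \<ge> 1" "R > 0" using R by auto
      have "bint R (\<lambda>x. (u s j x) ^ 4) \<le> K * m R ^ 4 * R ^ 3"
        using bint_u4_le[OF s, of R "3 * R" j] hyp[OF R1(1), of j] R by simp
      then have "bint R (\<lambda>x. \<bar>u s j x\<bar>) \<le> M * m R * R ^ 3"
        unfolding M_def using R m[OF R1(1)]
        by (intro bint_moments(1) smooth_borel locint_smooth smooth_power smooth_u s) auto
      then have "\<bar>c\<bar> * ball_const * R ^ 3 \<le> M * m R * R ^ 3"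
        unfolding c using R1 by (simp add: bint_const mult.assoc)
      then have "\<bar>c\<bar> * ball_const \<le> M * m R" using R1 by simp
      then show ?thesis using ball_const_pos by (simp add: field_simps)
    qed
    have "((\<lambda>R. M / ball_const * m R) \<longlongrightarrow> M / ball_const * 0) at_top" by (intro tendsto_intros lim_m)
    moreover have "\<forall>\<^sub>F R in at_top. \<bar>c\<bar> \<le> M / ball_const * m R"
      using eventually_ge_at_top[of "max 1 s"] by eventually_elim (rule le)
    ultimately have "\<bar>c\<bar> \<le> 0" by (intro tendsto_lowerbound) auto
    then show ?thesis using c by simp
  qed
  have ball: "AE x in lborel. norm x \<le> real n \<longrightarrow> U j x = 0" for n
  proof -
    have m4: "(\<lambda>x. ennreal (indicator (cball 0 (real n)) x * (U j x) ^ 4)) \<in> borel_measurable lborel"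
      using locint_borel[OF L4[of j]] L4[of j] borel_measurable_integrable[OF bint_integrable[OF L4[of j], of "real n"]] by simp
    have "(\<integral>\<^sup>+x. ennreal (indicator (cball 0 (real n)) x * (U j x) ^ 4) \<partial>lborel) \<le> 0"
    proof (rule ennreal_le_epsilon)
      \<comment> \<open>Since every mollification vanishes, \<open>oscillation_bounds(2)\<close>
        bounds U^4 itself by the oscillation.\<close>
      fix \<epsilon> :: real assume "\<epsilon> > 0"
      then obtain \<delta> where \<delta>: "\<delta> > 0" "\<And>s. 0 < s \<Longrightarrow> s \<le> \<delta> \<Longrightarrow>
        (\<integral>\<^sup>+x. ennreal (indicator (cball 0 (real n)) x) * (\<integral>\<^sup>+y. ennreal (mollifier s (x - y) * (U j y - U j x) ^ 4) \<partial>lborel) \<partial>lborel) \<le> ennreal \<epsilon>"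
        using mollified_oscillation[OF meas L4] by blast
      have "(\<integral>\<^sup>+x. ennreal (indicator (cball 0 (real n)) x * (U j x) ^ 4) \<partial>lborel) \<le>
        (\<integral>\<^sup>+x. ennreal (indicator (cball 0 (real n)) x) * (\<integral>\<^sup>+y. ennreal (mollifier \<delta> (x - y) * (U j y - U j x) ^ 4) \<partial>lborel) \<partial>lborel)"
        using oscillation_bounds(2)[OF meas L4 \<delta>(1), of j] u0[OF \<delta>(1)] unfolding u_def
        by (intro nn_integral_mono) (auto simp: ennreal_mult'' intro!: mult_left_mono)
      also have "\<dots> \<le> ennreal \<epsilon>" using \<delta> by auto
      finally show "(\<integral>\<^sup>+x. ennreal (indicator (cball 0 (real n)) x * (U j x) ^ 4) \<partial>lborel) \<le> 0 + ennreal \<epsilon>" by simp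
    qed
    then have "AE x in lborel. ennreal (indicator (cball 0 (real n)) x * (U j x) ^ 4) = 0"
      using nn_integral_0_iff_AE[OF m4] by simp
    then show ?thesis
    proof eventually_elim
      case (elim x)
      then have "indicator (cball 0 (real n)) x * (U j x) ^ 4 \<le> 0" by (simp only: ennreal_eq_0_iff)
      then show ?case by (auto simp: indicator_def power_less_zero_eq_numeral dest: antisym[OF _ zero_le_even_power])
    qed
  qed
  have "AE x in lborel. \<forall>n. norm x \<le> real n \<longrightarrow> U j x = 0"
    unfolding AE_all_countable using ball by blast
  then show ?thesis by eventually_elim (metis real_arch_simple)
qed

end

subsection \<open>Lorentz spaces\<close>

lemma superlevel_sets:
  fixes f :: "R3 \<Rightarrow> R3"
  assumes "f \<in> borel_measurable lebesgue"
  shows "{x. norm (f x) > \<alpha>} \<in> sets lebesgue"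
proof -
  have "(\<lambda>x. norm (f x)) \<in> borel_measurable lebesgue"
    by (rule measurable_compose[OF assms borel_measurable_continuous_onI]) (intro continuous_intros)
  then show ?thesis unfolding borel_measurable_iff_greater by simp
qed

lemma distrib_fun_antimono: "\<alpha> \<le> \<beta> \<Longrightarrow> f \<in> borel_measurable lebesgue \<Longrightarrow> distrib_fun f \<beta> \<le> distrib_fun f \<alpha>"
  unfolding distrib_fun_def by (intro emeasure_mono superlevel_sets) auto

definition lorentz_integrand :: "real \<Rightarrow> real \<Rightarrow> (R3 \<Rightarrow> R3) \<Rightarrow> real \<Rightarrow> real" where
  "lorentz_integrand r q f \<alpha> = (\<alpha> * (enn2real (distrib_fun f \<alpha>)) powr (1/r)) powr q / \<alpha>"

text \<open>The embedding of L^(r,q) into weak L^r. The distribution function decreases, so on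
  [\<alpha>/2, \<alpha>] the integrand is at least t^q / \<alpha>, where t combines the height
  \<alpha>/2 with the distribution at \<alpha>. As the interval has length \<alpha>/2, this gives
  t^q <= 2 I; the r in the constant undoes the normalisation of the norm.\<close>

lemma lorentz_weak_type:
  assumes f: "in_lorentz r q f" and r: "r > 0" and q: "q > 0" and \<alpha>: "\<alpha> > 0"
  shows "\<alpha> * enn2real (distrib_fun f \<alpha>) powr (1/r) \<le> 2 * (2 / r) powr (1/q) * lorentz_norm r q f"
proof -
  define h where "h = lorentz_integrand r q f"
  define d where "d = enn2real (distrib_fun f \<alpha>)"
  define t where "t = (\<alpha> / 2) * d powr (1/r)"
  define I where "I = (LINT \<alpha>:{0<..}|lborel. h \<alpha>)"
  have meas: "f \<in> borel_measurable lebesgue" and fin: "\<And>\<alpha>. \<alpha> > 0 \<Longrightarrow> distrib_fun f \<alpha> < \<infinity>"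
    and int: "set_integrable lborel {0<..} h"
    using f by (auto simp: in_lorentz_def h_def lorentz_integrand_def[abs_def])
  have t0: "t \<ge> 0" using \<alpha> by (simp add: t_def)
  have h0: "h s \<ge> 0" if "s > 0" for s using that by (simp add: h_def lorentz_integrand_def)
  have low: "t powr q / \<alpha> \<le> h s" if s: "\<alpha> / 2 \<le> s" "s \<le> \<alpha>" for s
  proof -
    have s0: "s > 0" using s \<alpha> by simp
    have "d \<le> enn2real (distrib_fun f s)"
      unfolding d_def using distrib_fun_antimono[OF s(2) meas] fin[OF s0] by (intro enn2real_mono) auto
    then have "d powr (1/r) \<le> enn2real (distrib_fun f s) powr (1/r)"
      using r by (intro powr_mono2) (auto simp: d_def)
    then have "t \<le> s * enn2real (distrib_fun f s) powr (1/r)"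
      unfolding t_def using s \<alpha> by (intro mult_mono) auto
    then have "t powr q \<le> (s * enn2real (distrib_fun f s) powr (1/r)) powr q"
      using q t0 by (intro powr_mono2) auto
    then show ?thesis
      unfolding h_def lorentz_integrand_def using s s0 \<alpha> by (intro frac_le) auto
  qed
  have sub: "set_integrable lborel {\<alpha>/2..\<alpha>} h"
    by (rule set_integrable_subset[OF int]) (use \<alpha> in auto)
  have c: "set_integrable lborel {\<alpha>/2..\<alpha>} (\<lambda>s. t powr q / \<alpha>)"
    by (intro borel_integrable_atLeastAtMost') auto
  have "t powr q / 2 = (LINT s:{\<alpha>/2..\<alpha>}|lborel. t powr q / \<alpha>)"
    using \<alpha> by (simp add: set_lebesgue_integral_def)
  also have "\<dots> \<le> (LINT s:{\<alpha>/2..\<alpha>}|lborel. h s)"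
    by (intro set_integral_mono c sub low) auto
  also have "\<dots> \<le> I"
    unfolding I_def set_lebesgue_integral_def
    using int sub h0 \<alpha> by (intro integral_mono) (auto simp: set_integrable_def indicator_def)
  finally have tI: "t powr q \<le> 2 * I" by simp
  have "t = (t powr q) powr (1/q)" using t0 q by (simp add: powr_powr)
  also have "\<dots> \<le> (2 * I) powr (1/q)" using tI q by (intro powr_mono2) auto
  also have "\<dots> = (2 / r) powr (1/q) * (r powr (1/q) * I powr (1/q))"
  proof -
    have "0 \<le> 2 * I" using tI powr_ge_zero[of t q] by linarith
    then have "I \<ge> 0" by simp
    moreover have "2 * I = (2 / r) * (r * I)" using r by simp
    ultimately show ?thesis using r by (simp only: powr_mult)
  qed
  also have "r powr (1/q) * I powr (1/q) = lorentz_norm r q f"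
    unfolding lorentz_norm_def I_def h_def lorentz_integrand_def ..
  finally show ?thesis unfolding t_def d_def by simp
qed

text \<open>Layers at the heights 2^k m: the k-th superlevel set has measure at most V 2^(-rk), so
  the layers contribute a geometric series of ratio 2^(4-r), convergent for r > 4. The level m is
  high enough for the weak-type bound to be at most V there, and below it the trivial bound m^4 V
  suffices. The 16 is the price of bounding a layer by its upper height.\<close>

lemma lorentz_L4:
  assumes f: "f \<in> borel_measurable lebesgue" and A: "A \<in> sets lebesgue" "emeasure lebesgue A \<le> ennreal V" "\<And>x. x \<notin> A \<Longrightarrow> f x = 0"
    and fin: "\<And>\<alpha>. \<alpha> > 0 \<Longrightarrow> distrib_fun f \<alpha> < \<infinity>"
    and weak: "\<And>\<alpha>. \<alpha> > 0 \<Longrightarrow> \<alpha> * enn2real (distrib_fun f \<alpha>) powr (1/r) \<le> N"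
    and r: "r > 4" and m: "m > 0" and V: "V \<ge> 0" and N: "N powr r \<le> V * m powr r"
  shows "(\<integral>\<^sup>+x. ennreal (norm (f x) ^ 4) \<partial>lebesgue) \<le> ennreal ((1 + 16 / (1 - 2 powr (4 - r))) * (m ^ 4 * V))"
proof -
  define b where "b = 2 powr (4 - r)"
  have "b < 2 powr 0" unfolding b_def using r by (intro powr_less_mono) auto
  then have b: "0 < b" "b < 1" by (auto simp: b_def)
  define S where "S k = {x. norm (f x) > 2 ^ k * m}" for k :: nat
  have Sm: "S k \<in> sets lebesgue" for k
    unfolding S_def by (rule superlevel_sets[OF f])
  have eS: "emeasure lebesgue (S k) \<le> ennreal (V / 2 powr (r * real k))" for k
  proof -
    define \<alpha> where "\<alpha> = 2 ^ k * m"
    have \<alpha>: "\<alpha> > 0" using m by (simp add: \<alpha>_def)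
    define d where "d = enn2real (distrib_fun f \<alpha>)"
    have d0: "d \<ge> 0" by (simp add: d_def)
    have "d powr (1/r) \<le> N / \<alpha>" using weak[OF \<alpha>] \<alpha> by (simp add: d_def field_simps)
    then have "(d powr (1/r)) powr r \<le> (N / \<alpha>) powr r" using r by (intro powr_mono2) auto
    then have "d \<le> (N / \<alpha>) powr r" using r d0 by (simp add: powr_powr)
    also have "\<dots> = N powr r / (2 powr (r * real k) * m powr r)"
    proof -
      have "N \<ge> 0" using weak[OF \<alpha>] \<alpha> by (meson mult_nonneg_nonneg order_trans less_imp_le powr_ge_zero)
      moreover have "\<alpha> powr r = 2 powr (r * real k) * m powr r"
      proof -
        have p: "(2::real) ^ k = 2 powr real k" by (simp add: powr_realpow)
        have "\<alpha> powr r = (2 powr real k) powr r * m powr r" using m unfolding \<alpha>_def p by (intro powr_mult) 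
        also have "(2 powr real k) powr r = 2 powr (real k * r)" by (rule powr_powr)
        finally show ?thesis by (simp only: mult.commute)
      qed
      ultimately show ?thesis using \<alpha> by (simp add: powr_divide)
    qed
    also have "\<dots> \<le> V * m powr r / (2 powr (r * real k) * m powr r)"
      using N m by (intro divide_right_mono) auto
    also have "\<dots> = V / 2 powr (r * real k)" using m by simp
    finally have "d \<le> V / 2 powr (r * real k)" .
    moreover have "emeasure lebesgue (S k) = ennreal d"
      unfolding d_def S_def \<alpha>_def[symmetric] distrib_fun_def[symmetric] using fin[OF \<alpha>] by simp
    ultimately show ?thesis by (simp add: ennreal_leI)
  qed
  have pt: "ennreal (norm (f x) ^ 4) \<le> ennreal (m ^ 4) * indicator A x + (\<Sum>k. ennreal ((2 ^ Suc k * m) ^ 4) * indicator (S k) x)" for x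
  proof (cases "norm (f x) \<le> m")
    case True
    show ?thesis
    proof (cases "x \<in> A")
      case xA: True
      have "ennreal (norm (f x) ^ 4) \<le> ennreal (m ^ 4)" using True by (intro ennreal_leI power_mono) auto
      also have "\<dots> \<le> ennreal (m ^ 4) * indicator A x + (\<Sum>k. ennreal ((2 ^ Suc k * m) ^ 4) * indicator (S k) x)"
        using xA by simp
      finally show ?thesis .
    qed (use A(3) in simp)
  next
    case False
    \<comment> \<open>With k minimal such that |f(x)| <= 2^k m, the point lies in the superlevel set
      one index lower; k is positive because |f(x)| > m.\<close>
    define P where "P k \<longleftrightarrow> norm (f x) \<le> 2 ^ k * m" for k :: nat
    obtain n where "norm (f x) / m < 2 ^ n" using real_arch_pow[of 2 "norm (f x) / m"] by auto
    then have "P n" using m by (simp add: P_def field_simps)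
    define k where "k = (LEAST k. P k)"
    have Pk: "P k" unfolding k_def using \<open>P n\<close> by (rule LeastI)
    have "k \<noteq> 0"
    proof
      assume "k = 0"
      with Pk False show False by (simp add: P_def)
    qed
    then obtain j where j: "k = Suc j" using not0_implies_Suc by blast
    have "\<not> P j" using not_less_Least[of j P] j by (simp add: k_def)
    then have xS: "x \<in> S j" by (simp add: P_def S_def)
    have "ennreal (norm (f x) ^ 4) \<le> ennreal ((2 ^ Suc j * m) ^ 4)"
      using Pk by (intro ennreal_leI power_mono) (auto simp: P_def j)
    also have "\<dots> = (\<Sum>k\<in>{j}. ennreal ((2 ^ Suc k * m) ^ 4) * indicator (S k) x)" using xS by simp
    also have "\<dots> \<le> (\<Sum>k. ennreal ((2 ^ Suc k * m) ^ 4) * indicator (S k) x)" by (intro sum_le_suminf) auto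
    also have "\<dots> \<le> ennreal (m ^ 4) * indicator A x + \<dots>" by simp
    finally show ?thesis .
  qed
  have t: "(2 ^ Suc k * m) ^ 4 * (V / 2 powr (r * real k)) = 16 * m ^ 4 * V * b ^ k" for k
  proof -
    have "b ^ k = b powr real k" using b by (simp add: powr_realpow)
    also have "\<dots> = 2 powr ((4 - r) * real k)" unfolding b_def by (rule powr_powr)
    also have "\<dots> = 2 powr (4 * real k) / 2 powr (r * real k)" by (simp add: left_diff_distrib powr_diff)
    also have "2 powr (4 * real k) = 2 powr real (k * 4)" by (simp add: mult.commute)
    also have "\<dots> = (2 ^ k) ^ 4" by (subst powr_realpow) (auto simp: power_mult)
    finally show ?thesis by (simp add: power_mult_distrib)
  qed
  have "(\<integral>\<^sup>+x. ennreal (norm (f x) ^ 4) \<partial>lebesgue) \<le>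
      (\<integral>\<^sup>+x. ennreal (m ^ 4) * indicator A x + (\<Sum>k. ennreal ((2 ^ Suc k * m) ^ 4) * indicator (S k) x) \<partial>lebesgue)"
    by (intro nn_integral_mono pt)
  also have "\<dots> = ennreal (m ^ 4) * emeasure lebesgue A + (\<Sum>k. ennreal ((2 ^ Suc k * m) ^ 4) * emeasure lebesgue (S k))"
    using A(1) Sm by (subst nn_integral_add) (auto simp: nn_integral_suminf nn_integral_cmult_indicator)
  also have "\<dots> \<le> ennreal (m ^ 4) * ennreal V + (\<Sum>k. ennreal (16 * m ^ 4 * V * b ^ k))"
  proof (intro add_mono mult_left_mono A(2) suminf_le)
    fix k
    have "ennreal ((2 ^ Suc k * m) ^ 4) * emeasure lebesgue (S k) \<le> ennreal ((2 ^ Suc k * m) ^ 4) * ennreal (V / 2 powr (r * real k))"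
      by (intro mult_left_mono eS) auto
    also have "\<dots> = ennreal (16 * m ^ 4 * V * b ^ k)" unfolding t[symmetric] using V m by (subst ennreal_mult) auto
    finally show "ennreal ((2 ^ Suc k * m) ^ 4) * emeasure lebesgue (S k) \<le> ennreal (16 * m ^ 4 * V * b ^ k)" .
  qed auto
  also have "(\<Sum>k. ennreal (16 * m ^ 4 * V * b ^ k)) = ennreal (16 * m ^ 4 * V * (1 / (1 - b)))"
  proof (rule suminf_ennreal_eq)
    show "(\<lambda>k. 16 * m ^ 4 * V * b ^ k) sums (16 * m ^ 4 * V * (1 / (1 - b)))"
      using b by (intro sums_mult geometric_sums) auto
  qed (use V m b in auto)
  also have "ennreal (m ^ 4) * ennreal V + ennreal (16 * m ^ 4 * V * (1 / (1 - b))) = ennreal ((1 + 16 / (1 - b)) * (m ^ 4 * V))"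
    using V m b by (simp add: algebra_simps flip: ennreal_mult ennreal_plus)
  finally show ?thesis unfolding b_def .
qed

section \<open>Fourth moments of a Lorentz function on sets of finite measure\<close>

definition ball_mass :: "(R3 \<Rightarrow> R3) \<Rightarrow> real \<Rightarrow> ennreal" where
  "ball_mass U \<rho> = (\<integral>\<^sup>+x. ennreal (norm (U x) ^ 4) * indicator (cball 0 \<rho>) x \<partial>lebesgue)"

lemma restrict_to_lebesgue:
  assumes "f \<in> borel_measurable lebesgue" "A \<in> sets lebesgue"
  shows "restrict_to A f \<in> borel_measurable lebesgue"
  unfolding restrict_to_def using assms by (intro measurable_If_set) auto

lemma nn_integral_restrict_to:
  "(\<integral>\<^sup>+x. ennreal (norm (restrict_to A U x) ^ 4) \<partial>lebesgue) = (\<integral>\<^sup>+x. ennreal (norm (U x) ^ 4) * indicator A x \<partial>lebesgue)"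
  by (intro nn_integral_cong) (auto simp: restrict_to_def)

lemma distrib_fun_restrict_to:
  assumes "f \<in> borel_measurable lebesgue" "\<alpha> > 0"
  shows "distrib_fun (restrict_to A f) \<alpha> \<le> distrib_fun f \<alpha>"
  unfolding distrib_fun_def using assms
  by (intro emeasure_mono superlevel_sets) (auto simp: restrict_to_def split: if_splits)

text \<open>Membership must be settled before the norm of the restricted function is used: a Bochner
  integral that does not exist has the value 0, and a bound on \<open>lorentz_norm\<close> would
  then say nothing. Measurability comes from monotonicity of the distribution function,
  integrability from comparison with that of \<open>f\<close>.\<close>

lemma in_lorentz_restrict_to:
  assumes f: "in_lorentz r q f" and A: "A \<in> sets lebesgue" and r: "r > 0" and q: "q > 0"
  shows "in_lorentz r q (restrict_to A f)"
proof -
  let ?g = "restrict_to A f"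
  have meas: "f \<in> borel_measurable lebesgue" and fin: "\<And>\<alpha>. \<alpha> > 0 \<Longrightarrow> distrib_fun f \<alpha> < \<infinity>"
    and int: "set_integrable lborel {0<..} (lorentz_integrand r q f)"
    using f by (auto simp: in_lorentz_def lorentz_integrand_def[abs_def])
  have mg: "?g \<in> borel_measurable lebesgue" by (rule restrict_to_lebesgue[OF meas A])
  have fing: "distrib_fun ?g \<alpha> < \<infinity>" if "\<alpha> > 0" for \<alpha>
    using distrib_fun_restrict_to[OF meas that] fin[OF that] by (rule le_less_trans)
  \<comment> \<open>For negative \<alpha> the distribution function is infinite and
    \<open>enn2real\<close> maps it to 0, which spoils monotonicity; hence the cut-off to positive
    \<alpha>.\<close>
  define h where "h \<alpha> = indicator {0<..} \<alpha> * enn2real (distrib_fun ?g \<alpha>)" for \<alpha> :: real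
  have [measurable]: "h \<in> borel_measurable borel"
  proof -
    have "mono_on {0<..} (\<lambda>\<alpha>. - enn2real (distrib_fun ?g \<alpha>))"
      using distrib_fun_antimono[OF _ mg] fing by (intro mono_onI) (auto intro!: enn2real_mono)
    then have "(\<lambda>\<alpha>. - enn2real (distrib_fun ?g \<alpha>)) \<in> borel_measurable (restrict_space borel {0<..})"
      by (rule borel_measurable_mono_on_fnc)
    then have "(\<lambda>\<alpha>. - (- enn2real (distrib_fun ?g \<alpha>))) \<in> borel_measurable (restrict_space borel {0<..})"
      by (rule borel_measurable_uminus)
    then show ?thesis by (subst (asm) borel_measurable_restrict_space_iff) (auto simp: mult.commute h_def[abs_def])
  qed
  have "(\<lambda>\<alpha>. indicator {0<..} \<alpha> * ((\<alpha> * h \<alpha> powr (1/r)) powr q / \<alpha>)) \<in> borel_measurable borel"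
    by measurable
  moreover have "(\<lambda>\<alpha>. indicator {0<..} \<alpha> * ((\<alpha> * h \<alpha> powr (1/r)) powr q / \<alpha>)) =
     (\<lambda>\<alpha>. indicator {0<..} \<alpha> * lorentz_integrand r q ?g \<alpha>)"
    by (auto simp: lorentz_integrand_def indicator_def h_def)
  ultimately have m: "(\<lambda>\<alpha>. indicator {0<..} \<alpha> * lorentz_integrand r q ?g \<alpha>) \<in> borel_measurable borel" by (simp only:)
  have "set_integrable lborel {0<..} (lorentz_integrand r q ?g)"
    unfolding set_integrable_def
  proof (rule Bochner_Integration.integrable_bound[OF int[unfolded set_integrable_def]])
    show "(\<lambda>\<alpha>. indicator {0<..} \<alpha> *\<^sub>R lorentz_integrand r q ?g \<alpha>) \<in> borel_measurable lborel" using m by simp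
    have "lorentz_integrand r q ?g \<alpha> \<le> lorentz_integrand r q f \<alpha>" if a: "\<alpha> > 0" for \<alpha>
    proof -
      have "enn2real (distrib_fun ?g \<alpha>) \<le> enn2real (distrib_fun f \<alpha>)"
        using distrib_fun_restrict_to[OF meas a] fin[OF a] by (intro enn2real_mono) auto
      then show ?thesis unfolding lorentz_integrand_def
        using a r q by (intro divide_right_mono powr_mono2 mult_left_mono) auto
    qed
    moreover have "0 \<le> lorentz_integrand r q ?g \<alpha>" if "\<alpha> > 0" for \<alpha> using that by (simp add: lorentz_integrand_def)
    ultimately show "AE \<alpha> in lborel. norm (indicator {0<..} \<alpha> *\<^sub>R lorentz_integrand r q ?g \<alpha>) \<le> norm (indicator {0<..} \<alpha> *\<^sub>R lorentz_integrand r q f \<alpha>)"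
      by (intro AE_I2) (auto simp: indicator_def intro: order_trans[OF _ abs_ge_self])
  qed
  then show ?thesis unfolding in_lorentz_def
    using mg fing by (simp add: lorentz_integrand_def[abs_def])
qed

lemma lorentz_L4_restrict:
  assumes f: "in_lorentz r q f" and r: "r > 4" and q: "q > 0" and A: "A \<in> sets lebesgue" "emeasure lebesgue A \<le> ennreal V"
    and V: "V > 0" and N: "lorentz_norm r q (restrict_to A f) \<le> N" "N > 0" 
  shows "(\<integral>\<^sup>+x. ennreal (norm (f x) ^ 4) * indicator A x \<partial>lebesgue) \<le>
    ennreal ((1 + 16 / (1 - 2 powr (4 - r))) * ((2 * (2 / r) powr (1/q) * N) ^ 4 * V powr (1 - 4 / r)))"
proof -
  define N' where "N' = 2 * (2 / r) powr (1/q) * N"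
  have r0: "r > 0" using r by simp
  have N': "N' > 0" using N r0 by (simp add: N'_def)
  \<comment> \<open>This choice gives V m^r = N'^r, the equality case of the level condition in
    \<open>lorentz_L4\<close>.\<close>
  define m where "m = N' * V powr (- 1 / r)"
  have m: "m > 0" using N' V by (simp add: m_def)
  have g: "in_lorentz r q (restrict_to A f)" by (rule in_lorentz_restrict_to[OF f A(1) r0 q])
  have w: "\<alpha> * enn2real (distrib_fun (restrict_to A f) \<alpha>) powr (1/r) \<le> N'" if "\<alpha> > 0" for \<alpha>
  proof -
    have "2 * (2 / r) powr (1/q) * lorentz_norm r q (restrict_to A f) \<le> N'"
      unfolding N'_def using N by (intro mult_left_mono) auto
    then show ?thesis using lorentz_weak_type[OF g r0 q that] by linarith
  qed
  have "m powr r = N' powr r * V powr (- 1)"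
    using N' V r0 by (simp add: m_def powr_mult powr_powr)
  then have "N' powr r \<le> V * m powr r" using V by (simp add: powr_minus field_simps)
  moreover have "restrict_to A f \<in> borel_measurable lebesgue" "\<And>\<alpha>. \<alpha> > 0 \<Longrightarrow> distrib_fun (restrict_to A f) \<alpha> < \<infinity>"
    using g by (auto simp: in_lorentz_def)
  ultimately have "(\<integral>\<^sup>+x. ennreal (norm (restrict_to A f x) ^ 4) \<partial>lebesgue) \<le> ennreal ((1 + 16 / (1 - 2 powr (4 - r))) * (m ^ 4 * V))"
    using V m by (intro lorentz_L4[OF _ A _ _ w r m]) (auto simp: restrict_to_def)
  moreover have "m ^ 4 * V = N' ^ 4 * V powr (1 - 4 / r)"
  proof -
    have "m ^ 4 = N' ^ 4 * (V powr (- 1 / r)) powr 4"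
      using V by (simp add: m_def power_mult_distrib powr_numeral)
    also have "(V powr (- 1 / r)) powr 4 = V powr (- 4 / r)" by (simp add: powr_powr)
    finally have "m ^ 4 * V = N' ^ 4 * (V powr (- 4 / r) * V powr 1)" using V by simp
    also have "V powr (- 4 / r) * V powr 1 = V powr (1 - 4 / r)"
      by (simp only: powr_add[symmetric]) (simp add: algebra_simps)
    finally show ?thesis .
  qed
  ultimately show ?thesis unfolding nn_integral_restrict_to N'_def by simp
qed

subsection \<open>The main theorem\<close>

lemma annulus_lebesgue: "annulus a b \<in> sets lebesgue"
proof -
  have "annulus a b = cball 0 b - ball 0 a" by (auto simp: annulus_def)
  then show ?thesis by simp
qed

lemma ball_mass_mono: "r \<le> s \<Longrightarrow> ball_mass U r \<le> ball_mass U s"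
  unfolding ball_mass_def by (intro nn_integral_mono mult_left_mono) (auto simp: indicator_def)

lemma ball_mass_step:
  assumes "U \<in> borel_measurable lebesgue"
  shows "ball_mass U b \<le> ball_mass U a + (\<integral>\<^sup>+x. ennreal (norm (U x) ^ 4) * indicator (annulus a b) x \<partial>lebesgue)"
proof -
  have m: "(\<lambda>x. ennreal (norm (U x) ^ 4)) \<in> borel_measurable lebesgue"
    by (rule measurable_compose[OF assms], rule measurable_compose[OF _ measurable_ennreal],
        rule borel_measurable_continuous_onI) (intro continuous_intros)
  have "ball_mass U b \<le> (\<integral>\<^sup>+x. ennreal (norm (U x) ^ 4) * indicator (cball 0 a) x + ennreal (norm (U x) ^ 4) * indicator (annulus a b) x \<partial>lebesgue)"
    unfolding ball_mass_def by (intro nn_integral_mono) (auto simp: indicator_def annulus_def)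
  also have "\<dots> = ball_mass U a + (\<integral>\<^sup>+x. ennreal (norm (U x) ^ 4) * indicator (annulus a b) x \<partial>lebesgue)"
    unfolding ball_mass_def using m annulus_lebesgue
    by (intro nn_integral_add borel_measurable_times_ennreal borel_measurable_indicator) auto
  finally show ?thesis .
qed

lemma emeasure_lebesgue_cball: "\<rho> \<ge> 0 \<Longrightarrow> emeasure lebesgue (cball (0::R3) \<rho>) = ennreal (ball_const * \<rho> ^ 3)"
  using emeasure_cball[of \<rho> "0::R3"] by (simp add: ball_const_def)

text \<open>Counting powers of R: the norm bound contributes 4 (9/r - 2) and the volume R^3
  contributes 3 (1 - 4/r), in total 24/r - 5.\<close>

lemma annulus_L4:
  assumes f: "in_lorentz r q U" and r: "r > 4" and q: "q > 0"
    and B: "\<And>R. R > 1 \<Longrightarrow> R powr (2 - 9/r) * lorentz_norm r q (restrict_to (annulus (R/4) (2*R)) U) \<le> B"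
  obtains C where "C \<ge> 0" "\<And>R. R > 1 \<Longrightarrow>
    (\<integral>\<^sup>+x. ennreal (norm (U x) ^ 4) * indicator (annulus (R/4) (2*R)) x \<partial>lebesgue) \<le> ennreal (C * R powr (24 / r - 5))"
proof -
  \<comment> \<open>The bound is made positive, since it determines the level m of the layers, which
    must not be 0.\<close>
  define b where "b = max B 1"
  define C0 where "C0 = 1 + 16 / (1 - 2 powr (4 - r))"
  define c where "c = 2 * (2 / r) powr (1/q)"
  define C where "C = C0 * ((c * b) ^ 4 * (8 * ball_const) powr (1 - 4 / r))"
  have "(2::real) powr (4 - r) < 2 powr 0" using r by (intro powr_less_mono) auto
  then have C0: "C0 \<ge> 0" by (simp add: C0_def)
  show ?thesis
  proof (rule that[of C])
    show "C \<ge> 0" unfolding C_def using C0 by (intro mult_nonneg_nonneg) auto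
    fix R :: real assume R: "R > 1"
    define V where "V = 8 * ball_const * R powr 3"
    define N where "N = b * R powr (9 / r - 2)"
    have V: "V > 0" using ball_const_pos R by (simp add: V_def)
    have N: "N > 0" using R by (simp add: N_def b_def)
    have "lorentz_norm r q (restrict_to (annulus (R/4) (2*R)) U) = R powr (9 / r - 2) * (R powr (2 - 9/r) * lorentz_norm r q (restrict_to (annulus (R/4) (2*R)) U))"
      using R by (simp add: mult.assoc[symmetric] flip: powr_add)
    also have "\<dots> \<le> R powr (9 / r - 2) * b"
      using B[OF R] by (intro mult_left_mono) (auto simp: b_def)
    finally have LN: "lorentz_norm r q (restrict_to (annulus (R/4) (2*R)) U) \<le> N" by (simp add: N_def mult.commute)
    have "emeasure lebesgue (annulus (R/4) (2*R)) \<le> emeasure lebesgue (cball (0::R3) (2 * R))"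
      by (intro emeasure_mono) (auto simp: annulus_def)
    also have "\<dots> = ennreal V" using emeasure_lebesgue_cball[of "2 * R"] R
      by (simp add: V_def power_mult_distrib powr_numeral mult_ac)
    finally have "(\<integral>\<^sup>+x. ennreal (norm (U x) ^ 4) * indicator (annulus (R/4) (2*R)) x \<partial>lebesgue) \<le> ennreal (C0 * ((c * N) ^ 4 * V powr (1 - 4 / r)))"
      unfolding C0_def c_def by (intro lorentz_L4_restrict[OF f r q annulus_lebesgue _ V LN N])
    also have "C0 * ((c * N) ^ 4 * V powr (1 - 4 / r)) = C * R powr (24 / r - 5)"
    proof -
      have "(R powr (9 / r - 2)) ^ 4 = (R powr (9 / r - 2)) powr 4" using R by (simp add: powr_numeral)
      also have "\<dots> = R powr (36 / r - 8)" by (simp add: powr_powr algebra_simps)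
      finally have 1: "N ^ 4 = b ^ 4 * R powr (36 / r - 8)" by (simp add: N_def power_mult_distrib)
      have "(R powr 3) powr (1 - 4 / r) = R powr (3 - 12 / r)" by (simp only: powr_powr) (simp add: algebra_simps)
      then have 2: "V powr (1 - 4 / r) = (8 * ball_const) powr (1 - 4 / r) * R powr (3 - 12 / r)"
        using ball_const_pos R unfolding V_def by (simp only: powr_mult)
      have 3: "R powr (36 / r - 8) * R powr (3 - 12 / r) = R powr (24 / r - 5)"
        by (simp only: powr_add[symmetric]) (simp add: algebra_simps flip: diff_divide_distrib)
      show ?thesis unfolding C_def power_mult_distrib 1 2 3[symmetric] by simp
    qed
    finally show "(\<integral>\<^sup>+x. ennreal (norm (U x) ^ 4) * indicator (annulus (R/4) (2*R)) x \<partial>lebesgue) \<le> ennreal (C * R powr (24 / r - 5))" .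
  qed
qed

text \<open>The step with R = \<rho>/2 passes from \<rho> to \<rho>/8, and the added terms decay
  geometrically because \<gamma> > 0. Any D with D a + C <= D for a = 8^(-\<gamma>) reproduces
  itself, and D must also cover the initial value at 8.\<close>

lemma dyadic_growth:
  fixes G :: "real \<Rightarrow> ennreal"
  assumes mono: "\<And>r s. r \<le> s \<Longrightarrow> G r \<le> G s" and fin: "G 8 < \<infinity>" and \<gamma>: "\<gamma> > 0" and C: "C \<ge> 0"
    and step: "\<And>R. R > 1 \<Longrightarrow> G (2 * R) \<le> G (R / 4) + ennreal (C * R powr \<gamma>)"
  obtains D where "D \<ge> 0" "\<And>\<rho>. \<rho> \<ge> 1 \<Longrightarrow> G \<rho> \<le> ennreal (D * \<rho> powr \<gamma>)"
proof -
  define a where "a = 8 powr (- \<gamma>)"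
  have "a < 8 powr 0" unfolding a_def using \<gamma> by (intro powr_less_mono) auto
  then have a: "0 < a" "a < 1" by (auto simp: a_def)
  define D where "D = max (enn2real (G 8)) (C / (1 - a))"
  have D0: "D \<ge> 0" by (simp add: D_def le_max_iff_disj)
  have "C / (1 - a) \<le> D" by (simp add: D_def)
  then have DC: "D * a + C \<le> D" using a by (simp add: field_simps)
  have main: "G \<rho> \<le> ennreal (D * \<rho> powr \<gamma>)" if "1 \<le> \<rho>" "\<rho> \<le> 8 ^ Suc n" for n \<rho>
    using that
  proof (induction n arbitrary: \<rho>)
    case 0
    have "G \<rho> \<le> G 8" using 0 by (intro mono) auto
    also have "\<dots> = ennreal (enn2real (G 8))" using fin by simp
    also have "\<dots> \<le> ennreal (D * \<rho> powr \<gamma>)"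
    proof (rule ennreal_leI)
      have "enn2real (G 8) * 1 \<le> D * \<rho> powr \<gamma>"
        using 0 \<gamma> D0 by (intro mult_mono ge_one_powr_ge_zero) (auto simp: D_def)
      then show "enn2real (G 8) \<le> D * \<rho> powr \<gamma>" by simp
    qed
    finally show ?case .
  next
    case (Suc n)
    show ?case
    \<comment> \<open>The recursion is entered only for \<rho> > 8, so that \<rho>/8 is again at
      least 1.\<close>
    proof (cases "\<rho> \<le> 8")
      case True
      then have "1 \<le> \<rho>" "\<rho> \<le> 8 ^ Suc n" using Suc.prems by (auto intro: order_trans[of _ 8])
      then show ?thesis by (rule Suc.IH)
    next
      case False
      have "G \<rho> = G (2 * (\<rho> / 2))" by simp
      also have "\<dots> \<le> G (\<rho> / 2 / 4) + ennreal (C * (\<rho> / 2) powr \<gamma>)" using False by (intro step) auto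
      also have "\<dots> = G (\<rho> / 8) + ennreal (C * (\<rho> / 2) powr \<gamma>)" by simp
      also have "\<dots> \<le> ennreal (D * (\<rho> / 8) powr \<gamma>) + ennreal (C * \<rho> powr \<gamma>)"
        using False Suc.prems \<gamma> C
        by (intro add_mono Suc.IH ennreal_leI mult_left_mono powr_mono2) auto
      also have "\<dots> = ennreal ((D * a + C) * \<rho> powr \<gamma>)"
      proof -
        have "(\<rho> / 8) powr \<gamma> = a * \<rho> powr \<gamma>" using False by (simp add: a_def powr_divide powr_minus field_simps)
        then show ?thesis using D0 C a by (simp add: distrib_right mult.assoc flip: ennreal_plus)
      qed
      also have "\<dots> \<le> ennreal (D * \<rho> powr \<gamma>)" using DC by (intro ennreal_leI mult_right_mono) auto
      finally show ?thesis .
    qed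
  qed
  show ?thesis
  proof (rule that[OF D0])
    fix \<rho> :: real assume "\<rho> \<ge> 1"
    obtain n where "\<rho> < 8 ^ n" using real_arch_pow[of 8 \<rho>] by auto
    also have "(8::real) ^ n \<le> 8 ^ Suc n" by simp
    finally show "G \<rho> \<le> ennreal (D * \<rho> powr \<gamma>)" using main[of \<rho> n] \<open>\<rho> \<ge> 1\<close> by simp
  qed
qed

lemma ball_mass_growth:
  assumes f: "in_lorentz r q U" and r: "r > 9/2" and q: "q > 0"
    and B: "\<And>R. R > 1 \<Longrightarrow> R powr (2 - 9/r) * lorentz_norm r q (restrict_to (annulus (R/4) (2*R)) U) \<le> B"
  obtains D \<gamma> where "D \<ge> 0" "0 < \<gamma>" "\<gamma> < 1/3" "\<And>\<rho>. \<rho> \<ge> 1 \<Longrightarrow> ball_mass U \<rho> \<le> ennreal (D * \<rho> powr \<gamma>)"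
proof -
  have r4: "r > 4" using r by simp
  have meas: "U \<in> borel_measurable lebesgue" using f by (simp add: in_lorentz_def)
  obtain C where C: "C \<ge> 0" "\<And>R. R > 1 \<Longrightarrow>
    (\<integral>\<^sup>+x. ennreal (norm (U x) ^ 4) * indicator (annulus (R/4) (2*R)) x \<partial>lebesgue) \<le> ennreal (C * R powr (24 / r - 5))"
    using annulus_L4[OF f r4 q B] by blast
  \<comment> \<open>For large r the exponent 24/r - 5 is not positive, whereas
    \<open>dyadic_growth\<close> needs \<gamma> > 0; 1/6 is an arbitrary number in (0, 1/3).\<close>
  define \<gamma> where "\<gamma> = max (24 / r - 5) (1/6)"
  have "24 / r < 16 / 3" using r by (simp add: field_simps)
  then have "24 / r - 5 < 1 / 3" by linarith
  then have \<gamma>: "0 < \<gamma>" "\<gamma> < 1/3" "24 / r - 5 \<le> \<gamma>"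
    unfolding \<gamma>_def max_less_iff_conj less_max_iff_disj by simp_all
  \<comment> \<open>The start of the recursion comes from membership of U in the Lorentz space on
    all of space. Adding 1 to the norm makes the bound positive.\<close>
  have fin: "ball_mass U 8 < \<infinity>"
  proof -
    have "ball_mass U 8 \<le> ennreal ((1 + 16 / (1 - 2 powr (4 - r))) * ((2 * (2 / r) powr (1/q) * (\<bar>lorentz_norm r q (restrict_to (cball 0 8) U)\<bar> + 1)) ^ 4 * (ball_const * 8 ^ 3) powr (1 - 4 / r)))"
      unfolding ball_mass_def
      by (intro lorentz_L4_restrict[OF f r4 q]) (use ball_const_pos emeasure_lebesgue_cball[of 8] in auto)
    also have "\<dots> < \<infinity>" by simp
    finally show ?thesis .
  qed
  have st: "ball_mass U (2 * R) \<le> ball_mass U (R / 4) + ennreal (C * R powr \<gamma>)" if R: "R > 1" for R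
  proof -
    have "ball_mass U (2 * R) \<le> ball_mass U (R / 4) + (\<integral>\<^sup>+x. ennreal (norm (U x) ^ 4) * indicator (annulus (R/4) (2*R)) x \<partial>lebesgue)"
      by (rule ball_mass_step[OF meas])
    also have "\<dots> \<le> ball_mass U (R / 4) + ennreal (C * R powr (24 / r - 5))" by (intro add_left_mono C R)
    also have "\<dots> \<le> ball_mass U (R / 4) + ennreal (C * R powr \<gamma>)"
      using R C(1) \<gamma>(3) by (intro add_left_mono ennreal_leI mult_left_mono powr_mono) auto
    finally show ?thesis .
  qed
  obtain D where "D \<ge> 0" "\<And>\<rho>. \<rho> \<ge> 1 \<Longrightarrow> ball_mass U \<rho> \<le> ennreal (D * \<rho> powr \<gamma>)"
    using dyadic_growth[OF ball_mass_mono fin \<gamma>(1) C(1) st] by blast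
  with \<gamma> show ?thesis using that by blast
qed

section \<open>From the weak formulation for Lebesgue measurable fields to
  \<open>weak_flow\<close>\<close>

lemma integral_lebesgue_eq:
  fixes f g :: "R3 \<Rightarrow> real"
  assumes "f \<in> borel_measurable lebesgue" "g \<in> borel_measurable borel" "AE x in lborel. f x = g x"
  shows "(LINT x|lebesgue. f x) = (LINT x|lborel. g x)"
proof -
  have g: "g \<in> borel_measurable lborel" using assms(2) by simp
  have "(LINT x|lebesgue. f x) = (LINT x|lebesgue. g x)"
    using assms(1) measurable_completion[OF g] AE_completion[OF assms(3)] by (rule integral_cong_AE)
  also have "\<dots> = (LINT x|lborel. g x)" by (rule integral_completion[OF g])
  finally show ?thesis .
qed

text \<open>With f_j = \<partial>_j \<Phi>_j this is the disappearance of the pressure against a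
  divergence free field. Linearity is given for two test functions at a time, and the value at 0
  comes from two zero coefficients.\<close>

lemma distribution_sum_zero:
  assumes P: "distribution P" and t: "\<And>j. tf s (f j)" and z: "\<And>x. (\<Sum>j\<in>(UNIV::3 set). f j x) = 0"
  shows "(\<Sum>j\<in>UNIV. P (f j)) = 0"
proof -
  have lin: "P (\<lambda>x. a * \<phi> x + b * \<psi> x) = a * P \<phi> + b * P \<psi>" if "tf s \<phi>" "tf s \<psi>" for a b \<phi> \<psi>
    using P tf_test_fun[OF that(1)] tf_test_fun[OF that(2)] unfolding distribution_def by blast
  have "P (\<lambda>x. 0 * f 1 x + 0 * f 1 x) = 0 * P (f 1) + 0 * P (f 1)" by (rule lin[OF t t])
  then have P0: "P (\<lambda>x. 0) = 0" by simp
  have t23: "tf s (\<lambda>x. f 2 x + f 3 x)" by (intro tf_add t)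
  have "P (\<lambda>x. 1 * f 1 x + 1 * (f 2 x + f 3 x)) = 1 * P (f 1) + 1 * P (\<lambda>x. f 2 x + f 3 x)"
    by (rule lin[OF t t23])
  moreover have "P (\<lambda>x. 1 * f 2 x + 1 * f 3 x) = 1 * P (f 2) + 1 * P (f 3)" by (rule lin[OF t t])
  moreover have "(\<lambda>x. 1 * f 1 x + 1 * (f 2 x + f 3 x)) = (\<lambda>x. 0)"
    using z by (auto simp: sum_3 add.assoc)
  ultimately show ?thesis using P0 by (simp add: sum_3)
qed

text \<open>The componentwise equations are summed, so that the pressure terms combine to the
  pairing with div \<Phi>. Passing to functions equal almost everywhere changes none of the
  integrals.\<close>

lemma weak_flow_borel_version:
  assumes w: "weak_NS_solution U P" and V: "\<And>j. V j \<in> borel_measurable borel"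
    and ae: "\<And>j. AE x in lborel. U x $ j = V j x" and L4: "\<And>j. locint (\<lambda>x. (V j x) ^ 4)"
  shows "weak_flow V"
proof
  have Um: "U \<in> borel_measurable lebesgue" using w by (simp add: weak_NS_solution_def L2_loc_def)
  have Uj: "(\<lambda>x. U x $ j) \<in> borel_measurable lebesgue" for j
    by (rule measurable_compose[OF Um borel_measurable_continuous_onI]) (intro continuous_intros)
  have bl: "f \<in> borel_measurable lebesgue" if "f \<in> borel_measurable borel" for f :: "R3 \<Rightarrow> real"
    using that by (intro measurable_completion) simp
  fix s
  show "(\<Sum>i\<in>UNIV. \<integral>x. V i x * pd i \<psi> x \<partial>lborel) = 0" if t: "tf s \<psi>" for \<psi>
  proof -
    have b: "pd i \<psi> \<in> borel_measurable borel" for i by (intro smooth_borel smooth_pd tf_smooth[OF t])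
    have "AE x in lborel. \<forall>j. U x $ j = V j x" by (rule eventually_all_finite[OF ae])
    then have "AE x in lborel. (\<Sum>i\<in>UNIV. U x $ i * dpart [i] \<psi> x) = (\<Sum>i\<in>UNIV. V i x * pd i \<psi> x)"
      by eventually_elim (simp add: dpart_single)
    then have "(LINT x|lebesgue. (\<Sum>i\<in>UNIV. U x $ i * dpart [i] \<psi> x)) = (\<integral>x. (\<Sum>i\<in>UNIV. V i x * pd i \<psi> x) \<partial>lborel)"
      unfolding dpart_single using Uj bl[OF b] V b
      by (intro integral_lebesgue_eq borel_measurable_sum borel_measurable_times) auto
    also have "\<dots> = (\<Sum>i\<in>UNIV. \<integral>x. V i x * pd i \<psi> x \<partial>lborel)"
      by (intro Bochner_Integration.integral_sum tf_integrable_mult(2)[OF tf_pd[OF t] locint_power4D(1)[OF V L4]])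
    finally show ?thesis using w tf_test_fun[OF t] by (simp add: weak_NS_solution_def)
  qed
  show "(\<Sum>j\<in>UNIV. \<integral>x. V j x * laplacian (\<Phi> j) x \<partial>lborel) +
      (\<Sum>i\<in>UNIV. \<Sum>j\<in>UNIV. \<integral>x. V i x * V j x * pd i (\<Phi> j) x \<partial>lborel) = 0"
    if t: "\<And>j. tf s (\<Phi> j)" and d: "\<And>x. (\<Sum>j\<in>UNIV. pd j (\<Phi> j) x) = 0" for \<Phi>
  proof -
    have P: "(\<Sum>j\<in>UNIV. P (pd j (\<Phi> j))) = 0"
    proof (rule distribution_sum_zero[where s = s and f = "\<lambda>j. pd j (\<Phi> j)"])
      show "distribution P" using w by (simp add: weak_NS_solution_def)
      show "tf s (pd j (\<Phi> j))" for j by (rule tf_pd[OF t])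
    qed (rule d)
    have b: "pd i (\<Phi> j) \<in> borel_measurable borel" "laplacian (\<Phi> j) \<in> borel_measurable borel" for i j
      by (intro smooth_borel tf_smooth[OF tf_pd[OF t]], intro smooth_borel tf_smooth[OF tf_laplacian[OF t]])
    have aeA: "AE x in lborel. \<forall>j. U x $ j = V j x" by (rule eventually_all_finite[OF ae])
    have 1: "(LINT x|lebesgue. U x $ j * (- laplacian (\<Phi> j) x)) = - (\<integral>x. V j x * laplacian (\<Phi> j) x \<partial>lborel)" for j
    proof -
      have "AE x in lborel. U x $ j * (- laplacian (\<Phi> j) x) = V j x * (- laplacian (\<Phi> j) x)"
        using ae[of j] by eventually_elim simp
      then have "(LINT x|lebesgue. U x $ j * (- laplacian (\<Phi> j) x)) = (\<integral>x. V j x * (- laplacian (\<Phi> j) x) \<partial>lborel)"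
        using Uj bl[OF b(2)] V b
        by (intro integral_lebesgue_eq borel_measurable_times borel_measurable_uminus) auto
      then show ?thesis by simp
    qed
    have 2: "(LINT x|lebesgue. (\<Sum>i\<in>UNIV. U x $ i * U x $ j * dpart [i] (\<Phi> j) x)) = (\<Sum>i\<in>UNIV. \<integral>x. V i x * V j x * pd i (\<Phi> j) x \<partial>lborel)" for j
    proof -
      have "AE x in lborel. (\<Sum>i\<in>UNIV. U x $ i * U x $ j * dpart [i] (\<Phi> j) x) = (\<Sum>i\<in>UNIV. V i x * V j x * pd i (\<Phi> j) x)"
        using aeA by eventually_elim (simp add: dpart_single)
      then have "(LINT x|lebesgue. (\<Sum>i\<in>UNIV. U x $ i * U x $ j * dpart [i] (\<Phi> j) x)) = (\<integral>x. (\<Sum>i\<in>UNIV. V i x * V j x * pd i (\<Phi> j) x) \<partial>lborel)"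
        unfolding dpart_single using Uj bl[OF b(1)] V b
        by (intro integral_lebesgue_eq borel_measurable_sum borel_measurable_times) auto
      also have "\<dots> = (\<Sum>i\<in>UNIV. \<integral>x. V i x * V j x * pd i (\<Phi> j) x \<partial>lborel)"
        by (intro Bochner_Integration.integral_sum tf_integrable_mult(2)[OF tf_pd[OF t] locint_mult[OF V L4 V L4]])
      finally show ?thesis .
    qed
    have "(LINT x|lebesgue. U x $ j * (- laplacian (\<Phi> j) x))
        - (LINT x|lebesgue. (\<Sum>i\<in>UNIV. U x $ i * U x $ j * dpart [i] (\<Phi> j) x)) - P (dpart [j] (\<Phi> j)) = 0" for j
      using w tf_test_fun[OF t[of j]] unfolding weak_NS_solution_def by blast
    then have "- (\<integral>x. V j x * laplacian (\<Phi> j) x \<partial>lborel) - (\<Sum>i\<in>UNIV. \<integral>x. V i x * V j x * pd i (\<Phi> j) x \<partial>lborel) - P (pd j (\<Phi> j)) = 0" for j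
      unfolding 1 2 by (simp only: dpart_single)
    then have "(\<Sum>j\<in>UNIV. - (\<integral>x. V j x * laplacian (\<Phi> j) x \<partial>lborel) - (\<Sum>i\<in>UNIV. \<integral>x. V i x * V j x * pd i (\<Phi> j) x \<partial>lborel) - P (pd j (\<Phi> j))) = 0"
      by simp
    then show ?thesis
      using P sum.swap[of "\<lambda>i j. \<integral>x. V i x * V j x * pd i (\<Phi> j) x \<partial>lborel" UNIV UNIV]
      by (simp add: sum_subtractf sum_negf)
  qed
qed (use V L4 in auto)

theorem theorem1:
  fixes U :: "R3 \<Rightarrow> R3" and P :: "(R3 \<Rightarrow> real) \<Rightarrow> real" and r q :: real
  assumes "weak_NS_solution U P"
    and "9/2 < r" and "r \<le> q"
    and "in_lorentz r q U"
    and "\<exists>B. \<forall>R>1. R powr (2 - 9/r) * lorentz_norm r q (restrict_to (annulus (R/4) (2*R)) U) \<le> B"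
  shows "AE x in lebesgue. U x = 0"
proof -
  obtain B where "\<And>R. R > 1 \<Longrightarrow> R powr (2 - 9/r) * lorentz_norm r q (restrict_to (annulus (R/4) (2*R)) U) \<le> B"
    using assms(5) by blast
  moreover have "q > 0" using assms by simp
  ultimately obtain D \<gamma> where D: "D \<ge> 0" "0 < \<gamma>" "\<gamma> < 1/3" "\<And>\<rho>. \<rho> \<ge> 1 \<Longrightarrow> ball_mass U \<rho> \<le> ennreal (D * \<rho> powr \<gamma>)"
    using ball_mass_growth[OF assms(4,2)] by metis
  have Um: "U \<in> borel_measurable lebesgue" using assms(4) by (simp add: in_lorentz_def)
  have Uj: "(\<lambda>x. U x $ j) \<in> borel_measurable lebesgue" for j
    by (rule measurable_compose[OF Um borel_measurable_continuous_onI]) (intro continuous_intros)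
  \<comment> \<open>U is only Lebesgue measurable; the convolution estimates work with
    \<open>lborel\<close> and its product, hence the Borel representatives.\<close>
  have "\<forall>j. \<exists>g. g \<in> borel_measurable borel \<and> (AE x in lborel. U x $ j = g x)"
    using completion_ex_borel_measurable_real[OF Uj] by auto
  from choice[OF this] obtain V where "\<forall>j. V j \<in> borel_measurable borel \<and> (AE x in lborel. U x $ j = V j x)"
    by blast
  then have V: "\<And>j. V j \<in> borel_measurable borel" "\<And>j. AE x in lborel. U x $ j = V j x" by auto
  have mass: "(\<integral>\<^sup>+x. ennreal (indicator (cball 0 \<rho>) x * (V j x) ^ 4) \<partial>lborel) \<le> ennreal (D * \<rho> powr \<gamma>)" if \<rho>: "\<rho> \<ge> 1" for \<rho> j
  proof -
    have "(\<integral>\<^sup>+x. ennreal (indicator (cball 0 \<rho>) x * (V j x) ^ 4) \<partial>lborel) = (\<integral>\<^sup>+x. ennreal (indicator (cball 0 \<rho>) x * (V j x) ^ 4) \<partial>lebesgue)"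
      by (rule nn_integral_completion[symmetric])
    also have "\<dots> \<le> ball_mass U \<rho>"
      unfolding ball_mass_def
    proof (rule nn_integral_mono_AE)
      show "AE x in lebesgue. ennreal (indicator (cball 0 \<rho>) x * (V j x) ^ 4) \<le> ennreal (norm (U x) ^ 4) * indicator (cball 0 \<rho>) x"
        using AE_completion[OF V(2)[of j]]
      proof eventually_elim
        case (elim x)
        have "\<bar>U x $ j\<bar> ^ 4 \<le> norm (U x) ^ 4" by (intro power_mono component_le_norm_cart) auto
        then have "(V j x) ^ 4 \<le> norm (U x) ^ 4" unfolding elim by simp
        then show ?case by (auto simp: indicator_def intro: ennreal_leI)
      qed
    qed
    also have "\<dots> \<le> ennreal (D * \<rho> powr \<gamma>)" by (rule D(4)[OF \<rho>])
    finally show ?thesis .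
  qed
  have L4: "locint (\<lambda>x. (V j x) ^ 4)" for j
    unfolding locint_def
  proof (intro conjI allI)
    show "(\<lambda>x. (V j x) ^ 4) \<in> borel_measurable borel" using V(1) by simp
    fix s :: real
    show "integrable lborel (\<lambda>x. indicator (cball 0 s) x * (V j x) ^ 4)"
    proof (rule integrableI_nonneg)
      show "(\<lambda>x. indicator (cball 0 s) x * (V j x) ^ 4) \<in> borel_measurable lborel"
        using V(1) by (auto intro!: borel_measurable_times borel_measurable_indicator borel_measurable_power)
      have "(\<integral>\<^sup>+x. ennreal (indicator (cball 0 s) x * (V j x) ^ 4) \<partial>lborel) \<le> (\<integral>\<^sup>+x. ennreal (indicator (cball 0 (max 1 s)) x * (V j x) ^ 4) \<partial>lborel)"
        by (intro nn_integral_mono ennreal_leI) (auto simp: indicator_def)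
      also have "\<dots> \<le> ennreal (D * (max 1 s) powr \<gamma>)" by (rule mass) simp
      also have "\<dots> < \<infinity>" by simp
      finally show "(\<integral>\<^sup>+x. ennreal (indicator (cball 0 s) x * (V j x) ^ 4) \<partial>lborel) < \<infinity>" .
    qed auto
  qed
  interpret weak_flow V by (rule weak_flow_borel_version[OF assms(1) V L4])
  have b: "bint \<rho> (\<lambda>x. (V j x) ^ 4) \<le> D * \<rho> powr \<gamma>" if \<rho>: "\<rho> \<ge> 1" for \<rho> j
  proof -
    have "ennreal (bint \<rho> (\<lambda>x. (V j x) ^ 4)) = (\<integral>\<^sup>+x. ennreal (indicator (cball 0 \<rho>) x * (V j x) ^ 4) \<partial>lborel)"
      unfolding bint_def by (intro nn_integral_eq_integral[symmetric] bint_integrable L4) auto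
    also note mass[OF \<rho>]
    finally show ?thesis using D(1) by (simp add: ennreal_le_iff)
  qed
  \<comment> \<open>The solution of m^4 R^3 = R^\<gamma>: up to a constant, it bounds the
    fourth-power mean of U on B(R).\<close>
  define m where "m R = R powr ((\<gamma> - 3) / 4)" for R :: real
  have pw: "m R ^ k * R ^ l = R powr ((\<gamma> - 3) / 4 * real k + real l)" if "R > 0" for R k l
  proof -
    have "m R ^ k = m R powr real k" using that by (simp add: m_def powr_realpow)
    also have "\<dots> = R powr ((\<gamma> - 3) / 4 * real k)" unfolding m_def by (rule powr_powr)
    finally show ?thesis using that by (simp add: powr_add powr_realpow)
  qed
  have "AE x in lborel. V j x = 0" for j
  \<comment> \<open>The growth hypothesis of \<open>liouville\<close> refers to B(3R), which
    produces the factor 3^\<gamma>.\<close>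
  proof (rule liouville[where K = "D * 3 powr \<gamma>" and m = m])
    show "D * 3 powr \<gamma> \<ge> 0" using D by simp
    show "m R > 0" if "R \<ge> 1" for R using that by (simp add: m_def)
    show "bint (3 * R) (\<lambda>x. (V i x) ^ 4) \<le> D * 3 powr \<gamma> * m R ^ 4 * R ^ 3" if R: "R \<ge> 1" for R i
    proof -
      have "(\<gamma> - 3) / 4 * real 4 + real 3 = \<gamma>" by (simp add: field_simps)
      then have "m R ^ 4 * R ^ 3 = R powr \<gamma>" using pw[of R 4 3] R by simp
      then have e: "D * 3 powr \<gamma> * m R ^ 4 * R ^ 3 = D * (3 * R) powr \<gamma>" using R by (simp add: powr_mult mult.assoc)
      show ?thesis unfolding e using R by (intro b) simp
    qed
    have tz: "((\<lambda>R. R powr a) \<longlongrightarrow> 0) at_top" if "a < 0" for a :: real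
      using tendsto_neg_powr[OF that filterlim_ident] .
    show "(m \<longlongrightarrow> 0) at_top" unfolding m_def[abs_def] using D by (intro tz) simp
    \<comment> \<open>These are the powers m^2 R and m^3 R^2; the second decays exactly because
      \<gamma> < 1/3.\<close>
    have "((\<lambda>R. R powr ((\<gamma> - 1) / 2) + R powr ((3 * \<gamma> - 1) / 4)) \<longlongrightarrow> 0 + 0) at_top"
      using D by (intro tendsto_add tz) auto
    moreover have "\<forall>\<^sub>F R in at_top. R powr ((\<gamma> - 1) / 2) + R powr ((3 * \<gamma> - 1) / 4) = (m R)\<^sup>2 * R + m R ^ 3 * R\<^sup>2"
      using eventually_gt_at_top[of 0]
    proof eventually_elim
      case (elim R)
      have e: "(\<gamma> - 3) / 4 * real 2 + real 1 = (\<gamma> - 1) / 2" "(\<gamma> - 3) / 4 * real 3 + real 2 = (3 * \<gamma> - 1) / 4"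
        by (simp_all add: field_simps)
      show ?case using pw[OF elim, of 2 1] pw[OF elim, of 3 2] unfolding e by simp
    qed
    ultimately show "((\<lambda>R. (m R)\<^sup>2 * R + m R ^ 3 * R\<^sup>2) \<longlongrightarrow> 0) at_top"
      by (simp add: Lim_transform_eventually)
  qed
  then have "AE x in lborel. U x $ j = V j x \<and> V j x = 0" for j
    using V(2) by (intro AE_conjI)
  then have "AE x in lborel. \<forall>j. U x $ j = V j x \<and> V j x = 0"
    by (rule eventually_all_finite)
  then have "AE x in lborel. U x = 0" by eventually_elim (simp add: vec_eq_iff)
  then show ?thesis by (rule AE_completion)
qed

end
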